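(* Let $e$ be an idempotent in $A$, and let $B := A/AeA$. Then for every finite-dimensional $B$-module $M$ (regarded also as an $A$-module annihilated by $AeA$) the following are equivalent: (i) $M$ is $\tau_A$-regular; (ii) $M$ is $\tau_B$-regular.
   Context: $K$ is an algebraically closed field and $A=KQ/I$, where $Q=(Q_0,Q_1,s,t)$ is a finite quiver with $Q_0=\{1,\dots,n\}$ (an arrow $a$ goes from $s(a)$ to $t(a)$) and $I$ is an admissible ideal of $KQ$. Modules are finite-dimensional left modules; dimension vectors in $\mathbb{N}^n$ record the Jordan-Hölder multiplicities of the simple modules $S(1),\dots,S(n)$. For $\mathbf d\in\mathbb{N}^n$ let $\operatorname{rep}(Q,\mathbf d)=\prod_{a\in Q_1}\operatorname{Hom}_K(K^{d_{s(a)}},K^{d_{t(a)}})$ and let $\operatorname{mod}(A,\mathbf d)=\{M\in\operatorname{rep}(Q,\mathbf d)\mid IM=0\}$, with the conjugation action of $G_{\mathbf d}=\prod_i\operatorname{GL}_{d_i}(K)$; $\mathcal O_M$ is the orbit of $M$ (its points are the modules isomorphic to $M$). Let $\operatorname{mod}(B,\mathbf d)=\{M\in\operatorname{mod}(A,\mathbf d)\mid (AeA)M=0\}$. For $C\in\{A,B\}$ and $M\in\operatorname{mod}(C,\mathbf d)$ let $\operatorname{mod}_M(C,\mathbf d)$ be the union of all irreducible components of $\operatorname{mod}(C,\mathbf d)$ containing $M$, and put $c_C(M)=\dim\operatorname{mod}_M(C,\mathbf d)-\dim\mathcal O_M$ and $E_C(M)=\dim\operatorname{Hom}_C(M,\tau_C(M))$,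 where $\tau_C$ is the Auslander-Reiten translation for $C$. $M$ is called $\tau_C$-regular if $c_C(M)=E_C(M)$. *)

theory Defs
  imports
    "Graph_Theory.Graph_Theory"
    "Jordan_Normal_Form.VS_Connect"
    "HOL-Library.Poly_Mapping"
    "HOL-Library.Extended_Nat"
    "HOL-Algebra.QuotRing"
    "HOL-Algebra.Ideal_Product"
    "HOL-Analysis.Function_Topology"
begin

section \<open>Algebras and left modules\<close>

text \<open>
  A \<open>K\<close>-algebra with elements of type \<open>'c\<close> is a record of type \<open>('k, 'c) module\<close>: its ring
  operations together with the scalar multiplication by the field type \<open>'k\<close>.  A left module over
  it is a record of type \<open>('c, 'm) module\<close>, whose fields \<open>mult\<close> and \<open>one\<close> carry no meaning.
  The locale \<open>Module.module\<close> is about commutative rings only, so left modules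
  over arbitrary rings are introduced here.
\<close>

locale left_module = R?: ring R + M?: abelian_group M
  for R :: "('c, 'r) ring_scheme" (structure) and M :: "('c, 'm, 'x) module_scheme" (structure) +
  assumes act_closed: "\<lbrakk>c \<in> carrier R; x \<in> carrier M\<rbrakk> \<Longrightarrow> c \<odot>\<^bsub>M\<^esub> x \<in> carrier M"
    and act_l_distr: "\<lbrakk>c \<in> carrier R; c' \<in> carrier R; x \<in> carrier M\<rbrakk>
        \<Longrightarrow> (c \<oplus>\<^bsub>R\<^esub> c') \<odot>\<^bsub>M\<^esub> x = c \<odot>\<^bsub>M\<^esub> x \<oplus>\<^bsub>M\<^esub> c' \<odot>\<^bsub>M\<^esub> x"
    and act_r_distr: "\<lbrakk>c \<in> carrier R; x \<in> carrier M; y \<in> carrier M\<rbrakk>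
        \<Longrightarrow> c \<odot>\<^bsub>M\<^esub> (x \<oplus>\<^bsub>M\<^esub> y) = c \<odot>\<^bsub>M\<^esub> x \<oplus>\<^bsub>M\<^esub> c \<odot>\<^bsub>M\<^esub> y"
    and act_assoc: "\<lbrakk>c \<in> carrier R; c' \<in> carrier R; x \<in> carrier M\<rbrakk>
        \<Longrightarrow> (c \<otimes>\<^bsub>R\<^esub> c') \<odot>\<^bsub>M\<^esub> x = c \<odot>\<^bsub>M\<^esub> (c' \<odot>\<^bsub>M\<^esub> x)"
    and act_one: "x \<in> carrier M \<Longrightarrow> \<one>\<^bsub>R\<^esub> \<odot>\<^bsub>M\<^esub> x = x"

definition scalar_act :: "('k, 'c) module \<Rightarrow> ('c, 'm) module \<Rightarrow> 'k \<Rightarrow> 'm \<Rightarrow> 'm" where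
  "scalar_act C M k x = (k \<odot>\<^bsub>C\<^esub> \<one>\<^bsub>C\<^esub>) \<odot>\<^bsub>M\<^esub> x"

definition underlying_space :: "('k, 'c) module \<Rightarrow> ('c, 'm) module \<Rightarrow> ('k, 'm) module" where
  "underlying_space C M =
    \<lparr>carrier = carrier M, mult = undefined, one = undefined, zero = \<zero>\<^bsub>M\<^esub>, add = add M,
     smult = scalar_act C M\<rparr>"

definition fd_module :: "('k::field, 'c) module \<Rightarrow> ('c, 'm) module \<Rightarrow> bool" where
  "fd_module C M \<longleftrightarrow> left_module C M \<and> vectorspace.fin_dim class_ring (underlying_space C M)"

definition module_homs :: "('k, 'c) module \<Rightarrow> ('c, 'm) module \<Rightarrow> ('c, 'n) module \<Rightarrow> ('m \<Rightarrow> 'n) set" where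
  "module_homs C M N = {f \<in> carrier M \<rightarrow>\<^sub>E carrier N.
     (\<forall>x\<in>carrier M. \<forall>y\<in>carrier M. f (x \<oplus>\<^bsub>M\<^esub> y) = f x \<oplus>\<^bsub>N\<^esub> f y) \<and>
     (\<forall>c\<in>carrier C. \<forall>x\<in>carrier M. f (c \<odot>\<^bsub>M\<^esub> x) = c \<odot>\<^bsub>N\<^esub> f x)}"

definition hom_space ::
    "('k, 'c) module \<Rightarrow> ('c, 'm) module \<Rightarrow> ('c, 'n) module \<Rightarrow> ('k, 'm \<Rightarrow> 'n) module" where
  "hom_space C M N =
    \<lparr>carrier = module_homs C M N, mult = undefined, one = undefined,
     zero = (\<lambda>x\<in>carrier M. \<zero>\<^bsub>N\<^esub>),
     add = (\<lambda>f g. \<lambda>x\<in>carrier M. f x \<oplus>\<^bsub>N\<^esub> g x),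
     smult = (\<lambda>k f. \<lambda>x\<in>carrier M. scalar_act C N k (f x))\<rparr>"

definition left_submodule :: "('k, 'c) module \<Rightarrow> 'm set \<Rightarrow> ('c, 'm) module \<Rightarrow> bool" where
  "left_submodule C U M \<longleftrightarrow>
     additive_subgroup U M \<and> (\<forall>c\<in>carrier C. \<forall>x\<in>U. c \<odot>\<^bsub>M\<^esub> x \<in> U)"

definition quotient_module :: "('c, 'm) module \<Rightarrow> 'm set \<Rightarrow> ('c, 'm set) module" where
  "quotient_module M U =
    \<lparr>carrier = a_rcosets\<^bsub>M\<^esub> U, mult = undefined, one = undefined, zero = U, add = set_add M,
     smult = (\<lambda>c X. \<Union>x\<in>X. U +>\<^bsub>M\<^esub> (c \<odot>\<^bsub>M\<^esub> x))\<rparr>"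

definition quotient_algebra :: "('k, 'c) module \<Rightarrow> 'c set \<Rightarrow> ('k, 'c set) module" where
  "quotient_algebra C J =
     ring.extend (C Quot J) (module.fields (\<lambda>k X. \<Union>x\<in>X. J +>\<^bsub>C\<^esub> (k \<odot>\<^bsub>C\<^esub> x)))"

text \<open>
  A \<open>C\<close>-module annihilated by an ideal \<open>J\<close>, viewed as a module over \<open>C / J\<close>: a coset acts like any
  of its elements.
\<close>

definition factor_module :: "('c, 'm) module \<Rightarrow> ('c set, 'm) module" where
  "factor_module M =
    \<lparr>carrier = carrier M, mult = mult M, one = one M, zero = zero M, add = add M,
     smult = (\<lambda>X v. THE w. \<exists>x\<in>X. w = x \<odot>\<^bsub>M\<^esub> v)\<rparr>"

definition annihilates :: "'c set \<Rightarrow> ('c, 'm) module \<Rightarrow> bool" where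
  "annihilates J M \<longleftrightarrow> (\<forall>x\<in>J. \<forall>v\<in>carrier M. x \<odot>\<^bsub>M\<^esub> v = \<zero>\<^bsub>M\<^esub>)"

text \<open>The ideal \<open>AeA\<close>, consisting of all finite sums of elements \<open>a e b\<close>.\<close>

definition idempotent_ideal :: "('k, 'c) module \<Rightarrow> 'c \<Rightarrow> 'c set" where
  "idempotent_ideal A e = ideal_prod A {a \<otimes>\<^bsub>A\<^esub> e |a. a \<in> carrier A} (carrier A)"


section \<open>The Auslander-Reiten translation\<close>

text \<open>
  Every finite-dimensional \<open>C\<close>-module is a quotient of some \<open>C\<^sup>r\<close>, hence is isomorphic to a module
  whose elements have type \<open>nat \<Rightarrow> 'c\<close>.  So it is no restriction to test projectivity on modules of
  that type, and to take projective presentations there.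
\<close>

definition projective_module :: "('k::field, 'c) module \<Rightarrow> ('c, 'p) module \<Rightarrow> bool" where
  "projective_module C P \<longleftrightarrow> fd_module C P \<and>
     (\<forall>(X :: ('c, nat \<Rightarrow> 'c) module) (Y :: ('c, nat \<Rightarrow> 'c) module) g f.
        fd_module C X \<and> fd_module C Y \<and>
        g \<in> module_homs C X Y \<and> g ` carrier X = carrier Y \<and> f \<in> module_homs C P Y \<longrightarrow>
        (\<exists>h\<in>module_homs C P X. compose (carrier P) g h = f))"

definition projective_cover ::
    "('k::field, 'c) module \<Rightarrow> ('c, 'p) module \<Rightarrow> ('c, 'm) module \<Rightarrow> ('p \<Rightarrow> 'm) \<Rightarrow> bool" where
  "projective_cover C P M g \<longleftrightarrow>
     projective_module C P \<and> g \<in> module_homs C P M \<and> g ` carrier P = carrier M \<and>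
     (\<forall>U. left_submodule C U P \<and> U <+>\<^bsub>P\<^esub> a_kernel P M g = carrier P \<longrightarrow> U = carrier P)"

definition minimal_projective_presentation ::
    "('k::field, 'c) module \<Rightarrow> ('c, 'm) module \<Rightarrow>
     ('c, 'p) module \<times> ('p \<Rightarrow> 'q) \<times> ('c, 'q) module \<times> ('q \<Rightarrow> 'm) \<Rightarrow> bool" where
  "minimal_projective_presentation C M = (\<lambda>(P\<^sub>1, h, P\<^sub>0, g).
     projective_cover C P\<^sub>0 M g \<and>
     projective_cover C P\<^sub>1 (P\<^sub>0\<lparr>carrier := a_kernel P\<^sub>0 M g\<rparr>) h)"

text \<open>
  \<open>Hom\<^sub>C(P, C)\<close> is a right \<open>C\<close>-module by \<open>(f c)(x) = f(x) c\<close>.  Right modules are recorded with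
  \<open>smult c f = f c\<close>, so that \<open>smult (c c') f = smult c' (smult c f)\<close>.
\<close>

definition regular_module :: "('k, 'c) module \<Rightarrow> ('c, 'c) module" where
  "regular_module C =
    \<lparr>carrier = carrier C, mult = mult C, one = one C, zero = zero C, add = add C, smult = mult C\<rparr>"

definition algebra_dual :: "('k, 'c) module \<Rightarrow> ('c, 'p) module \<Rightarrow> ('c, 'p \<Rightarrow> 'c) module" where
  "algebra_dual C P =
    \<lparr>carrier = module_homs C P (regular_module C), mult = undefined, one = undefined,
     zero = (\<lambda>x\<in>carrier P. \<zero>\<^bsub>C\<^esub>),
     add = (\<lambda>f g. \<lambda>x\<in>carrier P. f x \<oplus>\<^bsub>C\<^esub> g x),
     smult = (\<lambda>c f. \<lambda>x\<in>carrier P. f x \<otimes>\<^bsub>C\<^esub> c)\<rparr>"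

text \<open>The cokernel of \<open>Hom\<^sub>C(h, C) : Hom\<^sub>C(P\<^sub>0, C) \<rightarrow> Hom\<^sub>C(P\<^sub>1, C)\<close>, a right \<open>C\<close>-module.\<close>

definition transpose_module ::
    "('k, 'c) module \<Rightarrow> ('c, 'p) module \<Rightarrow> ('p \<Rightarrow> 'q) \<Rightarrow> ('c, 'q) module \<Rightarrow> ('c, ('p \<Rightarrow> 'c) set) module" where
  "transpose_module C P\<^sub>1 h P\<^sub>0 =
     quotient_module (algebra_dual C P\<^sub>1)
       ((\<lambda>f. compose (carrier P\<^sub>1) f h) ` carrier (algebra_dual C P\<^sub>0))"

text \<open>The \<open>K\<close>-dual of a right \<open>C\<close>-module, a left \<open>C\<close>-module by \<open>(c \<phi>)(x) = \<phi>(x c)\<close>.\<close>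

definition field_dual :: "('k::field, 'c) module \<Rightarrow> ('c, 'n) module \<Rightarrow> ('c, 'n \<Rightarrow> 'k) module" where
  "field_dual C N =
    \<lparr>carrier = {\<phi> \<in> carrier N \<rightarrow>\<^sub>E UNIV.
       (\<forall>x\<in>carrier N. \<forall>y\<in>carrier N. \<phi> (x \<oplus>\<^bsub>N\<^esub> y) = \<phi> x + \<phi> y) \<and>
       (\<forall>k. \<forall>x\<in>carrier N. \<phi> (scalar_act C N k x) = k * \<phi> x)},
     mult = undefined, one = undefined,
     zero = (\<lambda>x\<in>carrier N. 0),
     add = (\<lambda>\<phi> \<psi>. \<lambda>x\<in>carrier N. \<phi> x + \<psi> x),
     smult = (\<lambda>c \<phi>. \<lambda>x\<in>carrier N. \<phi> (c \<odot>\<^bsub>N\<^esub> x))\<rparr>"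

text \<open>
  \<open>\<tau>\<^sub>C M = D Tr M\<close>, formed from some chosen minimal projective presentation of \<open>M\<close>; a different
  choice gives an isomorphic module.
\<close>

definition AR_translate ::
    "('k::field, 'c) module \<Rightarrow> ('c, 'm) module \<Rightarrow> ('c, ((nat \<Rightarrow> 'c) \<Rightarrow> 'c) set \<Rightarrow> 'k) module" where
  "AR_translate C M =
    (case (SOME pres :: ('c, nat \<Rightarrow> 'c) module \<times> ((nat \<Rightarrow> 'c) \<Rightarrow> (nat \<Rightarrow> 'c)) \<times>
                        ('c, nat \<Rightarrow> 'c) module \<times> ((nat \<Rightarrow> 'c) \<Rightarrow> 'm).
             minimal_projective_presentation C M pres) of
       (P\<^sub>1, h, P\<^sub>0, g) \<Rightarrow> field_dual C (transpose_module C P\<^sub>1 h P\<^sub>0))"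

definition E_invariant :: "('k::field, 'c) module \<Rightarrow> ('c, 'm) module \<Rightarrow> nat" where
  "E_invariant C M = vectorspace.dim class_ring (hom_space C M (AR_translate C M))"


section \<open>Path algebras\<close>

text \<open>
  A path is a triple \<open>(i, w, j)\<close> of its source, its arrows in the order in which they are
  traversed, and its target.  Since modules are left modules, the product \<open>p q\<close> of two paths is
  \<open>q\<close> followed by \<open>p\<close>.
\<close>

type_synonym 'q path = "nat \<times> 'q list \<times> nat"

definition paths :: "(nat, 'q) pre_digraph \<Rightarrow> 'q path set" where
  "paths Q = {(i, w, j). pre_digraph.awalk Q i w j}"

definition path_mult ::
    "('q path \<Rightarrow>\<^sub>0 'k::field) \<Rightarrow> ('q path \<Rightarrow>\<^sub>0 'k) \<Rightarrow> ('q path \<Rightarrow>\<^sub>0 'k)" where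
  "path_mult x y = (\<Sum>p\<in>Poly_Mapping.keys x. \<Sum>q\<in>Poly_Mapping.keys y.
     (case p of (j', u, k) \<Rightarrow> case q of (i, w, j) \<Rightarrow>
        if j = j' then Poly_Mapping.single (i, w @ u, k) (Poly_Mapping.lookup x p * Poly_Mapping.lookup y q) else 0))"

definition path_algebra :: "(nat, 'q) pre_digraph \<Rightarrow> ('k::field, 'q path \<Rightarrow>\<^sub>0 'k) module" where
  "path_algebra Q =
    \<lparr>carrier = {x. Poly_Mapping.keys x \<subseteq> paths Q}, mult = path_mult,
     one = (\<Sum>i\<in>verts Q. Poly_Mapping.single (i, [], i) 1),
     zero = 0, add = (+), smult = (\<lambda>k x. Poly_Mapping.map ((*) k) x)\<rparr>"

definition arrow_ideal :: "(nat, 'q) pre_digraph \<Rightarrow> ('q path \<Rightarrow>\<^sub>0 'k::field) set" where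
  "arrow_ideal Q =
     genideal (path_algebra Q) {Poly_Mapping.single (tail Q a, [a], head Q a) 1 |a. a \<in> arcs Q}"

primrec ideal_power :: "('c, 'r) ring_scheme \<Rightarrow> 'c set \<Rightarrow> nat \<Rightarrow> 'c set" where
  "ideal_power R J 0 = carrier R"
| "ideal_power R J (Suc m) = ideal_prod R (ideal_power R J m) J"

definition admissible_ideal :: "(nat, 'q) pre_digraph \<Rightarrow> ('q path \<Rightarrow>\<^sub>0 'k::field) set \<Rightarrow> bool" where
  "admissible_ideal Q I \<longleftrightarrow> ideal I (path_algebra Q) \<and>
     (\<exists>m\<ge>2. ideal_power (path_algebra Q) (arrow_ideal Q) m \<subseteq> I) \<and>
     I \<subseteq> ideal_power (path_algebra Q) (arrow_ideal Q) 2"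


section \<open>Varieties of representations\<close>

definition rep :: "(nat, 'q) pre_digraph \<Rightarrow> (nat \<Rightarrow> nat) \<Rightarrow> ('q \<Rightarrow> 'k::field mat) set" where
  "rep Q d = (\<Pi>\<^sub>E a\<in>arcs Q. carrier_mat (d (head Q a)) (d (tail Q a)))"

definition walk_act :: "('q \<Rightarrow> 'k::field mat) \<Rightarrow> 'q list \<Rightarrow> 'k vec \<Rightarrow> 'k vec" where
  "walk_act M w v = fold (\<lambda>a u. M a *\<^sub>v u) w v"

text \<open>
  The \<open>KQ\<close>-module \<open>\<Oplus>\<^sub>i K\<^bsup>d i\<^esup>\<close> given by \<open>M\<close>; the \<open>j\<close>-th component of \<open>x v\<close> is the sum of
  \<open>x\<^sub>p M\<^sub>p v\<^sub>i\<close> over all paths \<open>p\<close> with some source \<open>i\<close> and with target \<open>j\<close>.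
\<close>

definition rep_module ::
    "(nat, 'q) pre_digraph \<Rightarrow> (nat \<Rightarrow> nat) \<Rightarrow> ('q \<Rightarrow> 'k::field mat) \<Rightarrow>
     ('q path \<Rightarrow>\<^sub>0 'k, nat \<Rightarrow> 'k vec) module" where
  "rep_module Q d M =
    \<lparr>carrier = (\<Pi>\<^sub>E i\<in>verts Q. carrier_vec (d i)), mult = undefined, one = undefined,
     zero = (\<lambda>i\<in>verts Q. 0\<^sub>v (d i)),
     add = (\<lambda>v v'. \<lambda>i\<in>verts Q. v i + v' i),
     smult = (\<lambda>x v. \<lambda>j\<in>verts Q. vec (d j) (\<lambda>r.
       \<Sum>(i, w, j') \<in> {(i, w, j'). (i, w, j') \<in> Poly_Mapping.keys x \<and> j' = j}.
         Poly_Mapping.lookup x (i, w, j') * walk_act M w (v i) $ r))\<rparr>"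

text \<open>
  With \<open>A = KQ/I\<close> and \<open>B = A/AeA\<close>, the set \<open>mod_var\<close> is \<open>mod(A, d)\<close> and \<open>mod_of_rep\<close> makes its points
  into \<open>A\<close>-modules; \<open>quotient_mod_var\<close> is \<open>mod(B, d)\<close> and \<open>quotient_mod_of_rep\<close> makes its points into
  \<open>B\<close>-modules.
\<close>

definition mod_var ::
    "(nat, 'q) pre_digraph \<Rightarrow> ('q path \<Rightarrow>\<^sub>0 'k::field) set \<Rightarrow> (nat \<Rightarrow> nat) \<Rightarrow> ('q \<Rightarrow> 'k mat) set" where
  "mod_var Q I d = {M \<in> rep Q d. annihilates I (rep_module Q d M)}"

definition mod_of_rep ::
    "(nat, 'q) pre_digraph \<Rightarrow> (nat \<Rightarrow> nat) \<Rightarrow> ('q \<Rightarrow> 'k::field mat) \<Rightarrow>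
     (('q path \<Rightarrow>\<^sub>0 'k) set, nat \<Rightarrow> 'k vec) module" where
  "mod_of_rep Q d M = factor_module (rep_module Q d M)"

definition quotient_mod_var ::
    "(nat, 'q) pre_digraph \<Rightarrow> ('q path \<Rightarrow>\<^sub>0 'k::field) set \<Rightarrow> ('q path \<Rightarrow>\<^sub>0 'k) set \<Rightarrow>
     (nat \<Rightarrow> nat) \<Rightarrow> ('q \<Rightarrow> 'k mat) set" where
  "quotient_mod_var Q I e d =
     {M \<in> mod_var Q I d.
        annihilates (idempotent_ideal (quotient_algebra (path_algebra Q) I) e) (mod_of_rep Q d M)}"

definition quotient_mod_of_rep ::
    "(nat, 'q) pre_digraph \<Rightarrow> (nat \<Rightarrow> nat) \<Rightarrow> ('q \<Rightarrow> 'k::field mat) \<Rightarrow>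
     (('q path \<Rightarrow>\<^sub>0 'k) set set, nat \<Rightarrow> 'k vec) module" where
  "quotient_mod_of_rep Q d M = factor_module (mod_of_rep Q d M)"

definition rep_orbit ::
    "(nat, 'q) pre_digraph \<Rightarrow> (nat \<Rightarrow> nat) \<Rightarrow> ('q \<Rightarrow> 'k::field mat) \<Rightarrow> ('q \<Rightarrow> 'k mat) set" where
  "rep_orbit Q d M = {N. \<exists>g g'.
     (\<forall>i\<in>verts Q. g i \<in> carrier_mat (d i) (d i) \<and> g' i \<in> carrier_mat (d i) (d i) \<and>
        inverts_mat (g i) (g' i) \<and> inverts_mat (g' i) (g i)) \<and>
     N = (\<lambda>a\<in>arcs Q. g (head Q a) * M a * g' (tail Q a))}"


section \<open>Zariski topology and dimension\<close>

inductive_set rep_polys ::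
    "(nat, 'q) pre_digraph \<Rightarrow> (nat \<Rightarrow> nat) \<Rightarrow> (('q \<Rightarrow> 'k::field mat) \<Rightarrow> 'k) set"
  for Q :: "(nat, 'q) pre_digraph" and d :: "nat \<Rightarrow> nat" where
  const: "(\<lambda>M. c) \<in> rep_polys Q d"
| entry: "\<lbrakk>a \<in> arcs Q; i < d (head Q a); j < d (tail Q a)\<rbrakk> \<Longrightarrow> (\<lambda>M. M a $$ (i, j)) \<in> rep_polys Q d"
| sum: "\<lbrakk>f \<in> rep_polys Q d; g \<in> rep_polys Q d\<rbrakk> \<Longrightarrow> (\<lambda>M. f M + g M) \<in> rep_polys Q d"
| prod: "\<lbrakk>f \<in> rep_polys Q d; g \<in> rep_polys Q d\<rbrakk> \<Longrightarrow> (\<lambda>M. f M * g M) \<in> rep_polys Q d"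

definition zariski :: "(nat, 'q) pre_digraph \<Rightarrow> (nat \<Rightarrow> nat) \<Rightarrow> ('q \<Rightarrow> 'k::field mat) topology" where
  "zariski Q d = topology_generated_by {{M \<in> rep Q d. f M \<noteq> 0} |f. f \<in> rep_polys Q d}"

definition irreducible_in :: "'a topology \<Rightarrow> 'a set \<Rightarrow> bool" where
  "irreducible_in X S \<longleftrightarrow> S \<subseteq> topspace X \<and> S \<noteq> {} \<and>
     (\<forall>F G. closedin X F \<and> closedin X G \<and> S \<subseteq> F \<union> G \<longrightarrow> S \<subseteq> F \<or> S \<subseteq> G)"

definition irreducible_components :: "'a topology \<Rightarrow> 'a set set" where
  "irreducible_components X =
     {Z. irreducible_in X Z \<and> (\<forall>Z'. irreducible_in X Z' \<and> Z \<subseteq> Z' \<longrightarrow> Z' = Z)}"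

definition krull_dim :: "'a topology \<Rightarrow> enat" where
  "krull_dim X = Sup {enat n |n. \<exists>Z :: nat \<Rightarrow> 'a set.
     (\<forall>m\<le>n. closedin X (Z m) \<and> irreducible_in X (Z m)) \<and> (\<forall>m<n. Z m \<subset> Z (Suc m))}"

definition components_through ::
    "(nat, 'q) pre_digraph \<Rightarrow> (nat \<Rightarrow> nat) \<Rightarrow> ('q \<Rightarrow> 'k::field mat) set \<Rightarrow> ('q \<Rightarrow> 'k mat) \<Rightarrow>
     ('q \<Rightarrow> 'k mat) set" where
  "components_through Q d V M =
     \<Union> {Z \<in> irreducible_components (subtopology (zariski Q d) V). M \<in> Z}"

text \<open>
  Both dimensions are at most that of the affine space \<open>rep(Q, d)\<close>, so \<^const>\<open>the_enat\<close> is applied to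
  finite values only.
\<close>

definition c_invariant ::
    "(nat, 'q) pre_digraph \<Rightarrow> (nat \<Rightarrow> nat) \<Rightarrow> ('q \<Rightarrow> 'k::field mat) set \<Rightarrow> ('q \<Rightarrow> 'k mat) \<Rightarrow> int" where
  "c_invariant Q d V M =
     int (the_enat (krull_dim (subtopology (zariski Q d) (components_through Q d V M)))) -
     int (the_enat (krull_dim (subtopology (zariski Q d) (rep_orbit Q d M))))"


section \<open>\<open>\<tau>\<close>-regular modules\<close>

text \<open>
  Here \<open>V = mod(C, d)\<close>, and \<open>F\<close> turns its points into \<open>C\<close>-modules.
\<close>

definition tau_regular ::
    "(nat, 'q) pre_digraph \<Rightarrow> (nat \<Rightarrow> nat) \<Rightarrow> ('k::field, 'c) module \<Rightarrow> ('q \<Rightarrow> 'k mat) set \<Rightarrow>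
     (('q \<Rightarrow> 'k mat) \<Rightarrow> ('c, 'm) module) \<Rightarrow> ('q \<Rightarrow> 'k mat) \<Rightarrow> bool" where
  "tau_regular Q d C V F M \<longleftrightarrow> c_invariant Q d V M = int (E_invariant C (F M))"

end

theory Submission
  imports Defs "Jordan_Normal_Form.DL_Rank"
begin

text \<open>
  The module \<open>M\<close> is \<open>\<tau>\<close>-regular when two numbers agree: one is read off from the variety of modules of
  dimension vector \<open>d\<close>, the other from a minimal projective presentation of \<open>M\<close>.  Each of the two
  has the same value over \<open>A\<close> as over \<open>B = A/J\<close>, where \<open>J = AeA\<close>.

  \<^emph>\<open>Geometry.\<close>  Let \<open>e\<close> be the class of \<open>x\<close> in \<open>KQ\<close>, and let \<open>\<lambda>\<^sub>i\<close> be the coefficient of \<open>x\<close> at the trivial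
  path at the vertex \<open>i\<close>.  A power of the arrow ideal lies in \<open>I\<close>, so the part of \<open>x\<close> that is supported on
  paths of positive length acts nilpotently on every point of \<open>mod(A, d)\<close>.  If \<open>e\<close> kills one point,
  then multiplication by \<open>\<lambda>\<^sub>i\<close> on \<open>K\<^bsup>d i\<^esup>\<close> is nilpotent, whence \<open>\<lambda>\<^sub>i = 0\<close> whenever \<open>d i > 0\<close>
  (\<open>vertex_coefficient_zero\<close>).  This condition depends on \<open>d\<close> alone, and under it \<open>e\<close> acts nilpotently on
  every point of \<open>mod(A, d)\<close>; being idempotent, \<open>e\<close> acts as zero (\<open>idempotent_acts_zero\<close>).  Hence
  \<open>mod(B, d)\<close>, once it has a point, is all of \<open>mod(A, d)\<close> (\<open>quotient_mod_var_eq\<close>), and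
  \<open>c\<^sub>A(M) = c\<^sub>B(M)\<close>.

  \<^emph>\<open>Algebra.\<close>  Let \<open>h : P\<^sub>1 \<rightarrow> P\<^sub>0\<close> be a minimal projective presentation of \<open>M\<close> over \<open>C\<close>, so that \<open>\<tau>M\<close> is the
  \<open>K\<close>-dual of \<open>Tr M = coker Hom\<^sub>C(h, C)\<close>.  By the adjunction of Hom and tensor product, \<open>Hom\<^sub>C(M, \<tau>M)\<close> is
  the dual of \<open>Tr M \<otimes>\<^sub>C M\<close>, and the latter is the cokernel of \<open>Hom\<^sub>C(P\<^sub>0, M) \<rightarrow> Hom\<^sub>C(P\<^sub>1, M)\<close>, since
  \<open>Hom\<^sub>C(P, C) \<otimes>\<^sub>C M = Hom\<^sub>C(P, M)\<close> for a finitely generated projective \<open>P\<close> (\<open>hom_tau_dim\<close>).  So \<open>E\<^sub>C(M)\<close>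
  is the dimension of this cokernel.

  If \<open>P\<^sub>1 \<rightarrow> P\<^sub>0 \<rightarrow> M\<close> is a minimal presentation over \<open>A\<close>, then \<open>P\<^sub>1/JP\<^sub>1 \<rightarrow> P\<^sub>0/JP\<^sub>0 \<rightarrow> M\<close> is one over \<open>B\<close>
  (\<open>presentation_reduction\<close>).  The delicate point is that \<open>P\<^sub>1/JP\<^sub>1\<close> covers the kernel \<open>\<Omega>/JP\<^sub>0\<close> of the second
  map minimally, where \<open>\<Omega>\<close> is the kernel of \<open>P\<^sub>0 \<rightarrow> M\<close>: this needs \<open>JP\<^sub>0 = J\<Omega>\<close>, which holds because
  \<open>J = J\<^sup>2\<close> and \<open>JP\<^sub>0 \<subseteq> \<Omega>\<close>.  As \<open>J\<close> kills \<open>M\<close>, maps from \<open>P\<^sub>i\<close> to \<open>M\<close> are maps from \<open>P\<^sub>i/JP\<^sub>i\<close> to \<open>M\<close>, so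
  both cokernels are the same space and \<open>E\<^sub>A(M) = E\<^sub>B(M)\<close> (\<open>E_invariant_quotient\<close>).

  The translation is formed from a chosen minimal presentation, so such presentations have to exist;
  \<open>projective_cover_exists\<close> provides them over every finite-dimensional algebra.
\<close>

section \<open>Vector spaces\<close>

lemma additive_finsum:
  assumes "abelian_group G" "abelian_group H" and f: "f \<in> carrier G \<rightarrow> carrier H"
    and add: "\<And>x y. \<lbrakk>x \<in> carrier G; y \<in> carrier G\<rbrakk> \<Longrightarrow> f (x \<oplus>\<^bsub>G\<^esub> y) = f x \<oplus>\<^bsub>H\<^esub> f y"
    and "finite A" and "g \<in> A \<rightarrow> carrier G"
  shows "f (finsum G g A) = finsum H (\<lambda>i. f (g i)) A"
  using \<open>finite A\<close> \<open>g \<in> A \<rightarrow> carrier G\<close>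
proof (induction A)
  case empty
  interpret G: abelian_group G by fact
  interpret H: abelian_group H by fact
  have "f \<zero>\<^bsub>G\<^esub> \<oplus>\<^bsub>H\<^esub> f \<zero>\<^bsub>G\<^esub> = f \<zero>\<^bsub>G\<^esub>"
    using add[of "\<zero>\<^bsub>G\<^esub>" "\<zero>\<^bsub>G\<^esub>"] by simp
  moreover have "f \<zero>\<^bsub>G\<^esub> \<in> carrier H" using f by auto
  ultimately have "f \<zero>\<^bsub>G\<^esub> = \<zero>\<^bsub>H\<^esub>" by (metis H.add.r_cancel_one)
  then show ?case by simp
next
  case (insert i A)
  interpret G: abelian_group G by fact
  interpret H: abelian_group H by fact
  have "(\<lambda>i. f (g i)) \<in> insert i A \<rightarrow> carrier H" using insert.prems f by auto
  then show ?case
    using insert f by (subst G.finsum_insert, auto simp: add G.finsum_closed H.finsum_insert)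
qed

lemma additive_zero:
  assumes "abelian_group G" "abelian_group H" and "f \<in> carrier G \<rightarrow> carrier H"
    and "\<And>x y. \<lbrakk>x \<in> carrier G; y \<in> carrier G\<rbrakk> \<Longrightarrow> f (x \<oplus>\<^bsub>G\<^esub> y) = f x \<oplus>\<^bsub>H\<^esub> f y"
  shows "f \<zero>\<^bsub>G\<^esub> = \<zero>\<^bsub>H\<^esub>"
  using additive_finsum[OF assms, of "{}" "\<lambda>_. \<zero>\<^bsub>G\<^esub>"] assms(1,2)
  by (simp add: abelian_monoid.finsum_empty abelian_group_def)

lemma additive_minus:
  assumes "abelian_group G" "abelian_group H" and f: "f \<in> carrier G \<rightarrow> carrier H"
    and add: "\<And>x y. \<lbrakk>x \<in> carrier G; y \<in> carrier G\<rbrakk> \<Longrightarrow> f (x \<oplus>\<^bsub>G\<^esub> y) = f x \<oplus>\<^bsub>H\<^esub> f y"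
    and "x \<in> carrier G" "y \<in> carrier G"
  shows "f (x \<ominus>\<^bsub>G\<^esub> y) = f x \<ominus>\<^bsub>H\<^esub> f y"
proof -
  interpret G: abelian_group G by fact
  interpret H: abelian_group H by fact
  have fx: "f x \<in> carrier H" "f y \<in> carrier H" "f (\<ominus>\<^bsub>G\<^esub> y) \<in> carrier H"
    using f assms(5,6) by auto
  have "f (\<ominus>\<^bsub>G\<^esub> y) \<oplus>\<^bsub>H\<^esub> f y = \<zero>\<^bsub>H\<^esub>"
    using add[of "\<ominus>\<^bsub>G\<^esub> y" y] assms(6) additive_zero[OF assms(1-4)] by (simp add: G.l_neg)
  then have "f (\<ominus>\<^bsub>G\<^esub> y) = \<ominus>\<^bsub>H\<^esub> f y"
    using fx H.minus_equality by metis
  then show ?thesis using add[of x "\<ominus>\<^bsub>G\<^esub> y"] assms(5,6) by (simp add: G.minus_eq H.minus_eq)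
qed

lemma field_class_ring: "field (class_ring :: 'k::field ring)"
  by (rule class_field.field_axioms)

text \<open>
  The target is only a record of operations until \<open>T\<close> carries the vector space axioms over to it.
  For the dimensions it suffices that \<open>T\<close> matches finite spanning sets, since a dimension is the
  least size of one.
\<close>

lemma vectorspace_transport:
  fixes V :: "('k, 'v, 'x) module_scheme" and W :: "('k, 'w, 'y) module_scheme"
  assumes V: "vectorspace K V" and T: "bij_betw T (carrier V) (carrier W)"
    and add: "\<And>x y. \<lbrakk>x \<in> carrier V; y \<in> carrier V\<rbrakk> \<Longrightarrow> T (x \<oplus>\<^bsub>V\<^esub> y) = T x \<oplus>\<^bsub>W\<^esub> T y"
    and smult: "\<And>k x. \<lbrakk>k \<in> carrier K; x \<in> carrier V\<rbrakk> \<Longrightarrow> T (k \<odot>\<^bsub>V\<^esub> x) = k \<odot>\<^bsub>W\<^esub> T x"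
    and zero: "T \<zero>\<^bsub>V\<^esub> = \<zero>\<^bsub>W\<^esub>"
  shows "vectorspace K W" and "vectorspace.dim K V = vectorspace.dim K W"
proof -
  interpret V: vectorspace K V by fact
  have im: "carrier W = T ` carrier V" using T by (simp add: bij_betw_def)
  have mem: "T x \<in> carrier W" if "x \<in> carrier V" for x
    using im that by auto
  show W: "vectorspace K W"
  proof (rule vs_criteria)
    show "field K" by (rule V.field_axioms)
    show "\<zero>\<^bsub>W\<^esub> \<in> carrier W" using zero mem[of "\<zero>\<^bsub>V\<^esub>"] by simp
    show "\<forall>v w. v \<in> carrier W \<and> w \<in> carrier W \<longrightarrow> v \<oplus>\<^bsub>W\<^esub> w \<in> carrier W"
      unfolding im by (auto simp flip: add)
    show "\<forall>v\<in>carrier W. \<exists>neg_v\<in>carrier W. v \<oplus>\<^bsub>W\<^esub> neg_v = \<zero>\<^bsub>W\<^esub>"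
    proof
      fix w assume "w \<in> carrier W"
      then obtain x where "x \<in> carrier V" "w = T x" unfolding im by blast
      then show "\<exists>neg_v\<in>carrier W. w \<oplus>\<^bsub>W\<^esub> neg_v = \<zero>\<^bsub>W\<^esub>"
        using mem[of "\<ominus>\<^bsub>V\<^esub> x"] add[of x "\<ominus>\<^bsub>V\<^esub> x"] zero
        by (intro bexI[of _ "T (\<ominus>\<^bsub>V\<^esub> x)"]) (simp_all add: V.r_neg)
    qed
    show "\<forall>c v. c \<in> carrier K \<and> v \<in> carrier W \<longrightarrow> c \<odot>\<^bsub>W\<^esub> v \<in> carrier W"
      unfolding im by (auto simp flip: smult)
    show "\<forall>v w. v \<in> carrier W \<and> w \<in> carrier W \<longrightarrow> v \<oplus>\<^bsub>W\<^esub> w = w \<oplus>\<^bsub>W\<^esub> v"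
      unfolding im by (auto simp flip: add simp: V.a_comm)
    show "\<forall>v w x. v \<in> carrier W \<and> w \<in> carrier W \<and> x \<in> carrier W \<longrightarrow> v \<oplus>\<^bsub>W\<^esub> w \<oplus>\<^bsub>W\<^esub> x = v \<oplus>\<^bsub>W\<^esub> (w \<oplus>\<^bsub>W\<^esub> x)"
      unfolding im by (auto simp flip: add simp: V.a_assoc)
    show "\<forall>v\<in>carrier W. v \<oplus>\<^bsub>W\<^esub> \<zero>\<^bsub>W\<^esub> = v"
      unfolding im by (auto simp flip: add zero)
    show "\<forall>a b v. a \<in> carrier K \<and> b \<in> carrier K \<and> v \<in> carrier W \<longrightarrow> (a \<otimes>\<^bsub>K\<^esub> b) \<odot>\<^bsub>W\<^esub> v = a \<odot>\<^bsub>W\<^esub> (b \<odot>\<^bsub>W\<^esub> v)"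
      unfolding im by (auto simp flip: smult simp: V.smult_assoc1)
    show "\<forall>v\<in>carrier W. \<one>\<^bsub>K\<^esub> \<odot>\<^bsub>W\<^esub> v = v"
      unfolding im by (auto simp flip: smult)
    show "\<forall>a b v. a \<in> carrier K \<and> b \<in> carrier K \<and> v \<in> carrier W \<longrightarrow> (a \<oplus>\<^bsub>K\<^esub> b) \<odot>\<^bsub>W\<^esub> v = a \<odot>\<^bsub>W\<^esub> v \<oplus>\<^bsub>W\<^esub> b \<odot>\<^bsub>W\<^esub> v"
      unfolding im by (auto simp flip: smult add simp: V.smult_l_distr)
    show "\<forall>a v w. a \<in> carrier K \<and> v \<in> carrier W \<and> w \<in> carrier W \<longrightarrow> a \<odot>\<^bsub>W\<^esub> (v \<oplus>\<^bsub>W\<^esub> w) = a \<odot>\<^bsub>W\<^esub> v \<oplus>\<^bsub>W\<^esub> a \<odot>\<^bsub>W\<^esub> w"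
      unfolding im by (auto simp flip: smult add simp: V.smult_r_distr)
  qed
  interpret W: vectorspace K W by fact
  have "T \<in> module_hom K V W"
    unfolding module_hom_def using mem by (simp add: add smult)
  then have "mod_hom K V W T"
    using V.module_axioms W.module_axioms by (simp add: mod_hom_def mod_hom_axioms_def)
  then interpret T: linear_map K V W T
    by (simp add: linear_map_def V.vectorspace_axioms W.vectorspace_axioms)
  have inj: "inj_on T (carrier V)" using T by (auto simp: bij_betw_def)
  have span: "W.span (T ` A) = T ` V.span A" if A: "finite A" "A \<subseteq> carrier V" for A
  proof -
    have TA: "T ` A \<subseteq> carrier W" using that mem by auto
    have "w \<in> T ` V.span A" if w: "w \<in> W.span (T ` A)" for w
    proof -
      obtain a where "a \<in> T ` A \<rightarrow> carrier K" "w = W.lincomb a (T ` A)"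
        using w W.finite_span[OF _ TA] \<open>finite A\<close> by blast
      moreover from this have "V.lincomb (a \<circ> T) A \<in> V.span A"
        using \<open>finite A\<close> unfolding V.span_def by fastforce
      ultimately show ?thesis
        using T.lincomb_linear_image[OF inj \<open>A \<subseteq> carrier V\<close> _ \<open>finite A\<close>] by auto
    qed
    moreover have "T v \<in> W.span (T ` A)" if v: "v \<in> V.span A" for v
    proof -
      obtain a where a: "a \<in> A \<rightarrow> carrier K" "v = V.lincomb a A"
        using v V.finite_span[OF A] by blast
      define a' where "a' = a \<circ> inv_into (carrier V) T"
      have a'T: "a' (T x) = a x" if "x \<in> A" for x
        using that \<open>A \<subseteq> carrier V\<close> inj by (auto simp: a'_def subset_iff)
      have "V.lincomb (a' \<circ> T) A = V.lincomb a A"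
        by (rule V.lincomb_cong) (use a a'T \<open>A \<subseteq> carrier V\<close> in auto)
      moreover have a'A: "a' \<in> T ` A \<rightarrow> carrier K" using a a'T by auto
      ultimately have "T v = W.lincomb a' (T ` A)"
        using T.lincomb_linear_image[OF inj \<open>A \<subseteq> carrier V\<close> a'A \<open>finite A\<close>] a by simp
      then show ?thesis using a'A \<open>finite A\<close> unfolding W.span_def by blast
    qed
    ultimately show ?thesis by blast
  qed
  have "(\<exists>A. finite A \<and> card A = n \<and> A \<subseteq> carrier V \<and> V.span A = carrier V) \<longleftrightarrow>
        (\<exists>A. finite A \<and> card A = n \<and> A \<subseteq> carrier W \<and> W.span A = carrier W)" (is "?l \<longleftrightarrow> ?r") for n
  proof
    assume ?l
    then obtain A where A: "finite A" "card A = n" "A \<subseteq> carrier V" "V.span A = carrier V"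
      by (elim exE conjE)
    show ?r
    proof (intro exI conjI)
      show "finite (T ` A)" using A(1) by (rule finite_imageI)
      show "card (T ` A) = n" using card_image[OF inj_on_subset[OF inj A(3)]] A(2) by simp
      show "T ` A \<subseteq> carrier W" unfolding im using A(3) by (rule image_mono)
      show "W.span (T ` A) = carrier W" unfolding im span[OF A(1,3)] A(4) by (rule refl)
    qed
  next
    assume ?r
    then obtain A where A: "finite A" "card A = n" "A \<subseteq> carrier W" "W.span A = carrier W"
      by (elim exE conjE)
    obtain A' where A': "A' \<subseteq> carrier V" "A = T ` A'"
      using A(3) unfolding im subset_image_iff by blast
    have "inj_on T A'" by (rule inj_on_subset[OF inj A'(1)])
    then have "finite A'" "card A' = n"
      using A(1,2) A'(2) by (simp_all add: finite_image_iff card_image)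
    moreover have "V.span A' = carrier V"
    proof -
      have "T ` V.span A' = T ` carrier V" using span[OF \<open>finite A'\<close> A'(1)] A A' T by (simp add: bij_betw_def)
      moreover have "V.span A' \<subseteq> carrier V" using A'(1) V.span_is_subset2 by blast
      ultimately show ?thesis using inj by (meson inj_on_image_eq_iff order_refl)
    qed
    ultimately show ?l using A' by blast
  qed
  then show "vectorspace.dim K V = vectorspace.dim K W"
    unfolding V.dim_def W.dim_def by simp
qed

text \<open>
  Independent subsets of \<open>U\<close> stay independent in \<open>V\<close>, so their sizes are bounded by \<open>dim V\<close>; a maximal
  one is a basis of \<open>U\<close>, and it is a basis of \<open>V\<close> as soon as it has \<open>dim V\<close> elements.
\<close>

lemma fin_dim_subspace:
  assumes "vectorspace K V" "vectorspace.fin_dim K V" "submodule K U V"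
  shows "vectorspace.fin_dim K (V\<lparr>carrier := U\<rparr>)"
    and "vectorspace.dim K (V\<lparr>carrier := U\<rparr>) \<le> vectorspace.dim K V"
    and "vectorspace.dim K (V\<lparr>carrier := U\<rparr>) = vectorspace.dim K V \<Longrightarrow> U = carrier V"
proof -
  interpret V: vectorspace K V by fact
  have sub: "VectorSpace.subspace K U V" using assms by (simp add: VectorSpace.subspace_def)
  interpret U: vectorspace K "V.vs U" by (rule V.subspace_is_vs[OF sub])
  have UV: "U \<subseteq> carrier V" using assms(3) by (simp add: submodule_def)
  have li: "V.lin_indpt S" if "S \<subseteq> U" "U.lin_indpt S" for S
    using V.span_li_not_depend(2)[OF that(1) assms(3)] that(2) by simp
  have small: "finite S \<and> card S \<le> V.dim" if "S \<subseteq> U \<and> U.lin_indpt S" for S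
    using V.li_le_dim[OF assms(2), of S] li that UV by auto
  have e: "{} \<subseteq> U \<and> U.lin_indpt {}" using U.finite_lin_indpt2[of "{}"] by simp
  have "\<exists>A. finite A \<and> maximal A (\<lambda>S. S \<subseteq> U \<and> U.lin_indpt S)"
    by (rule maximal_exists[of "\<lambda>S. S \<subseteq> U \<and> U.lin_indpt S" V.dim "{}"]) (use small e in simp_all)
  then obtain A where A: "finite A" "maximal A (\<lambda>S. S \<subseteq> carrier (V.vs U) \<and> U.lin_indpt S)"
    by (metis V.carrier_vs_is_self)
  have B: "U.basis A" by (rule U.max_li_is_basis[OF A(2)])
  then show fd: "U.fin_dim" using A by (auto simp: U.basis_def U.fin_dim_def)
  show "U.dim \<le> V.dim" by (rule V.subspace_dim[OF sub assms(2) fd])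
  assume "U.dim = V.dim"
  then have "V.dim \<le> card A" using U.dim_basis[OF A(1) B] by simp
  moreover have "A \<subseteq> U" "U.lin_indpt A" using B by (auto simp: U.basis_def)
  ultimately have "V.basis A" using V.dim_li_is_basis[OF assms(2) A(1)] li UV by auto
  then have "carrier V = V.span A" by (simp add: V.basis_def)
  also have "\<dots> \<subseteq> U" by (rule V.span_is_subset[OF \<open>A \<subseteq> U\<close> assms(3)])
  finally show "U = carrier V" using UV by auto
qed

lemma surj_endo_inj:
  assumes "linear_map K V V T" "vectorspace.fin_dim K V" "T ` carrier V = carrier V"
  shows "inj_on T (carrier V)"
proof -
  interpret linear_map K V V T by fact
  have "V.dim + vectorspace.dim K (V.vs kerT) = V.dim"
    using rank_nullity[OF assms(2)] surj_imp_imT_carrier[OF assms(3)] by simp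
  then have d: "vectorspace.dim K (V.vs kerT) = 0" by simp
  have sub: "submodule K kerT V" by (rule ker_is_submodule)
  interpret ker: vectorspace K "V.vs kerT" by (rule V.subspace_is_vs[OF kerT_is_subspace])
  obtain \<beta> where "finite \<beta>" "ker.basis \<beta>"
    using ker.finite_basis_exists fin_dim_subspace(1)[OF V.vectorspace_axioms assms(2) sub] by blast
  then have "\<beta> = {}" using ker.dim_basis d by auto
  then have "carrier (V.vs kerT) = {\<zero>\<^bsub>V\<^esub>}"
    using \<open>ker.basis \<beta>\<close> by (simp add: ker.basis_def ker.span_empty)
  then show ?thesis by (rule Ke0_imp_inj)
qed

section \<open>Algebras over a field and their modules\<close>

locale K_algebra = ring C for C :: "('k::field, 'c) module" (structure) +
  assumes scale_closed: "x \<in> carrier C \<Longrightarrow> k \<odot> x \<in> carrier C"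
    and scale_l_distr: "x \<in> carrier C \<Longrightarrow> (k + l) \<odot> x = k \<odot> x \<oplus> l \<odot> x"
    and scale_r_distr: "\<lbrakk>x \<in> carrier C; y \<in> carrier C\<rbrakk> \<Longrightarrow> k \<odot> (x \<oplus> y) = k \<odot> x \<oplus> k \<odot> y"
    and scale_assoc: "x \<in> carrier C \<Longrightarrow> (k * l) \<odot> x = k \<odot> (l \<odot> x)"
    and scale_one: "x \<in> carrier C \<Longrightarrow> 1 \<odot> x = x"
    and scale_mult_left: "\<lbrakk>x \<in> carrier C; y \<in> carrier C\<rbrakk> \<Longrightarrow> (k \<odot> x) \<otimes> y = k \<odot> (x \<otimes> y)"
    and scale_mult_right: "\<lbrakk>x \<in> carrier C; y \<in> carrier C\<rbrakk> \<Longrightarrow> x \<otimes> (k \<odot> y) = k \<odot> (x \<otimes> y)"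

lemma abelian_group_cong:
  assumes "abelian_group G" "carrier H = carrier G" "add H = add G" "zero H = zero G"
  shows "abelian_group H"
proof -
  interpret G: abelian_group G by fact
  show ?thesis
  proof (rule abelian_groupI)
    fix x assume "x \<in> carrier H"
    then show "\<exists>y\<in>carrier H. y \<oplus>\<^bsub>H\<^esub> x = \<zero>\<^bsub>H\<^esub>"
      using G.l_neg G.a_inv_closed unfolding assms by blast
  qed (simp_all add: assms G.a_ac)
qed

lemma finsum_cong_record:
  assumes "carrier H = carrier G" "add H = add G" "zero H = zero G"
  shows "finsum H f A = finsum G f A"
  using assms unfolding finsum_def finprod_def by simp

text \<open>
  Right \<open>C\<close>-modules such as \<open>Hom\<^sub>C(P, C)\<close> and \<open>Tr M\<close> are treated as left modules over the opposite algebra.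
\<close>

definition opposite_algebra :: "('k, 'c) module \<Rightarrow> ('k, 'c) module" where
  "opposite_algebra C = C\<lparr>mult := \<lambda>x y. y \<otimes>\<^bsub>C\<^esub> x\<rparr>"

lemma opposite_simps [simp]:
  "carrier (opposite_algebra C) = carrier C" "zero (opposite_algebra C) = zero C"
  "add (opposite_algebra C) = add C" "one (opposite_algebra C) = one C"
  "smult (opposite_algebra C) = smult C" "x \<otimes>\<^bsub>opposite_algebra C\<^esub> y = y \<otimes>\<^bsub>C\<^esub> x"
  by (simp_all add: opposite_algebra_def)

lemma (in K_algebra) opposite: "K_algebra (opposite_algebra C)"
proof -
  have "abelian_group (opposite_algebra C)"
    by (rule abelian_group_cong[OF is_abelian_group]) simp_all
  moreover have "Group.monoid (opposite_algebra C)"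
    by (rule monoidI) (simp_all add: m_assoc)
  ultimately have "ring (opposite_algebra C)"
    by (rule ringI) (simp_all add: l_distr r_distr)
  then show ?thesis
    unfolding K_algebra_def K_algebra_axioms_def
    by (simp add: scale_closed scale_l_distr scale_r_distr scale_assoc scale_one
        scale_mult_left scale_mult_right)
qed

lemma scalar_act_opposite [simp]: "scalar_act (opposite_algebra C) N = scalar_act C N"
  by (intro ext) (simp add: scalar_act_def)

lemma left_moduleI:
  assumes "ring R" "abelian_group M"
    and "\<And>c x. \<lbrakk>c \<in> carrier R; x \<in> carrier M\<rbrakk> \<Longrightarrow> c \<odot>\<^bsub>M\<^esub> x \<in> carrier M"
    and "\<And>c c' x. \<lbrakk>c \<in> carrier R; c' \<in> carrier R; x \<in> carrier M\<rbrakk>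
        \<Longrightarrow> (c \<oplus>\<^bsub>R\<^esub> c') \<odot>\<^bsub>M\<^esub> x = c \<odot>\<^bsub>M\<^esub> x \<oplus>\<^bsub>M\<^esub> c' \<odot>\<^bsub>M\<^esub> x"
    and "\<And>c x y. \<lbrakk>c \<in> carrier R; x \<in> carrier M; y \<in> carrier M\<rbrakk>
        \<Longrightarrow> c \<odot>\<^bsub>M\<^esub> (x \<oplus>\<^bsub>M\<^esub> y) = c \<odot>\<^bsub>M\<^esub> x \<oplus>\<^bsub>M\<^esub> c \<odot>\<^bsub>M\<^esub> y"
    and "\<And>c c' x. \<lbrakk>c \<in> carrier R; c' \<in> carrier R; x \<in> carrier M\<rbrakk>
        \<Longrightarrow> (c \<otimes>\<^bsub>R\<^esub> c') \<odot>\<^bsub>M\<^esub> x = c \<odot>\<^bsub>M\<^esub> (c' \<odot>\<^bsub>M\<^esub> x)"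
    and "\<And>x. x \<in> carrier M \<Longrightarrow> \<one>\<^bsub>R\<^esub> \<odot>\<^bsub>M\<^esub> x = x"
  shows "left_module R M"
  using assms by (simp add: left_module_def left_module_axioms_def)

lemma left_moduleD:
  assumes "left_module R M"
  shows "ring R" "abelian_group M"
    and "\<And>c x. \<lbrakk>c \<in> carrier R; x \<in> carrier M\<rbrakk> \<Longrightarrow> c \<odot>\<^bsub>M\<^esub> x \<in> carrier M"
    and "\<And>c c' x. \<lbrakk>c \<in> carrier R; c' \<in> carrier R; x \<in> carrier M\<rbrakk>
        \<Longrightarrow> (c \<oplus>\<^bsub>R\<^esub> c') \<odot>\<^bsub>M\<^esub> x = c \<odot>\<^bsub>M\<^esub> x \<oplus>\<^bsub>M\<^esub> c' \<odot>\<^bsub>M\<^esub> x"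
    and "\<And>c x y. \<lbrakk>c \<in> carrier R; x \<in> carrier M; y \<in> carrier M\<rbrakk>
        \<Longrightarrow> c \<odot>\<^bsub>M\<^esub> (x \<oplus>\<^bsub>M\<^esub> y) = c \<odot>\<^bsub>M\<^esub> x \<oplus>\<^bsub>M\<^esub> c \<odot>\<^bsub>M\<^esub> y"
    and "\<And>c c' x. \<lbrakk>c \<in> carrier R; c' \<in> carrier R; x \<in> carrier M\<rbrakk>
        \<Longrightarrow> (c \<otimes>\<^bsub>R\<^esub> c') \<odot>\<^bsub>M\<^esub> x = c \<odot>\<^bsub>M\<^esub> (c' \<odot>\<^bsub>M\<^esub> x)"
    and "\<And>x. x \<in> carrier M \<Longrightarrow> \<one>\<^bsub>R\<^esub> \<odot>\<^bsub>M\<^esub> x = x"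
  using assms by (simp_all add: left_module_def left_module_axioms_def)

lemmas lm_closed = left_moduleD(3) and lm_l_distr = left_moduleD(4) and lm_r_distr = left_moduleD(5)
  and lm_assoc = left_moduleD(6) and lm_one = left_moduleD(7) and lm_group = left_moduleD(2)

lemma lm_add: "\<lbrakk>left_module R M; x \<in> carrier M; y \<in> carrier M\<rbrakk> \<Longrightarrow> x \<oplus>\<^bsub>M\<^esub> y \<in> carrier M"
  by (rule abelian_monoid.a_closed[OF abelian_group.axioms(1)[OF lm_group]])

lemma lm_zero: "left_module R M \<Longrightarrow> \<zero>\<^bsub>M\<^esub> \<in> carrier M"
  by (rule abelian_monoid.zero_closed[OF abelian_group.axioms(1)[OF lm_group]])

lemma lm_act_zero: "\<lbrakk>left_module R M; c \<in> carrier R\<rbrakk> \<Longrightarrow> c \<odot>\<^bsub>M\<^esub> \<zero>\<^bsub>M\<^esub> = \<zero>\<^bsub>M\<^esub>"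
  by (rule additive_zero[of M M "smult M c"]) (auto simp: lm_group lm_closed lm_r_distr)

lemma lm_zero_act: "\<lbrakk>left_module R M; x \<in> carrier M\<rbrakk> \<Longrightarrow> \<zero>\<^bsub>R\<^esub> \<odot>\<^bsub>M\<^esub> x = \<zero>\<^bsub>M\<^esub>"
  by (rule additive_zero[of R M "\<lambda>c. c \<odot>\<^bsub>M\<^esub> x"])
    (auto simp: lm_group lm_closed lm_l_distr ring.is_abelian_group left_moduleD(1))

lemma lm_act_finsum:
  "\<lbrakk>left_module R M; c \<in> carrier R; finite A; g \<in> A \<rightarrow> carrier M\<rbrakk>
    \<Longrightarrow> c \<odot>\<^bsub>M\<^esub> finsum M g A = finsum M (\<lambda>i. c \<odot>\<^bsub>M\<^esub> g i) A"
  by (rule additive_finsum[of M M "smult M c"]) (auto simp: lm_group lm_closed lm_r_distr)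

lemma lm_finsum: "\<lbrakk>left_module R M; g \<in> A \<rightarrow> carrier M\<rbrakk> \<Longrightarrow> finsum M g A \<in> carrier M"
  by (rule abelian_monoid.finsum_closed[OF abelian_group.axioms(1)[OF lm_group]])

lemma module_homsI:
  assumes "\<And>x. x \<in> carrier M \<Longrightarrow> f x \<in> carrier N" "f \<in> extensional (carrier M)"
    and "\<And>x y. \<lbrakk>x \<in> carrier M; y \<in> carrier M\<rbrakk> \<Longrightarrow> f (x \<oplus>\<^bsub>M\<^esub> y) = f x \<oplus>\<^bsub>N\<^esub> f y"
    and "\<And>c x. \<lbrakk>c \<in> carrier C; x \<in> carrier M\<rbrakk> \<Longrightarrow> f (c \<odot>\<^bsub>M\<^esub> x) = c \<odot>\<^bsub>N\<^esub> f x"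
  shows "f \<in> module_homs C M N"
  using assms by (auto simp: module_homs_def PiE_def)

lemma homs_closed: "\<lbrakk>f \<in> module_homs C M N; x \<in> carrier M\<rbrakk> \<Longrightarrow> f x \<in> carrier N"
  by (auto simp: module_homs_def)

lemma homs_ext: "f \<in> module_homs C M N \<Longrightarrow> f \<in> extensional (carrier M)"
  by (auto simp: module_homs_def PiE_def)

lemma homs_add:
  "\<lbrakk>f \<in> module_homs C M N; x \<in> carrier M; y \<in> carrier M\<rbrakk> \<Longrightarrow> f (x \<oplus>\<^bsub>M\<^esub> y) = f x \<oplus>\<^bsub>N\<^esub> f y"
  by (auto simp: module_homs_def)

lemma homs_act:
  "\<lbrakk>f \<in> module_homs C M N; c \<in> carrier C; x \<in> carrier M\<rbrakk> \<Longrightarrow> f (c \<odot>\<^bsub>M\<^esub> x) = c \<odot>\<^bsub>N\<^esub> f x"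
  by (auto simp: module_homs_def)

lemma homs_eqI:
  "\<lbrakk>f \<in> module_homs C M N; g \<in> module_homs C M N; \<And>x. x \<in> carrier M \<Longrightarrow> f x = g x\<rbrakk> \<Longrightarrow> f = g"
  by (rule extensionalityI[OF homs_ext homs_ext])

lemma homs_funcset: "f \<in> module_homs C M N \<Longrightarrow> f \<in> carrier M \<rightarrow> carrier N"
  by (auto simp: module_homs_def)

lemma homs_zero:
  "\<lbrakk>f \<in> module_homs C M N; abelian_group M; abelian_group N\<rbrakk> \<Longrightarrow> f \<zero>\<^bsub>M\<^esub> = \<zero>\<^bsub>N\<^esub>"
  by (rule additive_zero[of M N f]) (auto simp: homs_closed homs_add)

lemma homs_minus:
  "\<lbrakk>f \<in> module_homs C M N; abelian_group M; abelian_group N; x \<in> carrier M; y \<in> carrier M\<rbrakk>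
    \<Longrightarrow> f (x \<ominus>\<^bsub>M\<^esub> y) = f x \<ominus>\<^bsub>N\<^esub> f y"
  by (rule additive_minus[of M N f]) (auto simp: homs_closed homs_add)

lemma homs_finsum:
  "\<lbrakk>f \<in> module_homs C M N; abelian_group M; abelian_group N; finite A; g \<in> A \<rightarrow> carrier M\<rbrakk>
    \<Longrightarrow> f (finsum M g A) = finsum N (\<lambda>i. f (g i)) A"
  by (rule additive_finsum[of M N f]) (auto simp: homs_closed homs_add)

lemma homs_compose:
  assumes "f \<in> module_homs C M N" "g \<in> module_homs C N L" "abelian_group M"
    and "\<And>c x. \<lbrakk>c \<in> carrier C; x \<in> carrier M\<rbrakk> \<Longrightarrow> c \<odot>\<^bsub>M\<^esub> x \<in> carrier M"
  shows "compose (carrier M) g f \<in> module_homs C M L"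
proof (rule module_homsI)
  interpret M: abelian_group M by fact
  show "compose (carrier M) g f (x \<oplus>\<^bsub>M\<^esub> y) = compose (carrier M) g f x \<oplus>\<^bsub>L\<^esub> compose (carrier M) g f y"
    if "x \<in> carrier M" "y \<in> carrier M" for x y
    using that assms(1,2) by (simp add: compose_eq homs_closed homs_add)
  show "compose (carrier M) g f (c \<odot>\<^bsub>M\<^esub> x) = c \<odot>\<^bsub>L\<^esub> compose (carrier M) g f x"
    if "c \<in> carrier C" "x \<in> carrier M" for c x
    using that assms by (simp add: compose_eq homs_closed homs_act)
qed (use assms in \<open>auto simp: compose_eq homs_closed\<close>)

context K_algebra
begin

lemma scal: "k \<odot> \<one> \<in> carrier C" by (simp add: scale_closed)

lemma scal_comm: "c \<in> carrier C \<Longrightarrow> (k \<odot> \<one>) \<otimes> c = c \<otimes> (k \<odot> \<one>)"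
  by (simp add: scale_mult_left scale_mult_right)

lemma scalar_act_closed: "\<lbrakk>left_module C M; x \<in> carrier M\<rbrakk> \<Longrightarrow> scalar_act C M k x \<in> carrier M"
  by (simp add: scalar_act_def lm_closed scal)

lemma scalar_act_r_distr:
  "\<lbrakk>left_module C M; x \<in> carrier M; y \<in> carrier M\<rbrakk>
    \<Longrightarrow> scalar_act C M k (x \<oplus>\<^bsub>M\<^esub> y) = scalar_act C M k x \<oplus>\<^bsub>M\<^esub> scalar_act C M k y"
  by (simp add: scalar_act_def lm_r_distr scal)

lemma scalar_act_l_distr:
  "\<lbrakk>left_module C M; x \<in> carrier M\<rbrakk>
    \<Longrightarrow> scalar_act C M (k + l) x = scalar_act C M k x \<oplus>\<^bsub>M\<^esub> scalar_act C M l x"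
  by (simp add: scalar_act_def scale_l_distr lm_l_distr scal)

lemma scalar_act_assoc:
  "\<lbrakk>left_module C M; x \<in> carrier M\<rbrakk>
    \<Longrightarrow> scalar_act C M (k * l) x = scalar_act C M k (scalar_act C M l x)"
proof -
  assume M: "left_module C M" and x: "x \<in> carrier M"
  have "(k * l) \<odot> \<one> = (k \<odot> \<one>) \<otimes> (l \<odot> \<one>)"
    by (simp add: scale_assoc scale_mult_left scale_closed)
  then show ?thesis using lm_assoc[OF M scal scal x] by (simp add: scalar_act_def)
qed

lemma scalar_act_one: "\<lbrakk>left_module C M; x \<in> carrier M\<rbrakk> \<Longrightarrow> scalar_act C M 1 x = x"
  by (simp add: scalar_act_def scale_one lm_one)

lemma scalar_act_act:
  "\<lbrakk>left_module C M; x \<in> carrier M; c \<in> carrier C\<rbrakk>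
    \<Longrightarrow> scalar_act C M k (c \<odot>\<^bsub>M\<^esub> x) = c \<odot>\<^bsub>M\<^esub> scalar_act C M k x"
  by (simp add: scalar_act_def scal scal_comm flip: lm_assoc)

lemma homs_scalar:
  "\<lbrakk>f \<in> module_homs C M N; x \<in> carrier M\<rbrakk> \<Longrightarrow> f (scalar_act C M k x) = scalar_act C N k (f x)"
  by (simp add: scalar_act_def homs_act scal)

lemma underlying_simps [simp]:
  "carrier (underlying_space C M) = carrier M" "zero (underlying_space C M) = zero M"
  "add (underlying_space C M) = add M" "smult (underlying_space C M) = scalar_act C M"
  by (simp_all add: underlying_space_def)

lemma underlying_vectorspace:
  assumes M: "left_module C M"
  shows "vectorspace class_ring (underlying_space C M)"
proof -
  interpret M: abelian_group M by (rule lm_group[OF M])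
  have "\<forall>v\<in>carrier M. \<exists>w\<in>carrier M. v \<oplus>\<^bsub>M\<^esub> w = \<zero>\<^bsub>M\<^esub>"
    using M.r_neg M.a_inv_closed by blast
  then show ?thesis
    by (intro vs_criteria field_class_ring)
       (auto simp: M.a_ac scalar_act_closed[OF M] scalar_act_r_distr[OF M]
         scalar_act_l_distr[OF M] scalar_act_assoc[OF M] scalar_act_one[OF M])
qed

end

text \<open>
  Closure under negatives comes from the action of \<open>-1\<close>.
\<close>

lemma left_submoduleI:
  assumes M: "left_module C M" and "U \<subseteq> carrier M" "\<zero>\<^bsub>M\<^esub> \<in> U"
    and "\<And>x y. \<lbrakk>x \<in> U; y \<in> U\<rbrakk> \<Longrightarrow> x \<oplus>\<^bsub>M\<^esub> y \<in> U"
    and act: "\<And>c x. \<lbrakk>c \<in> carrier C; x \<in> U\<rbrakk> \<Longrightarrow> c \<odot>\<^bsub>M\<^esub> x \<in> U"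
  shows "left_submodule C U M"
proof -
  interpret R: ring C by (rule left_moduleD(1)[OF M])
  interpret M: abelian_group M by (rule lm_group[OF M])
  have neg: "\<ominus>\<^bsub>M\<^esub> x \<in> U" if "x \<in> U" for x
  proof -
    have x: "x \<in> carrier M" using that assms(2) by auto
    have "(\<ominus>\<^bsub>C\<^esub> \<one>\<^bsub>C\<^esub>) \<odot>\<^bsub>M\<^esub> x \<oplus>\<^bsub>M\<^esub> x = (\<ominus>\<^bsub>C\<^esub> \<one>\<^bsub>C\<^esub> \<oplus>\<^bsub>C\<^esub> \<one>\<^bsub>C\<^esub>) \<odot>\<^bsub>M\<^esub> x"
      using x by (simp add: lm_l_distr[OF M] lm_one[OF M])
    also have "\<dots> = \<zero>\<^bsub>M\<^esub>" using x by (simp add: R.l_neg lm_zero_act[OF M])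
    finally have "\<ominus>\<^bsub>M\<^esub> x = (\<ominus>\<^bsub>C\<^esub> \<one>\<^bsub>C\<^esub>) \<odot>\<^bsub>M\<^esub> x"
      using x by (intro M.minus_equality) (simp_all add: lm_closed[OF M])
    then show ?thesis using act[OF _ that] by simp
  qed
  have "subgroup U (add_monoid M)"
    by (rule group.subgroupI[OF M.a_group])
       (use assms neg in \<open>auto simp: a_inv_def\<close>)
  then show ?thesis
    using act by (simp add: left_submodule_def additive_subgroup_def)
qed

lemma left_submoduleD:
  assumes "left_submodule C U M"
  shows "U \<subseteq> carrier M" "\<zero>\<^bsub>M\<^esub> \<in> U" "additive_subgroup U M"
    "\<And>x y. \<lbrakk>x \<in> U; y \<in> U\<rbrakk> \<Longrightarrow> x \<oplus>\<^bsub>M\<^esub> y \<in> U"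
    "\<And>c x. \<lbrakk>c \<in> carrier C; x \<in> U\<rbrakk> \<Longrightarrow> c \<odot>\<^bsub>M\<^esub> x \<in> U"
proof -
  have U: "additive_subgroup U M" using assms by (simp add: left_submodule_def)
  show "additive_subgroup U M" by (rule U)
  show "U \<subseteq> carrier M" by (rule additive_subgroup.a_subset[OF U])
  show "\<zero>\<^bsub>M\<^esub> \<in> U" by (rule additive_subgroup.zero_closed[OF U])
  show "x \<oplus>\<^bsub>M\<^esub> y \<in> U" if "x \<in> U" "y \<in> U" for x y by (rule additive_subgroup.a_closed[OF U that])
  show "c \<odot>\<^bsub>M\<^esub> x \<in> U" if "c \<in> carrier C" "x \<in> U" for c x
    using assms that by (simp add: left_submodule_def)
qed

lemma left_submodule_left_module:
  assumes M: "left_module C M" and U: "left_submodule C U M"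
  shows "left_module C (M\<lparr>carrier := U\<rparr>)"
proof -
  interpret M: abelian_group M by (rule lm_group[OF M])
  interpret R: ring C by (rule left_moduleD(1)[OF M])
  interpret U: additive_subgroup U M by (rule left_submoduleD(3)[OF U])
  note UM = left_submoduleD(1)[OF U, THEN subsetD]
  have neg: "\<ominus>\<^bsub>M\<^esub> x \<in> U" if "x \<in> U" for x
    using that U.a_subgroup subgroup.m_inv_closed by (fastforce simp: a_inv_def)
  have "abelian_group (M\<lparr>carrier := U\<rparr>)"
  proof (rule abelian_groupI)
    fix x assume "x \<in> carrier (M\<lparr>carrier := U\<rparr>)"
    then show "\<exists>y\<in>carrier (M\<lparr>carrier := U\<rparr>). y \<oplus>\<^bsub>M\<lparr>carrier := U\<rparr>\<^esub> x = \<zero>\<^bsub>M\<lparr>carrier := U\<rparr>\<^esub>"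
      using neg UM by (intro bexI[of _ "\<ominus>\<^bsub>M\<^esub> x"]) (simp_all add: M.l_neg)
  qed (use UM U.zero_closed U.a_closed in \<open>auto simp: M.a_ac\<close>)
  then show ?thesis
    by (intro left_moduleI R.ring_axioms)
       (use UM left_submoduleD(5)[OF U] M in
         \<open>auto simp: lm_l_distr lm_r_distr lm_assoc lm_one\<close>)
qed

lemma quotient_simps [simp]:
  "carrier (quotient_module M U) = a_rcosets\<^bsub>M\<^esub> U" "zero (quotient_module M U) = U"
  "add (quotient_module M U) = set_add M"
  by (simp_all add: quotient_module_def)

lemma
  fixes M :: "('c, 'b) module"
  assumes M: "left_module C M" and U: "left_submodule C U M"
  shows quotient_act: "\<lbrakk>c \<in> carrier C; x \<in> carrier M\<rbrakk>
      \<Longrightarrow> c \<odot>\<^bsub>quotient_module M U\<^esub> (U +>\<^bsub>M\<^esub> x) = U +>\<^bsub>M\<^esub> (c \<odot>\<^bsub>M\<^esub> x)"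
    and quotient_add: "\<lbrakk>x \<in> carrier M; y \<in> carrier M\<rbrakk>
      \<Longrightarrow> (U +>\<^bsub>M\<^esub> x) \<oplus>\<^bsub>quotient_module M U\<^esub> (U +>\<^bsub>M\<^esub> y) = U +>\<^bsub>M\<^esub> (x \<oplus>\<^bsub>M\<^esub> y)"
    and quotient_carrier: "a_rcosets\<^bsub>M\<^esub> U = (\<lambda>x. U +>\<^bsub>M\<^esub> x) ` carrier M"
    and quotient_eq_zero: "x \<in> U \<Longrightarrow> U +>\<^bsub>M\<^esub> x = U"
    and quotient_mem: "x \<in> carrier M \<Longrightarrow> y \<in> U +>\<^bsub>M\<^esub> x \<longleftrightarrow> (\<exists>u\<in>U. y = u \<oplus>\<^bsub>M\<^esub> x)"
    and quotient_self: "x \<in> carrier M \<Longrightarrow> x \<in> U +>\<^bsub>M\<^esub> x"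
    and quotient_left_module: "left_module C (quotient_module M U)"
proof -
  interpret M: abelian_group M by (rule lm_group[OF M])
  interpret R: ring C by (rule left_moduleD(1)[OF M])
  interpret U: abelian_subgroup U M
    by (rule abelian_subgroupI3[OF left_submoduleD(3)[OF U] lm_group[OF M]])
  note UM = left_submoduleD(1)[OF U, THEN subsetD]
  show mem: "y \<in> U +>\<^bsub>M\<^esub> x \<longleftrightarrow> (\<exists>u\<in>U. y = u \<oplus>\<^bsub>M\<^esub> x)" if "x \<in> carrier M" for x y
    by (auto simp: a_r_coset_def')
  show act: "c \<odot>\<^bsub>quotient_module M U\<^esub> (U +>\<^bsub>M\<^esub> x) = U +>\<^bsub>M\<^esub> (c \<odot>\<^bsub>M\<^esub> x)"
    if "c \<in> carrier C" "x \<in> carrier M" for c x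
  proof -
    have "U +>\<^bsub>M\<^esub> (c \<odot>\<^bsub>M\<^esub> y) = U +>\<^bsub>M\<^esub> (c \<odot>\<^bsub>M\<^esub> x)" if y: "y \<in> U +>\<^bsub>M\<^esub> x" for y
    proof -
      obtain u where u: "u \<in> U" "y = u \<oplus>\<^bsub>M\<^esub> x" using y mem \<open>x \<in> carrier M\<close> by blast
      have "c \<odot>\<^bsub>M\<^esub> y = c \<odot>\<^bsub>M\<^esub> u \<oplus>\<^bsub>M\<^esub> c \<odot>\<^bsub>M\<^esub> x"
        using u UM \<open>c \<in> carrier C\<close> \<open>x \<in> carrier M\<close> by (simp add: lm_r_distr[OF M])
      then have "c \<odot>\<^bsub>M\<^esub> y \<in> U +>\<^bsub>M\<^esub> (c \<odot>\<^bsub>M\<^esub> x)"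
        using mem[OF lm_closed[OF M \<open>c \<in> carrier C\<close> \<open>x \<in> carrier M\<close>]]
          left_submoduleD(5)[OF U \<open>c \<in> carrier C\<close> u(1)] by blast
      then show ?thesis
        by (rule U.a_repr_independence'[symmetric]) (simp add: lm_closed[OF M] that \<open>c \<in> carrier C\<close> \<open>x \<in> carrier M\<close>)
    qed
    then have "(\<Union>y\<in>U +>\<^bsub>M\<^esub> x. U +>\<^bsub>M\<^esub> (c \<odot>\<^bsub>M\<^esub> y)) = (\<Union>y\<in>U +>\<^bsub>M\<^esub> x. U +>\<^bsub>M\<^esub> (c \<odot>\<^bsub>M\<^esub> x))"
      by (rule SUP_cong[OF refl])
    moreover have "U +>\<^bsub>M\<^esub> x \<noteq> {}" using U.a_rcos_self[OF \<open>x \<in> carrier M\<close>] by blast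
    ultimately show ?thesis by (simp add: quotient_module_def)
  qed
  show add: "(U +>\<^bsub>M\<^esub> x) \<oplus>\<^bsub>quotient_module M U\<^esub> (U +>\<^bsub>M\<^esub> y) = U +>\<^bsub>M\<^esub> (x \<oplus>\<^bsub>M\<^esub> y)"
    if "x \<in> carrier M" "y \<in> carrier M" for x y
    using U.a_rcos_sum[OF that] by simp
  show car: "a_rcosets\<^bsub>M\<^esub> U = (\<lambda>x. U +>\<^bsub>M\<^esub> x) ` carrier M"
    unfolding A_RCOSETS_def' a_r_coset_def' by blast
  show "U +>\<^bsub>M\<^esub> x = U" if "x \<in> U" for x using U.a_rcos_const[OF that] .
  show "x \<in> U +>\<^bsub>M\<^esub> x" if "x \<in> carrier M" for x using U.a_rcos_self that by blast
  have grp: "abelian_group (quotient_module M U)"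
  proof (rule abelian_group_cong)
    show "abelian_group (\<lparr>carrier = a_rcosets\<^bsub>M\<^esub> U, mult = undefined, one = undefined, zero = U,
        add = set_add M\<rparr> :: 'b set ring)"
      by (rule comm_group_abelian_groupI)
         (simp add: U.a_factorgroup_is_comm_group[unfolded A_FactGroup_def'])
  qed simp_all
  have obt: "\<exists>x\<in>carrier M. X = U +>\<^bsub>M\<^esub> x" if "X \<in> carrier (quotient_module M U)" for X
    using that car by auto
  have qc: "U +>\<^bsub>M\<^esub> x \<in> carrier (quotient_module M U)" if "x \<in> carrier M" for x
    using that car by auto
  show "left_module C (quotient_module M U)"
  proof (rule left_moduleI[OF R.ring_axioms grp])
    fix c c' X Y assume c: "c \<in> carrier C" and "X \<in> carrier (quotient_module M U)"
    then obtain x where x: "x \<in> carrier M" and X: "X = U +>\<^bsub>M\<^esub> x" using obt by blast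
    note cx = lm_closed[OF M c x]
    show "c \<odot>\<^bsub>quotient_module M U\<^esub> X \<in> carrier (quotient_module M U)"
      unfolding X act[OF c x] by (rule qc[OF cx])
    { assume "Y \<in> carrier (quotient_module M U)"
      then obtain y where y: "y \<in> carrier M" and Y: "Y = U +>\<^bsub>M\<^esub> y" using obt by blast
      show "c \<odot>\<^bsub>quotient_module M U\<^esub> (X \<oplus>\<^bsub>quotient_module M U\<^esub> Y)
        = c \<odot>\<^bsub>quotient_module M U\<^esub> X \<oplus>\<^bsub>quotient_module M U\<^esub> c \<odot>\<^bsub>quotient_module M U\<^esub> Y"
        unfolding X Y add[OF x y] act[OF c x] act[OF c y] act[OF c M.a_closed[OF x y]]
          add[OF cx lm_closed[OF M c y]] lm_r_distr[OF M c x y] by (rule refl) }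
    assume c': "c' \<in> carrier C"
    note c'x = lm_closed[OF M c' x]
    show "(c \<oplus>\<^bsub>C\<^esub> c') \<odot>\<^bsub>quotient_module M U\<^esub> X
        = c \<odot>\<^bsub>quotient_module M U\<^esub> X \<oplus>\<^bsub>quotient_module M U\<^esub> c' \<odot>\<^bsub>quotient_module M U\<^esub> X"
      unfolding X act[OF c x] act[OF c' x] act[OF R.a_closed[OF c c'] x] add[OF cx c'x]
        lm_l_distr[OF M c c' x] by (rule refl)
    show "(c \<otimes>\<^bsub>C\<^esub> c') \<odot>\<^bsub>quotient_module M U\<^esub> X
        = c \<odot>\<^bsub>quotient_module M U\<^esub> (c' \<odot>\<^bsub>quotient_module M U\<^esub> X)"
      unfolding X act[OF c' x] act[OF c c'x] act[OF R.m_closed[OF c c'] x] lm_assoc[OF M c c' x] by (rule refl)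
  next
    fix X assume "X \<in> carrier (quotient_module M U)"
    then obtain x where x: "x \<in> carrier M" and X: "X = U +>\<^bsub>M\<^esub> x" using obt by blast
    show "\<one>\<^bsub>C\<^esub> \<odot>\<^bsub>quotient_module M U\<^esub> X = X"
      unfolding X act[OF R.one_closed x] lm_one[OF M x] by (rule refl)
  qed
qed

section \<open>Spaces of homomorphisms and duals\<close>

text \<open>
  Hom spaces, dual spaces and free modules all consist of functions with pointwise operations; this
  lemma gives their additive structure at once.  A negative is asked for only up to existence because
  it arises in different ways: from the scalar \<open>-1\<close>, or from negatives of values.
\<close>

lemma pointwise_abelian_group:
  assumes N: "abelian_group N" and S: "S \<subseteq> A \<rightarrow>\<^sub>E carrier N"
    and zero: "(\<lambda>x\<in>A. \<zero>\<^bsub>N\<^esub>) \<in> S"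
    and add: "\<And>f g. \<lbrakk>f \<in> S; g \<in> S\<rbrakk> \<Longrightarrow> (\<lambda>x\<in>A. f x \<oplus>\<^bsub>N\<^esub> g x) \<in> S"
    and neg: "\<And>f. f \<in> S \<Longrightarrow> \<exists>g\<in>S. \<forall>x\<in>A. g x \<oplus>\<^bsub>N\<^esub> f x = \<zero>\<^bsub>N\<^esub>"
    and H: "carrier H = S" "zero H = (\<lambda>x\<in>A. \<zero>\<^bsub>N\<^esub>)" "add H = (\<lambda>f g. \<lambda>x\<in>A. f x \<oplus>\<^bsub>N\<^esub> g x)"
  shows "abelian_group H"
proof (rule abelian_groupI)
  interpret N: abelian_group N by fact
  have mem: "f x \<in> carrier N" if "f \<in> S" "x \<in> A" for f x
    using S that by blast
  have ext: "f \<in> extensional A" if "f \<in> S" for f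
    using S that by (auto simp: PiE_def)
  show "\<zero>\<^bsub>H\<^esub> \<in> carrier H" using zero H by simp
  fix f assume "f \<in> carrier H"
  then have f: "f \<in> S" using H by simp
  show "\<zero>\<^bsub>H\<^esub> \<oplus>\<^bsub>H\<^esub> f = f"
    by (rule extensionalityI[of _ A]) (simp_all add: H ext f mem)
  obtain g where g: "g \<in> S" "\<forall>x\<in>A. g x \<oplus>\<^bsub>N\<^esub> f x = \<zero>\<^bsub>N\<^esub>" using neg[OF f] by blast
  have "g \<oplus>\<^bsub>H\<^esub> f = \<zero>\<^bsub>H\<^esub>" unfolding H by (rule restrict_ext) (use g in blast)
  then show "\<exists>y\<in>carrier H. y \<oplus>\<^bsub>H\<^esub> f = \<zero>\<^bsub>H\<^esub>" using g(1) unfolding H(1) by blast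
  fix g assume "g \<in> carrier H"
  then have g: "g \<in> S" using H by simp
  show "f \<oplus>\<^bsub>H\<^esub> g \<in> carrier H" using add[OF f g] by (simp add: H)
  show "f \<oplus>\<^bsub>H\<^esub> g = g \<oplus>\<^bsub>H\<^esub> f"
    unfolding H by (rule restrict_ext) (simp add: mem f g N.a_comm)
  fix l assume "l \<in> carrier H"
  then have l: "l \<in> S" using H by simp
  show "f \<oplus>\<^bsub>H\<^esub> g \<oplus>\<^bsub>H\<^esub> l = f \<oplus>\<^bsub>H\<^esub> (g \<oplus>\<^bsub>H\<^esub> l)"
    unfolding H by (rule restrict_ext) (simp add: mem f g l N.a_assoc)
qed

lemma abelian_group_class_ring: "abelian_group (class_ring :: 'k::field ring)"
  using field_class_ring[where 'k='k] by (simp add: field_def domain_def cring_def ring.is_abelian_group)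

lemma hom_space_simps [simp]:
  "carrier (hom_space C M N) = module_homs C M N"
  "zero (hom_space C M N) = (\<lambda>x\<in>carrier M. \<zero>\<^bsub>N\<^esub>)"
  "add (hom_space C M N) = (\<lambda>f g. \<lambda>x\<in>carrier M. f x \<oplus>\<^bsub>N\<^esub> g x)"
  "smult (hom_space C M N) = (\<lambda>k f. \<lambda>x\<in>carrier M. scalar_act C N k (f x))"
  by (simp_all add: hom_space_def)

lemma regular_simps [simp]:
  "carrier (regular_module C) = carrier C" "zero (regular_module C) = zero C"
  "add (regular_module C) = add C" "smult (regular_module C) = mult C"
  by (simp_all add: regular_module_def)

lemma algebra_dual_simps [simp]:
  "carrier (algebra_dual C P) = module_homs C P (regular_module C)"
  "zero (algebra_dual C P) = (\<lambda>x\<in>carrier P. \<zero>\<^bsub>C\<^esub>)"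
  "add (algebra_dual C P) = (\<lambda>f g. \<lambda>x\<in>carrier P. f x \<oplus>\<^bsub>C\<^esub> g x)"
  "smult (algebra_dual C P) = (\<lambda>c f. \<lambda>x\<in>carrier P. f x \<otimes>\<^bsub>C\<^esub> c)"
  by (simp_all add: algebra_dual_def)

lemma field_dual_simps [simp]:
  "zero (field_dual C N) = (\<lambda>x\<in>carrier N. 0)"
  "add (field_dual C N) = (\<lambda>\<phi> \<psi>. \<lambda>x\<in>carrier N. \<phi> x + \<psi> x)"
  "smult (field_dual C N) = (\<lambda>c \<phi>. \<lambda>x\<in>carrier N. \<phi> (c \<odot>\<^bsub>N\<^esub> x))"
  by (simp_all add: field_dual_def)

lemma field_dual_mem:
  "\<phi> \<in> carrier (field_dual C N) \<longleftrightarrow> \<phi> \<in> extensional (carrier N) \<and>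
     (\<forall>x\<in>carrier N. \<forall>y\<in>carrier N. \<phi> (x \<oplus>\<^bsub>N\<^esub> y) = \<phi> x + \<phi> y) \<and>
     (\<forall>k. \<forall>x\<in>carrier N. \<phi> (scalar_act C N k x) = k * \<phi> x)"
  by (simp add: field_dual_def PiE_def)

context K_algebra
begin

lemma scalar_act_zero: assumes M: "left_module C M" and x: "x \<in> carrier M"
  shows "scalar_act C M 0 x = \<zero>\<^bsub>M\<^esub>"
proof -
  have "0 \<odot> \<one> \<oplus> 0 \<odot> \<one> = 0 \<odot> \<one>" using scale_l_distr[of \<one> 0 0] by simp
  then have "0 \<odot> \<one> = \<zero>" using scal[of 0] by (simp add: add.l_cancel_one)
  then show ?thesis by (simp add: scalar_act_def lm_zero_act[OF M x])
qed

lemma scalar_act_neg: assumes M: "left_module C M" and x: "x \<in> carrier M"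
  shows "scalar_act C M (- 1) x \<oplus>\<^bsub>M\<^esub> x = \<zero>\<^bsub>M\<^esub>"
  using scalar_act_l_distr[OF M x, of "- 1" 1] scalar_act_zero[OF M x] scalar_act_one[OF M x] by simp

lemma regular_left_module: "left_module C (regular_module C)"
  by (rule left_moduleI[OF ring_axioms])
     (auto intro: abelian_group_cong[OF is_abelian_group] simp: l_distr r_distr m_assoc)

lemma hom_scalar_mem:
  assumes M: "left_module C M" and N: "left_module C N" and f: "f \<in> module_homs C M N"
  shows "(\<lambda>x\<in>carrier M. scalar_act C N k (f x)) \<in> module_homs C M N"
  by (rule module_homsI)
     (simp_all add: homs_closed[OF f] homs_add[OF f] homs_act[OF f] lm_add[OF M] lm_closed[OF M]
       scalar_act_closed[OF N] scalar_act_r_distr[OF N] scalar_act_act[OF N])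

lemma hom_add_mem:
  assumes M: "left_module C M" and N: "left_module C N"
    and f: "f \<in> module_homs C M N" and g: "g \<in> module_homs C M N"
  shows "(\<lambda>x\<in>carrier M. f x \<oplus>\<^bsub>N\<^esub> g x) \<in> module_homs C M N"
proof -
  interpret N: abelian_group N by (rule lm_group[OF N])
  show ?thesis
    by (rule module_homsI)
       (simp_all add: homs_closed[OF f] homs_add[OF f] homs_act[OF f] homs_closed[OF g] homs_add[OF g]
         homs_act[OF g] lm_add[OF M] lm_closed[OF M] lm_r_distr[OF N] N.a_ac)
qed

lemma hom_zero_mem:
  assumes M: "left_module C M" and N: "left_module C N"
  shows "(\<lambda>x\<in>carrier M. \<zero>\<^bsub>N\<^esub>) \<in> module_homs C M N"
proof -
  interpret N: abelian_group N by (rule lm_group[OF N])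
  show ?thesis
    by (rule module_homsI) (simp_all add: lm_add[OF M] lm_closed[OF M] lm_act_zero[OF N])
qed

lemma hom_space_group:
  assumes M: "left_module C M" and N: "left_module C N"
  shows "abelian_group (hom_space C M N)"
proof (rule pointwise_abelian_group[OF lm_group[OF N], of "module_homs C M N" "carrier M"])
  show "module_homs C M N \<subseteq> carrier M \<rightarrow>\<^sub>E carrier N" by (auto simp: module_homs_def)
  show "(\<lambda>x\<in>carrier M. \<zero>\<^bsub>N\<^esub>) \<in> module_homs C M N" by (rule hom_zero_mem[OF M N])
  show "(\<lambda>x\<in>carrier M. f x \<oplus>\<^bsub>N\<^esub> g x) \<in> module_homs C M N"
    if "f \<in> module_homs C M N" "g \<in> module_homs C M N" for f g by (rule hom_add_mem[OF M N that])
  show "\<exists>g\<in>module_homs C M N. \<forall>x\<in>carrier M. g x \<oplus>\<^bsub>N\<^esub> f x = \<zero>\<^bsub>N\<^esub>" if f: "f \<in> module_homs C M N" for f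
    using hom_scalar_mem[OF M N f, of "- 1"]
    by (rule bexI[rotated]) (simp add: scalar_act_neg[OF N] homs_closed[OF f])
qed simp_all

lemma hom_space_vectorspace:
  assumes M: "left_module C M" and N: "left_module C N"
  shows "vectorspace class_ring (hom_space C M N)"
proof -
  interpret H: abelian_group "hom_space C M N" by (rule hom_space_group[OF M N])
  have "module class_ring (hom_space C M N)"
  proof (rule moduleI)
    show "cring (class_ring :: 'k ring)" using field_class_ring[where 'k='k] by (simp add: field_def domain_def)
    show "abelian_group (hom_space C M N)" by (rule hom_space_group[OF M N])
    fix k l :: 'k and f g assume f: "f \<in> carrier (hom_space C M N)"
    then have f': "f \<in> module_homs C M N" by simp
    note simps = homs_closed[OF f'] scalar_act_closed[OF N] scalar_act_r_distr[OF N]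
        scalar_act_l_distr[OF N] scalar_act_assoc[OF N] scalar_act_one[OF N]
    show "k \<odot>\<^bsub>hom_space C M N\<^esub> f \<in> carrier (hom_space C M N)"
      using hom_scalar_mem[OF M N f'] by simp
    show "(k \<oplus>\<^bsub>class_ring\<^esub> l) \<odot>\<^bsub>hom_space C M N\<^esub> f
        = k \<odot>\<^bsub>hom_space C M N\<^esub> f \<oplus>\<^bsub>hom_space C M N\<^esub> l \<odot>\<^bsub>hom_space C M N\<^esub> f"
      unfolding hom_space_simps by (rule restrict_ext) (simp add: simps)
    show "(k \<otimes>\<^bsub>class_ring\<^esub> l) \<odot>\<^bsub>hom_space C M N\<^esub> f = k \<odot>\<^bsub>hom_space C M N\<^esub> (l \<odot>\<^bsub>hom_space C M N\<^esub> f)"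
      unfolding hom_space_simps by (rule restrict_ext) (simp add: simps)
    show "\<one>\<^bsub>class_ring\<^esub> \<odot>\<^bsub>hom_space C M N\<^esub> f = f"
      by (rule extensionalityI[OF _ homs_ext[OF f']]) (simp_all add: simps)
    assume "g \<in> carrier (hom_space C M N)"
    then have g': "g \<in> module_homs C M N" by simp
    show "k \<odot>\<^bsub>hom_space C M N\<^esub> (f \<oplus>\<^bsub>hom_space C M N\<^esub> g)
        = k \<odot>\<^bsub>hom_space C M N\<^esub> f \<oplus>\<^bsub>hom_space C M N\<^esub> k \<odot>\<^bsub>hom_space C M N\<^esub> g"
      unfolding hom_space_simps by (rule restrict_ext) (simp add: simps homs_closed[OF g'])
  qed
  then show ?thesis using field_class_ring[where 'k='k] by (simp add: vectorspace_def)
qed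

lemma hom_space_finsum_apply:
  assumes M: "left_module C M" and N: "left_module C N" and x: "x \<in> carrier M"
    and "finite A" and F: "F \<in> A \<rightarrow> module_homs C M N"
  shows "finsum (hom_space C M N) F A x = finsum N (\<lambda>i. F i x) A"
  by (rule additive_finsum[OF hom_space_group[OF M N] lm_group[OF N], of "\<lambda>f. f x"])
     (use assms in \<open>auto simp: homs_closed\<close>)

lemma algebra_dual_right_module:
  assumes P: "left_module C P"
  shows "left_module (opposite_algebra C) (algebra_dual C P)"
proof (rule left_moduleI)
  interpret op: K_algebra "opposite_algebra C" by (rule opposite)
  show "ring (opposite_algebra C)" by (rule op.ring_axioms)
  show "abelian_group (algebra_dual C P)"
    by (rule abelian_group_cong[OF hom_space_group[OF P regular_left_module]]) simp_all
  fix c c' f g assume "c \<in> carrier (opposite_algebra C)" and f': "f \<in> carrier (algebra_dual C P)"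
  then have c: "c \<in> carrier C" and f: "f \<in> module_homs C P (regular_module C)" by simp_all
  have fx: "f x \<in> carrier C" if "x \<in> carrier P" for x using homs_closed[OF f that] by simp
  have "(\<lambda>x\<in>carrier P. f x \<otimes> c) \<in> module_homs C P (regular_module C)"
    by (rule module_homsI)
       (simp_all add: fx c lm_add[OF P] lm_closed[OF P] homs_add[OF f] homs_act[OF f] l_distr m_assoc)
  then show "c \<odot>\<^bsub>algebra_dual C P\<^esub> f \<in> carrier (algebra_dual C P)" by simp
  { assume "c' \<in> carrier (opposite_algebra C)"
    then have c': "c' \<in> carrier C" by simp
    show "(c \<oplus>\<^bsub>opposite_algebra C\<^esub> c') \<odot>\<^bsub>algebra_dual C P\<^esub> f
        = c \<odot>\<^bsub>algebra_dual C P\<^esub> f \<oplus>\<^bsub>algebra_dual C P\<^esub> c' \<odot>\<^bsub>algebra_dual C P\<^esub> f"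
      unfolding algebra_dual_simps by (rule restrict_ext) (simp add: fx c c' r_distr)
    show "(c \<otimes>\<^bsub>opposite_algebra C\<^esub> c') \<odot>\<^bsub>algebra_dual C P\<^esub> f
        = c \<odot>\<^bsub>algebra_dual C P\<^esub> (c' \<odot>\<^bsub>algebra_dual C P\<^esub> f)"
      unfolding algebra_dual_simps by (rule restrict_ext) (simp add: fx c c' m_assoc) }
  assume "g \<in> carrier (algebra_dual C P)"
  then have g: "g \<in> module_homs C P (regular_module C)" by simp
  have gx: "g x \<in> carrier C" if "x \<in> carrier P" for x using homs_closed[OF g that] by simp
  show "c \<odot>\<^bsub>algebra_dual C P\<^esub> (f \<oplus>\<^bsub>algebra_dual C P\<^esub> g)
        = c \<odot>\<^bsub>algebra_dual C P\<^esub> f \<oplus>\<^bsub>algebra_dual C P\<^esub> c \<odot>\<^bsub>algebra_dual C P\<^esub> g"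
    unfolding algebra_dual_simps by (rule restrict_ext) (simp add: fx gx c l_distr)
next
  fix f assume "f \<in> carrier (algebra_dual C P)"
  then have f: "f \<in> module_homs C P (regular_module C)" by simp
  have fx: "f x \<in> carrier C" if "x \<in> carrier P" for x using homs_closed[OF f that] by simp
  show "\<one>\<^bsub>opposite_algebra C\<^esub> \<odot>\<^bsub>algebra_dual C P\<^esub> f = f"
    by (rule extensionalityI[OF _ homs_ext[OF f]]) (simp_all add: fx)
qed

lemma field_dual_left_module:
  assumes N: "left_module (opposite_algebra C) N"
  shows "left_module C (field_dual C N)"
proof (rule left_moduleI[OF ring_axioms])
  interpret op: K_algebra "opposite_algebra C" by (rule opposite)
  interpret N: abelian_group N by (rule lm_group[OF N])
  note sc = op.scalar_act_closed[OF N, simplified] op.scalar_act_r_distr[OF N, simplified]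
    op.scalar_act_act[OF N, simplified]
  note nc = lm_closed[OF N, simplified] lm_r_distr[OF N, simplified] lm_l_distr[OF N, simplified]
    lm_assoc[OF N, simplified] lm_one[OF N, simplified]
  show "abelian_group (field_dual C N)"
  proof (rule pointwise_abelian_group[OF abelian_group_class_ring, of "carrier (field_dual C N)" "carrier N"])
    show "carrier (field_dual C N) \<subseteq> carrier N \<rightarrow>\<^sub>E carrier class_ring"
      by (auto simp: field_dual_mem PiE_def)
    fix f assume f: "f \<in> carrier (field_dual C N)"
    have "(\<lambda>x\<in>carrier N. - f x) \<in> carrier (field_dual C N)"
      using f by (simp add: field_dual_mem sc)
    then show "\<exists>g\<in>carrier (field_dual C N). \<forall>x\<in>carrier N. g x \<oplus>\<^bsub>class_ring\<^esub> f x = \<zero>\<^bsub>class_ring\<^esub>"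
      by (rule bexI[rotated]) simp
    fix g assume g: "g \<in> carrier (field_dual C N)"
    show "(\<lambda>x\<in>carrier N. f x \<oplus>\<^bsub>class_ring\<^esub> g x) \<in> carrier (field_dual C N)"
      using f g by (simp add: field_dual_mem sc algebra_simps)
  qed (simp_all add: field_dual_mem sc)
  fix c c' \<phi> \<psi> assume c: "c \<in> carrier C" and \<phi>: "\<phi> \<in> carrier (field_dual C N)"
  have \<phi>_add: "\<phi> (x \<oplus>\<^bsub>N\<^esub> y) = \<phi> x + \<phi> y" if "x \<in> carrier N" "y \<in> carrier N" for x y
    using \<phi> that by (simp add: field_dual_mem)
  have \<phi>_sc: "\<phi> (scalar_act C N k x) = k * \<phi> x" if "x \<in> carrier N" for x k
    using \<phi> that by (simp add: field_dual_mem)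
  show "c \<odot>\<^bsub>field_dual C N\<^esub> \<phi> \<in> carrier (field_dual C N)"
    unfolding field_dual_mem using c
    by (simp add: \<phi>_add \<phi>_sc nc sc flip: sc(3))
  { assume c': "c' \<in> carrier C"
    show "(c \<oplus> c') \<odot>\<^bsub>field_dual C N\<^esub> \<phi> = c \<odot>\<^bsub>field_dual C N\<^esub> \<phi> \<oplus>\<^bsub>field_dual C N\<^esub> c' \<odot>\<^bsub>field_dual C N\<^esub> \<phi>"
      unfolding field_dual_simps by (rule restrict_ext) (simp add: c c' nc \<phi>_add)
    show "(c \<otimes> c') \<odot>\<^bsub>field_dual C N\<^esub> \<phi> = c \<odot>\<^bsub>field_dual C N\<^esub> (c' \<odot>\<^bsub>field_dual C N\<^esub> \<phi>)"
      unfolding field_dual_simps by (rule restrict_ext) (simp add: c c' nc) }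
  show "c \<odot>\<^bsub>field_dual C N\<^esub> (\<phi> \<oplus>\<^bsub>field_dual C N\<^esub> \<psi>)
        = c \<odot>\<^bsub>field_dual C N\<^esub> \<phi> \<oplus>\<^bsub>field_dual C N\<^esub> c \<odot>\<^bsub>field_dual C N\<^esub> \<psi>"
    unfolding field_dual_simps by (rule restrict_ext) (simp add: c nc)
next
  fix \<phi> assume "\<phi> \<in> carrier (field_dual C N)"
  then have ext: "\<phi> \<in> extensional (carrier N)" by (simp add: field_dual_mem)
  show "\<one> \<odot>\<^bsub>field_dual C N\<^esub> \<phi> = \<phi>"
    by (rule extensionalityI[OF _ ext]) (simp_all add: lm_one[OF N, simplified])
qed

lemma field_dual_scalar:
  assumes N: "left_module (opposite_algebra C) N" and \<phi>: "\<phi> \<in> carrier (field_dual C N)"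
    and X: "X \<in> carrier N"
  shows "scalar_act C (field_dual C N) k \<phi> X = k * \<phi> X"
  using \<phi> X by (simp add: scalar_act_def[of C "field_dual C N"] field_dual_mem scalar_act_def[of C N])

end

section \<open>Dual bases\<close>

text \<open>
  By the dual basis lemma, a module has such a pair of families if and only if it is finitely
  generated and projective.  In this form projectivity refers to no other module, so it can be used
  with targets of arbitrary type.
\<close>

definition dual_basis ::
    "('k, 'c) module \<Rightarrow> ('c, 'p) module \<Rightarrow> nat \<Rightarrow> (nat \<Rightarrow> 'p) \<Rightarrow> (nat \<Rightarrow> 'p \<Rightarrow> 'c) \<Rightarrow> bool" where
  "dual_basis C P r b \<beta> \<longleftrightarrow> b \<in> {..<r} \<rightarrow> carrier P \<and>
     \<beta> \<in> {..<r} \<rightarrow> module_homs C P (regular_module C) \<and>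
     (\<forall>x\<in>carrier P. finsum P (\<lambda>i. \<beta> i x \<odot>\<^bsub>P\<^esub> b i) {..<r} = x)"

lemma dual_basisD:
  assumes "dual_basis C P r b \<beta>"
  shows "i < r \<Longrightarrow> b i \<in> carrier P" "i < r \<Longrightarrow> \<beta> i \<in> module_homs C P (regular_module C)"
    "\<lbrakk>i < r; x \<in> carrier P\<rbrakk> \<Longrightarrow> \<beta> i x \<in> carrier C"
    "x \<in> carrier P \<Longrightarrow> finsum P (\<lambda>i. \<beta> i x \<odot>\<^bsub>P\<^esub> b i) {..<r} = x"
proof -
  show b: "b i \<in> carrier P" if "i < r" for i using assms that by (auto simp: dual_basis_def)
  show \<beta>: "\<beta> i \<in> module_homs C P (regular_module C)" if "i < r" for i
    using assms that by (auto simp: dual_basis_def)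
  show "\<beta> i x \<in> carrier C" if "i < r" "x \<in> carrier P" for i x
    using homs_closed[OF \<beta>[OF that(1)] that(2)] by simp
  show "finsum P (\<lambda>i. \<beta> i x \<odot>\<^bsub>P\<^esub> b i) {..<r} = x" if "x \<in> carrier P" for x
    using assms that by (simp add: dual_basis_def)
qed

text \<open>
  The image of \<open>f \<otimes> m\<close> under the map \<open>Hom\<^sub>C(P, C) \<otimes>\<^sub>C M \<rightarrow> Hom\<^sub>C(P, M)\<close>.  Elements of the tensor product are
  only ever used through these images.
\<close>

definition rank_one :: "('c, 'p) module \<Rightarrow> ('c, 'm) module \<Rightarrow> ('p \<Rightarrow> 'c) \<Rightarrow> 'm \<Rightarrow> 'p \<Rightarrow> 'm" where
  "rank_one P M f m = (\<lambda>x\<in>carrier P. f x \<odot>\<^bsub>M\<^esub> m)"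

context K_algebra
begin

lemma rank_one_hom:
  assumes P: "left_module C P" and M: "left_module C M"
    and f: "f \<in> module_homs C P (regular_module C)" and m: "m \<in> carrier M"
  shows "rank_one P M f m \<in> module_homs C P M"
proof (rule module_homsI)
  have fx: "f x \<in> carrier C" if "x \<in> carrier P" for x using homs_closed[OF f that] by simp
  show "rank_one P M f m x \<in> carrier M" if "x \<in> carrier P" for x
    using that by (simp add: rank_one_def fx lm_closed[OF M] m)
  show "rank_one P M f m (x \<oplus>\<^bsub>P\<^esub> y) = rank_one P M f m x \<oplus>\<^bsub>M\<^esub> rank_one P M f m y"
    if "x \<in> carrier P" "y \<in> carrier P" for x y
    using that by (simp add: rank_one_def fx lm_add[OF P] homs_add[OF f] lm_l_distr[OF M] m)
  show "rank_one P M f m (c \<odot>\<^bsub>P\<^esub> x) = c \<odot>\<^bsub>M\<^esub> rank_one P M f m x"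
    if "c \<in> carrier C" "x \<in> carrier P" for c x
    using that by (simp add: rank_one_def fx lm_closed[OF P] homs_act[OF f] lm_assoc[OF M] m)
qed (simp add: rank_one_def)

text \<open>
  The surjectivity of \<open>Hom\<^sub>C(P, C) \<otimes>\<^sub>C M \<rightarrow> Hom\<^sub>C(P, M)\<close>: the dual basis provides the preimage
  \<open>\<Sum>\<^sub>i \<beta>\<^sub>i \<otimes> u(b\<^sub>i)\<close> of \<open>u\<close>.
\<close>

lemma hom_expand:
  assumes P: "left_module C P" and M: "left_module C M" and B: "dual_basis C P r b \<beta>"
    and u: "u \<in> module_homs C P M"
  shows "finsum (hom_space C P M) (\<lambda>i. rank_one P M (\<beta> i) (u (b i))) {..<r} = u" (is "?s = u")
proof (rule homs_eqI[OF _ u])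
  interpret H: abelian_group "hom_space C P M" by (rule hom_space_group[OF P M])
  interpret M: abelian_group M by (rule lm_group[OF M])
  have mem: "rank_one P M (\<beta> i) (u (b i)) \<in> module_homs C P M" if "i < r" for i
    using rank_one_hom[OF P M dual_basisD(2)[OF B that] homs_closed[OF u dual_basisD(1)[OF B that]]] .
  show "?s \<in> module_homs C P M" using H.finsum_closed[of "\<lambda>i. rank_one P M (\<beta> i) (u (b i))" "{..<r}"] mem by auto
  fix x assume x: "x \<in> carrier P"
  have "?s x = finsum M (\<lambda>i. rank_one P M (\<beta> i) (u (b i)) x) {..<r}"
    by (rule hom_space_finsum_apply[OF P M x]) (use mem in auto)
  also have "\<dots> = finsum M (\<lambda>i. u (\<beta> i x \<odot>\<^bsub>P\<^esub> b i)) {..<r}"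
  proof (rule M.finsum_cong'[OF refl])
    show "(\<lambda>i. u (\<beta> i x \<odot>\<^bsub>P\<^esub> b i)) \<in> {..<r} \<rightarrow> carrier M"
      using homs_closed[OF u] lm_closed[OF P] dual_basisD[OF B] x by auto
    show "rank_one P M (\<beta> i) (u (b i)) x = u (\<beta> i x \<odot>\<^bsub>P\<^esub> b i)" if "i \<in> {..<r}" for i
      using that x dual_basisD[OF B] by (simp add: rank_one_def homs_act[OF u])
  qed
  also have "\<dots> = u (finsum P (\<lambda>i. \<beta> i x \<odot>\<^bsub>P\<^esub> b i) {..<r})"
    by (rule homs_finsum[OF u lm_group[OF P] lm_group[OF M], symmetric])
       (use lm_closed[OF P] dual_basisD[OF B] x in auto)
  also have "\<dots> = u x" by (simp add: dual_basisD(4)[OF B x])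
  finally show "?s x = u x" .
qed

end

section \<open>Homomorphisms into the Auslander-Reiten translate\<close>

text \<open>
  The \<open>K\<close>-dual of the cokernel of \<open>Hom\<^sub>C(P\<^sub>0, M) \<rightarrow> Hom\<^sub>C(P\<^sub>1, M)\<close>.
\<close>

definition hom_functionals ::
    "('k::field, 'c) module \<Rightarrow> ('c, 'p) module \<Rightarrow> ('p \<Rightarrow> 'q) \<Rightarrow> ('c, 'q) module \<Rightarrow> ('c, 'm) module \<Rightarrow>
     ('k, ('p \<Rightarrow> 'm) \<Rightarrow> 'k) module" where
  "hom_functionals C P\<^sub>1 h P\<^sub>0 M =
    \<lparr>carrier = {\<phi> \<in> extensional (module_homs C P\<^sub>1 M).
       (\<forall>u\<in>module_homs C P\<^sub>1 M. \<forall>v\<in>module_homs C P\<^sub>1 M. \<phi> (\<lambda>x\<in>carrier P\<^sub>1. u x \<oplus>\<^bsub>M\<^esub> v x) = \<phi> u + \<phi> v) \<and>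
       (\<forall>k. \<forall>u\<in>module_homs C P\<^sub>1 M. \<phi> (\<lambda>x\<in>carrier P\<^sub>1. scalar_act C M k (u x)) = k * \<phi> u) \<and>
       (\<forall>v\<in>module_homs C P\<^sub>0 M. \<phi> (compose (carrier P\<^sub>1) v h) = 0)},
     mult = undefined, one = undefined,
     zero = (\<lambda>u\<in>module_homs C P\<^sub>1 M. 0),
     add = (\<lambda>\<phi> \<psi>. \<lambda>u\<in>module_homs C P\<^sub>1 M. \<phi> u + \<psi> u),
     smult = (\<lambda>k \<phi>. \<lambda>u\<in>module_homs C P\<^sub>1 M. k * \<phi> u)\<rparr>"

lemma hom_functionals_simps [simp]:
  "zero (hom_functionals C P\<^sub>1 h P\<^sub>0 M) = (\<lambda>u\<in>module_homs C P\<^sub>1 M. 0)"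
  "add (hom_functionals C P\<^sub>1 h P\<^sub>0 M) = (\<lambda>\<phi> \<psi>. \<lambda>u\<in>module_homs C P\<^sub>1 M. \<phi> u + \<psi> u)"
  "smult (hom_functionals C P\<^sub>1 h P\<^sub>0 M) = (\<lambda>k \<phi>. \<lambda>u\<in>module_homs C P\<^sub>1 M. k * \<phi> u)"
  by (simp_all add: hom_functionals_def)

lemma hom_functionals_mem:
  "\<phi> \<in> carrier (hom_functionals C P\<^sub>1 h P\<^sub>0 M) \<longleftrightarrow> \<phi> \<in> extensional (module_homs C P\<^sub>1 M) \<and>
       (\<forall>u\<in>module_homs C P\<^sub>1 M. \<forall>v\<in>module_homs C P\<^sub>1 M. \<phi> (\<lambda>x\<in>carrier P\<^sub>1. u x \<oplus>\<^bsub>M\<^esub> v x) = \<phi> u + \<phi> v) \<and>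
       (\<forall>k. \<forall>u\<in>module_homs C P\<^sub>1 M. \<phi> (\<lambda>x\<in>carrier P\<^sub>1. scalar_act C M k (u x)) = k * \<phi> u) \<and>
       (\<forall>v\<in>module_homs C P\<^sub>0 M. \<phi> (compose (carrier P\<^sub>1) v h) = 0)"
  by (simp add: hom_functionals_def)

text \<open>
  Here \<open>M\<close> is an arbitrary module and \<open>h\<close> an arbitrary map between finitely generated projectives; the
  translate \<open>tau\<close> is the one obtained from \<open>h\<close>.
\<close>

locale projective_presentation = K_algebra C for C :: "('k::field, 'c) module" (structure) +
  fixes M :: "('c, 'm) module" and P\<^sub>1 :: "('c, 'p) module" and h :: "'p \<Rightarrow> 'q" and P\<^sub>0 :: "('c, 'q) module"
    and r :: nat and b :: "nat \<Rightarrow> 'p" and \<beta> :: "nat \<Rightarrow> 'p \<Rightarrow> 'c"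
    and s :: nat and a :: "nat \<Rightarrow> 'q" and \<alpha> :: "nat \<Rightarrow> 'q \<Rightarrow> 'c"
  assumes M: "left_module C M" and P1: "left_module C P\<^sub>1" and P0: "left_module C P\<^sub>0"
    and h: "h \<in> module_homs C P\<^sub>1 P\<^sub>0"
    and B1: "dual_basis C P\<^sub>1 r b \<beta>" and B0: "dual_basis C P\<^sub>0 s a \<alpha>"
begin

abbreviation D1 where "D1 \<equiv> algebra_dual C P\<^sub>1"
abbreviation U where "U \<equiv> (\<lambda>f. compose (carrier P\<^sub>1) f h) ` carrier (algebra_dual C P\<^sub>0)"
abbreviation Tr where "Tr \<equiv> transpose_module C P\<^sub>1 h P\<^sub>0"
abbreviation tau where "tau \<equiv> field_dual C Tr"
abbreviation rk where "rk \<equiv> rank_one P\<^sub>1 M"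
abbreviation W where "W \<equiv> hom_functionals C P\<^sub>1 h P\<^sub>0 M"

lemma D1: "left_module (opposite_algebra C) D1"
  by (rule algebra_dual_right_module[OF P1])

lemma hx: "x \<in> carrier P\<^sub>1 \<Longrightarrow> h x \<in> carrier P\<^sub>0"
  by (rule homs_closed[OF h])

lemma compose_h: "v \<in> module_homs C P\<^sub>0 N \<Longrightarrow> compose (carrier P\<^sub>1) v h \<in> module_homs C P\<^sub>1 N"
  by (rule homs_compose[OF h _ lm_group[OF P1] lm_closed[OF P1]])

lemma U_submodule: "left_submodule (opposite_algebra C) U D1"
proof (rule left_submoduleI[OF D1])
  have D0: "left_module (opposite_algebra C) (algebra_dual C P\<^sub>0)" by (rule algebra_dual_right_module[OF P0])
  show "U \<subseteq> carrier D1" using compose_h by auto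
  have "compose (carrier P\<^sub>1) \<zero>\<^bsub>algebra_dual C P\<^sub>0\<^esub> h = \<zero>\<^bsub>D1\<^esub>"
    unfolding compose_def algebra_dual_simps by (rule restrict_ext) (simp add: hx)
  then show "\<zero>\<^bsub>D1\<^esub> \<in> U" using lm_zero[OF D0] by (metis imageI)
  fix x assume "x \<in> U"
  then obtain f where f: "f \<in> carrier (algebra_dual C P\<^sub>0)" and x: "x = compose (carrier P\<^sub>1) f h" by blast
  { fix y assume "y \<in> U"
    then obtain g where g: "g \<in> carrier (algebra_dual C P\<^sub>0)" and y: "y = compose (carrier P\<^sub>1) g h" by blast
    have "compose (carrier P\<^sub>1) (f \<oplus>\<^bsub>algebra_dual C P\<^sub>0\<^esub> g) h = x \<oplus>\<^bsub>D1\<^esub> y"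
      unfolding x y algebra_dual_simps compose_def by (rule restrict_ext) (simp add: hx)
    then show "x \<oplus>\<^bsub>D1\<^esub> y \<in> U" using lm_add[OF D0 f g] by (metis imageI) }
  fix c assume c: "c \<in> carrier (opposite_algebra C)"
  have "compose (carrier P\<^sub>1) (c \<odot>\<^bsub>algebra_dual C P\<^sub>0\<^esub> f) h = c \<odot>\<^bsub>D1\<^esub> x"
    unfolding x algebra_dual_simps compose_def by (rule restrict_ext) (simp add: hx)
  then show "c \<odot>\<^bsub>D1\<^esub> x \<in> U" using lm_closed[OF D0 c f] by (metis imageI)
qed

lemma Tr_eq: "Tr = quotient_module D1 U" by (simp add: transpose_module_def)

lemma Tr: "left_module (opposite_algebra C) Tr"
  unfolding Tr_eq by (rule quotient_left_module[OF D1 U_submodule])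

lemma tau: "left_module C tau" by (rule field_dual_left_module[OF Tr])

lemma hom_tau: "vectorspace class_ring (hom_space C M tau)" by (rule hom_space_vectorspace[OF M tau])

definition cls where "cls f = U +>\<^bsub>D1\<^esub> f"

lemma cls_mem: "f \<in> carrier D1 \<Longrightarrow> cls f \<in> carrier Tr"
  using quotient_carrier[OF D1 U_submodule] by (auto simp: Tr_eq cls_def)

lemma cls_surj: "X \<in> carrier Tr \<Longrightarrow> \<exists>f\<in>carrier D1. X = cls f"
  using quotient_carrier[OF D1 U_submodule] by (auto simp: Tr_eq cls_def)

lemma cls_add: "\<lbrakk>f \<in> carrier D1; g \<in> carrier D1\<rbrakk> \<Longrightarrow> cls f \<oplus>\<^bsub>Tr\<^esub> cls g = cls (f \<oplus>\<^bsub>D1\<^esub> g)"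
  unfolding Tr_eq cls_def by (rule quotient_add[OF D1 U_submodule])

lemma cls_act: "\<lbrakk>c \<in> carrier C; f \<in> carrier D1\<rbrakk> \<Longrightarrow> c \<odot>\<^bsub>Tr\<^esub> cls f = cls (c \<odot>\<^bsub>D1\<^esub> f)"
  unfolding Tr_eq cls_def by (rule quotient_act[OF D1 U_submodule]) simp_all

lemma cls_zero: "f \<in> U \<Longrightarrow> cls f = \<zero>\<^bsub>Tr\<^esub>"
  using quotient_eq_zero[OF D1 U_submodule] by (simp add: Tr_eq cls_def)

lemma rk_hom: "\<lbrakk>f \<in> carrier D1; m \<in> carrier M\<rbrakk> \<Longrightarrow> rk f m \<in> module_homs C P\<^sub>1 M"
  by (rule rank_one_hom[OF P1 M]) simp_all

lemma D1_closed: "\<lbrakk>f \<in> carrier D1; x \<in> carrier P\<^sub>1\<rbrakk> \<Longrightarrow> f x \<in> carrier C"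
  using homs_closed[of f C P\<^sub>1 "regular_module C"] by simp

lemma D1_basis: "i < r \<Longrightarrow> \<beta> i \<in> carrier D1" by (simp add: dual_basisD(2)[OF B1])

lemma tau_apply:
  assumes \<psi>: "\<psi> \<in> carrier tau"
  shows "\<lbrakk>f \<in> carrier D1; g \<in> carrier D1\<rbrakk> \<Longrightarrow> \<psi> (cls (f \<oplus>\<^bsub>D1\<^esub> g)) = \<psi> (cls f) + \<psi> (cls g)"
    and "\<lbrakk>c \<in> carrier C; f \<in> carrier D1\<rbrakk> \<Longrightarrow> (c \<odot>\<^bsub>tau\<^esub> \<psi>) (cls f) = \<psi> (cls (c \<odot>\<^bsub>D1\<^esub> f))"
    and "\<psi> \<zero>\<^bsub>Tr\<^esub> = 0"
proof -
  show "\<psi> (cls (f \<oplus>\<^bsub>D1\<^esub> g)) = \<psi> (cls f) + \<psi> (cls g)" if f: "f \<in> carrier D1" and g: "g \<in> carrier D1" for f g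
    using \<psi> cls_mem[OF f] cls_mem[OF g] unfolding field_dual_mem cls_add[OF f g, symmetric] by blast
  show "(c \<odot>\<^bsub>tau\<^esub> \<psi>) (cls f) = \<psi> (cls (c \<odot>\<^bsub>D1\<^esub> f))" if c: "c \<in> carrier C" and f: "f \<in> carrier D1" for c f
    using cls_mem[OF f] unfolding cls_act[OF c f, symmetric] by simp
  have "\<psi> (\<zero>\<^bsub>Tr\<^esub> \<oplus>\<^bsub>Tr\<^esub> \<zero>\<^bsub>Tr\<^esub>) = \<psi> \<zero>\<^bsub>Tr\<^esub> + \<psi> \<zero>\<^bsub>Tr\<^esub>"
    using \<psi> lm_zero[OF Tr] unfolding field_dual_mem by blast
  moreover have "\<zero>\<^bsub>Tr\<^esub> \<oplus>\<^bsub>Tr\<^esub> \<zero>\<^bsub>Tr\<^esub> = \<zero>\<^bsub>Tr\<^esub>"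
    using abelian_monoid.l_zero[OF abelian_group.axioms(1)[OF lm_group[OF Tr]] lm_zero[OF Tr]] .
  ultimately show "\<psi> \<zero>\<^bsub>Tr\<^esub> = 0" by (metis add_cancel_right_right)
qed

text \<open>
  A map \<open>\<Phi> : M \<rightarrow> D Tr\<close> corresponds to the linear form \<open>f \<otimes> m \<mapsto> \<Phi>(m)(f)\<close> on \<open>Tr \<otimes>\<^sub>C M\<close>.  A map \<open>u : P\<^sub>1 \<rightarrow> M\<close>
  is the sum of the rank one maps of \<open>\<beta>\<^sub>i\<close> and \<open>u(b\<^sub>i)\<close>, which dictates the value at \<open>u\<close>.
\<close>

definition to_functional :: "('m \<Rightarrow> ('p \<Rightarrow> 'c) set \<Rightarrow> 'k) \<Rightarrow> ('p \<Rightarrow> 'm) \<Rightarrow> 'k" where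
  "to_functional \<Phi> = (\<lambda>u\<in>module_homs C P\<^sub>1 M. \<Sum>i<r. \<Phi> (u (b i)) (cls (\<beta> i)))"

text \<open>
  The formula without the dual basis, which determines the linear form.  It follows by expanding \<open>f\<close>
  in the \<open>\<beta>\<^sub>i\<close> and moving the coefficients \<open>f(b\<^sub>i)\<close> across, from \<open>D Tr\<close> to \<open>M\<close>.
\<close>

lemma to_functional_rk:
  assumes \<Phi>: "\<Phi> \<in> module_homs C M tau" and f: "f \<in> carrier D1" and m: "m \<in> carrier M"
  shows "to_functional \<Phi> (rk f m) = \<Phi> m (cls f)"
proof -
  note \<Phi>m = homs_closed[OF \<Phi> m]
  have fb: "f (b i) \<in> carrier C" if "i < r" for i using D1_closed[OF f dual_basisD(1)[OF B1 that]] .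
  let ?g = "\<lambda>i. f (b i) \<odot>\<^bsub>D1\<^esub> \<beta> i"
  have g: "?g i \<in> carrier D1" if "i < r" for i
    by (rule lm_closed[OF D1]) (use fb D1_basis that in simp_all)
  have f': "f \<in> module_homs C P\<^sub>1 (regular_module C)" using f by simp
  have "f = finsum (hom_space C P\<^sub>1 (regular_module C)) ?g {..<r}"
    using hom_expand[OF P1 regular_left_module B1 f'] by (simp add: rank_one_def)
  also have "\<dots> = finsum D1 ?g {..<r}" by (rule finsum_cong_record) simp_all
  finally have "\<Phi> m (cls f) = \<Phi> m (cls (finsum D1 ?g {..<r}))" by simp
  also have "\<dots> = finsum class_ring (\<lambda>i. \<Phi> m (cls (?g i))) {..<r}"
    by (rule additive_finsum[OF lm_group[OF D1] abelian_group_class_ring, of "\<lambda>f. \<Phi> m (cls f)"])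
       (use g tau_apply(1)[OF \<Phi>m] in simp_all)
  also have "\<dots> = (\<Sum>i<r. \<Phi> m (cls (?g i)))" by (simp add: class_ring_simps)
  also have "\<dots> = (\<Sum>i<r. \<Phi> (rk f m (b i)) (cls (\<beta> i)))"
  proof (rule sum.cong[OF refl])
    fix i assume "i \<in> {..<r}"
    then have i: "i < r" by simp
    have "\<Phi> (rk f m (b i)) (cls (\<beta> i)) = (f (b i) \<odot>\<^bsub>tau\<^esub> \<Phi> m) (cls (\<beta> i))"
      using dual_basisD(1)[OF B1 i] homs_act[OF \<Phi> fb[OF i] m] by (simp add: rank_one_def)
    then show "\<Phi> m (cls (?g i)) = \<Phi> (rk f m (b i)) (cls (\<beta> i))"
      using tau_apply(2)[OF \<Phi>m fb[OF i] D1_basis[OF i]] by simp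
  qed
  also have "\<dots> = to_functional \<Phi> (rk f m)" using rk_hom[OF f m] by (simp add: to_functional_def)
  finally show ?thesis by simp
qed

lemma to_functional_add:
  assumes \<Phi>: "\<Phi> \<in> module_homs C M tau" and u: "u \<in> module_homs C P\<^sub>1 M" and v: "v \<in> module_homs C P\<^sub>1 M"
  shows "to_functional \<Phi> (\<lambda>x\<in>carrier P\<^sub>1. u x \<oplus>\<^bsub>M\<^esub> v x) = to_functional \<Phi> u + to_functional \<Phi> v"
proof -
  have "\<Phi> (u (b i) \<oplus>\<^bsub>M\<^esub> v (b i)) (cls (\<beta> i)) = \<Phi> (u (b i)) (cls (\<beta> i)) + \<Phi> (v (b i)) (cls (\<beta> i))"
    if "i < r" for i
    using homs_add[OF \<Phi> homs_closed[OF u] homs_closed[OF v], OF dual_basisD(1)[OF B1 that] dual_basisD(1)[OF B1 that]]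
      cls_mem[OF D1_basis[OF that]] by simp
  then show ?thesis
    using u v hom_add_mem[OF P1 M u v] dual_basisD(1)[OF B1]
    by (simp add: to_functional_def sum.distrib)
qed

text \<open>
  To see that the form vanishes on \<open>v \<circ> h\<close>, expand \<open>v : P\<^sub>0 \<rightarrow> M\<close> in a dual basis of \<open>P\<^sub>0\<close>: composing the rank
  one map of \<open>\<alpha>\<^sub>j\<close> and \<open>m\<close> with \<open>h\<close> gives the rank one map of \<open>\<alpha>\<^sub>j \<circ> h\<close> and \<open>m\<close>, and \<open>\<alpha>\<^sub>j \<circ> h\<close> is zero in \<open>Tr\<close>.
\<close>

lemma to_functional_mem:
  assumes \<Phi>: "\<Phi> \<in> module_homs C M tau"
  shows "to_functional \<Phi> \<in> carrier W"
  unfolding hom_functionals_mem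
proof (intro conjI ballI allI)
  show "to_functional \<Phi> \<in> extensional (module_homs C P\<^sub>1 M)" by (simp add: to_functional_def)
  show "to_functional \<Phi> (\<lambda>x\<in>carrier P\<^sub>1. u x \<oplus>\<^bsub>M\<^esub> v x) = to_functional \<Phi> u + to_functional \<Phi> v"
    if "u \<in> module_homs C P\<^sub>1 M" "v \<in> module_homs C P\<^sub>1 M" for u v
    by (rule to_functional_add[OF \<Phi> that])
  show "to_functional \<Phi> (\<lambda>x\<in>carrier P\<^sub>1. scalar_act C M k (u x)) = k * to_functional \<Phi> u"
    if u: "u \<in> module_homs C P\<^sub>1 M" for k u
  proof -
    have "\<Phi> (scalar_act C M k (u (b i))) (cls (\<beta> i)) = k * \<Phi> (u (b i)) (cls (\<beta> i))" if i: "i < r" for i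
    proof -
      note ub = homs_closed[OF u dual_basisD(1)[OF B1 i]]
      show ?thesis
        unfolding homs_scalar[OF \<Phi> ub]
        by (rule field_dual_scalar[OF Tr homs_closed[OF \<Phi> ub] cls_mem[OF D1_basis[OF i]]])
    qed
    then show ?thesis
      using u hom_scalar_mem[OF P1 M u] dual_basisD(1)[OF B1]
      by (simp add: to_functional_def sum_distrib_left)
  qed
  fix v assume v: "v \<in> module_homs C P\<^sub>0 M"
  let ?H0 = "hom_space C P\<^sub>0 M" and ?H1 = "hom_space C P\<^sub>1 M"
  have \<alpha>: "\<alpha> j \<in> module_homs C P\<^sub>0 (regular_module C)" and va: "v (a j) \<in> carrier M" if "j < s" for j
    using dual_basisD(2)[OF B0 that] homs_closed[OF v dual_basisD(1)[OF B0 that]] .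
  have rk0: "rank_one P\<^sub>0 M (\<alpha> j) (v (a j)) \<in> module_homs C P\<^sub>0 M" if "j < s" for j
    by (rule rank_one_hom[OF P0 M \<alpha>[OF that] va[OF that]])
  have "to_functional \<Phi> (compose (carrier P\<^sub>1) v h)
      = to_functional \<Phi> (compose (carrier P\<^sub>1) (finsum ?H0 (\<lambda>j. rank_one P\<^sub>0 M (\<alpha> j) (v (a j))) {..<s}) h)"
    using hom_expand[OF P0 M B0 v] by simp
  also have "\<dots> = finsum class_ring (\<lambda>j. to_functional \<Phi> (compose (carrier P\<^sub>1) (rank_one P\<^sub>0 M (\<alpha> j) (v (a j))) h)) {..<s}"
  proof (rule additive_finsum[OF hom_space_group[OF P0 M] abelian_group_class_ring,
        of "\<lambda>v. to_functional \<Phi> (compose (carrier P\<^sub>1) v h)"])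
    fix u w assume "u \<in> carrier ?H0" "w \<in> carrier ?H0"
    then have u: "u \<in> module_homs C P\<^sub>0 M" and w: "w \<in> module_homs C P\<^sub>0 M" by simp_all
    have "compose (carrier P\<^sub>1) (u \<oplus>\<^bsub>?H0\<^esub> w) h
        = (\<lambda>x\<in>carrier P\<^sub>1. compose (carrier P\<^sub>1) u h x \<oplus>\<^bsub>M\<^esub> compose (carrier P\<^sub>1) w h x)"
      unfolding compose_def hom_space_simps by (rule restrict_ext) (simp add: hx)
    then show "to_functional \<Phi> (compose (carrier P\<^sub>1) (u \<oplus>\<^bsub>?H0\<^esub> w) h)
        = to_functional \<Phi> (compose (carrier P\<^sub>1) u h) \<oplus>\<^bsub>class_ring\<^esub> to_functional \<Phi> (compose (carrier P\<^sub>1) w h)"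
      using to_functional_add[OF \<Phi> compose_h[OF u] compose_h[OF w]] by simp
  qed (use rk0 in auto)
  also have "\<dots> = (\<Sum>j<s. to_functional \<Phi> (compose (carrier P\<^sub>1) (rank_one P\<^sub>0 M (\<alpha> j) (v (a j))) h))"
    by (simp add: class_ring_simps)
  also have "\<dots> = 0"
  proof (rule sum.neutral, rule ballI)
    fix j assume "j \<in> {..<s}"
    then have j: "j < s" by simp
    have \<alpha>': "\<alpha> j \<in> carrier (algebra_dual C P\<^sub>0)" using \<alpha>[OF j] by simp
    have mem: "compose (carrier P\<^sub>1) (\<alpha> j) h \<in> carrier D1" using compose_h[OF \<alpha>[OF j]] by simp
    have "compose (carrier P\<^sub>1) (rank_one P\<^sub>0 M (\<alpha> j) (v (a j))) h = rk (compose (carrier P\<^sub>1) (\<alpha> j) h) (v (a j))"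
      unfolding compose_def rank_one_def by (rule restrict_ext) (simp add: hx)
    then have "to_functional \<Phi> (compose (carrier P\<^sub>1) (rank_one P\<^sub>0 M (\<alpha> j) (v (a j))) h)
        = \<Phi> (v (a j)) (cls (compose (carrier P\<^sub>1) (\<alpha> j) h))"
      using to_functional_rk[OF \<Phi> mem va[OF j]] by simp
    also have "\<dots> = \<Phi> (v (a j)) \<zero>\<^bsub>Tr\<^esub>" using cls_zero[OF imageI[OF \<alpha>']] by simp
    also have "\<dots> = 0" by (rule tau_apply(3)[OF homs_closed[OF \<Phi> va[OF j]]])
    finally show "to_functional \<Phi> (compose (carrier P\<^sub>1) (rank_one P\<^sub>0 M (\<alpha> j) (v (a j))) h) = 0" .
  qed
  finally show "to_functional \<Phi> (compose (carrier P\<^sub>1) v h) = 0" .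
qed

lemma to_functional_inj: "inj_on to_functional (module_homs C M tau)"
proof (rule inj_onI)
  fix \<Phi> \<Psi> assume \<Phi>: "\<Phi> \<in> module_homs C M tau" and \<Psi>: "\<Psi> \<in> module_homs C M tau"
    and eq: "to_functional \<Phi> = to_functional \<Psi>"
  show "\<Phi> = \<Psi>"
  proof (rule homs_eqI[OF \<Phi> \<Psi>])
    fix m assume m: "m \<in> carrier M"
    have ext: "\<Phi> m \<in> extensional (carrier Tr)" "\<Psi> m \<in> extensional (carrier Tr)"
      using homs_closed[OF \<Phi> m] homs_closed[OF \<Psi> m] by (simp_all add: field_dual_mem)
    show "\<Phi> m = \<Psi> m"
    proof (rule extensionalityI[OF ext])
      fix X assume "X \<in> carrier Tr"
      then obtain f where f: "f \<in> carrier D1" "X = cls f" using cls_surj by blast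
      then show "\<Phi> m X = \<Psi> m X"
        using to_functional_rk[OF \<Phi> f(1) m] to_functional_rk[OF \<Psi> f(1) m] eq by simp
    qed
  qed
qed

text \<open>
  The inverse of \<open>to_functional\<close>.  The choice of a representative \<open>f\<close> of the class \<open>X\<close> is harmless, because
  \<open>\<phi>\<close> vanishes on maps that factor through \<open>h\<close>.
\<close>

definition from_functional :: "(('p \<Rightarrow> 'm) \<Rightarrow> 'k) \<Rightarrow> 'm \<Rightarrow> ('p \<Rightarrow> 'c) set \<Rightarrow> 'k" where
  "from_functional \<phi> = (\<lambda>m\<in>carrier M. \<lambda>X\<in>carrier Tr. \<phi> (rk (SOME f. f \<in> X) m))"

lemma from_functional_apply:
  assumes \<phi>: "\<phi> \<in> carrier W" and f: "f \<in> carrier D1" and m: "m \<in> carrier M"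
  shows "from_functional \<phi> m (cls f) = \<phi> (rk f m)"
proof -
  let ?g = "SOME g. g \<in> cls f"
  have "f \<in> cls f" unfolding cls_def by (rule quotient_self[OF D1 U_submodule f])
  then have "?g \<in> cls f" by (rule someI[of "\<lambda>g. g \<in> cls f"])
  then have "\<exists>w\<in>U. ?g = w \<oplus>\<^bsub>D1\<^esub> f"
    unfolding cls_def quotient_mem[OF D1 U_submodule f] .
  then obtain w where w: "w \<in> U" "?g = w \<oplus>\<^bsub>D1\<^esub> f" by (elim bexE)
  from w(1) obtain v where v: "v \<in> module_homs C P\<^sub>0 (regular_module C)" "w = compose (carrier P\<^sub>1) v h"
    by (elim imageE) simp
  have w': "w \<in> carrier D1" using compose_h[OF v(1)] v(2) by simp
  have "rk (w \<oplus>\<^bsub>D1\<^esub> f) m = (\<lambda>x\<in>carrier P\<^sub>1. rk w m x \<oplus>\<^bsub>M\<^esub> rk f m x)"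
    unfolding rank_one_def by (rule restrict_ext) (simp add: D1_closed[OF f] D1_closed[OF w'] lm_l_distr[OF M] m)
  then have "\<phi> (rk (w \<oplus>\<^bsub>D1\<^esub> f) m) = \<phi> (rk w m) + \<phi> (rk f m)"
    using \<phi> rk_hom[OF w' m] rk_hom[OF f m] unfolding hom_functionals_mem by simp
  moreover have "rk w m = compose (carrier P\<^sub>1) (rank_one P\<^sub>0 M v m) h"
    unfolding v(2) compose_def rank_one_def by (rule restrict_ext) (simp add: hx)
  then have "\<phi> (rk w m) = 0"
    using \<phi> rank_one_hom[OF P0 M v(1) m] unfolding hom_functionals_mem by simp
  ultimately show ?thesis
    using w(2) m cls_mem[OF f] by (simp add: from_functional_def)
qed

lemma from_functional_mem:
  assumes \<phi>: "\<phi> \<in> carrier W"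
  shows "from_functional \<phi> \<in> module_homs C M tau"
proof -
  note app = from_functional_apply[OF \<phi>]
  have \<phi>_add: "\<phi> (\<lambda>x\<in>carrier P\<^sub>1. u x \<oplus>\<^bsub>M\<^esub> v x) = \<phi> u + \<phi> v"
    if "u \<in> module_homs C P\<^sub>1 M" "v \<in> module_homs C P\<^sub>1 M" for u v
    using \<phi> that unfolding hom_functionals_mem by blast
  have \<phi>_sc: "\<phi> (\<lambda>x\<in>carrier P\<^sub>1. scalar_act C M k (u x)) = k * \<phi> u" if "u \<in> module_homs C P\<^sub>1 M" for u k
    using \<phi> that unfolding hom_functionals_mem by blast
  have ext: "from_functional \<phi> m \<in> extensional (carrier Tr)" if "m \<in> carrier M" for m
    using that by (simp add: from_functional_def)
  have mem: "from_functional \<phi> m \<in> carrier tau" if m: "m \<in> carrier M" for m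
    unfolding field_dual_mem
  proof (intro conjI ballI allI)
    show "from_functional \<phi> m \<in> extensional (carrier Tr)" by (rule ext[OF m])
    fix X assume "X \<in> carrier Tr"
    then obtain f where f: "f \<in> carrier D1" and X: "X = cls f" using cls_surj by blast
    { fix Y assume "Y \<in> carrier Tr"
      then obtain g where g: "g \<in> carrier D1" and Y: "Y = cls g" using cls_surj by blast
      have "rk (f \<oplus>\<^bsub>D1\<^esub> g) m = (\<lambda>x\<in>carrier P\<^sub>1. rk f m x \<oplus>\<^bsub>M\<^esub> rk g m x)"
        unfolding rank_one_def by (rule restrict_ext) (simp add: D1_closed[OF f] D1_closed[OF g] lm_l_distr[OF M] m)
      then show "from_functional \<phi> m (X \<oplus>\<^bsub>Tr\<^esub> Y) = from_functional \<phi> m X + from_functional \<phi> m Y"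
        unfolding X Y cls_add[OF f g] app[OF f m] app[OF g m] app[OF lm_add[OF D1 f g] m]
        using \<phi>_add[OF rk_hom[OF f m] rk_hom[OF g m]] by simp }
    fix k
    have kf: "(k \<odot> \<one>) \<odot>\<^bsub>D1\<^esub> f \<in> carrier D1" by (rule lm_closed[OF D1 _ f]) (simp add: scal)
    have "rk ((k \<odot> \<one>) \<odot>\<^bsub>D1\<^esub> f) m = (\<lambda>x\<in>carrier P\<^sub>1. scalar_act C M k (rk f m x))"
      unfolding rank_one_def scalar_act_def
      by (rule restrict_ext)
         (simp add: D1_closed[OF f] m scal flip: lm_assoc[OF M], simp add: scal_comm D1_closed[OF f])
    then show "from_functional \<phi> m (scalar_act C Tr k X) = k * from_functional \<phi> m X"
      unfolding X scalar_act_def cls_act[OF scal f] app[OF f m] app[OF kf m]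
      using \<phi>_sc[OF rk_hom[OF f m]] by (simp add: scalar_act_def)
  qed
  show ?thesis
  proof (rule module_homsI)
    show "from_functional \<phi> m \<in> carrier tau" if "m \<in> carrier M" for m by (rule mem[OF that])
    show "from_functional \<phi> \<in> extensional (carrier M)" by (simp add: from_functional_def)
    fix m assume m: "m \<in> carrier M"
    { fix n assume n: "n \<in> carrier M"
      note mn = lm_add[OF M m n]
      show "from_functional \<phi> (m \<oplus>\<^bsub>M\<^esub> n) = from_functional \<phi> m \<oplus>\<^bsub>tau\<^esub> from_functional \<phi> n"
      proof (rule extensionalityI[OF ext[OF mn]])
        show "from_functional \<phi> m \<oplus>\<^bsub>tau\<^esub> from_functional \<phi> n \<in> extensional (carrier Tr)" by simp
        fix X assume X': "X \<in> carrier Tr"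
        then obtain f where f: "f \<in> carrier D1" and X: "X = cls f" using cls_surj by blast
        have "rk f (m \<oplus>\<^bsub>M\<^esub> n) = (\<lambda>x\<in>carrier P\<^sub>1. rk f m x \<oplus>\<^bsub>M\<^esub> rk f n x)"
          unfolding rank_one_def by (rule restrict_ext) (simp add: D1_closed[OF f] lm_r_distr[OF M] m n)
        then show "from_functional \<phi> (m \<oplus>\<^bsub>M\<^esub> n) X = (from_functional \<phi> m \<oplus>\<^bsub>tau\<^esub> from_functional \<phi> n) X"
          using \<phi>_add[OF rk_hom[OF f m] rk_hom[OF f n]] X' app[OF f m] app[OF f n] app[OF f mn]
          unfolding X by simp
      qed }
    fix c assume c: "c \<in> carrier C"
    note cm = lm_closed[OF M c m]
    show "from_functional \<phi> (c \<odot>\<^bsub>M\<^esub> m) = c \<odot>\<^bsub>tau\<^esub> from_functional \<phi> m"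
    proof (rule extensionalityI[OF ext[OF cm]])
      show "c \<odot>\<^bsub>tau\<^esub> from_functional \<phi> m \<in> extensional (carrier Tr)" by simp
      fix X assume "X \<in> carrier Tr"
      then obtain f where f: "f \<in> carrier D1" and X: "X = cls f" using cls_surj by blast
      have cf: "c \<odot>\<^bsub>D1\<^esub> f \<in> carrier D1" by (rule lm_closed[OF D1 _ f]) (simp add: c)
      have "rk f (c \<odot>\<^bsub>M\<^esub> m) = rk (c \<odot>\<^bsub>D1\<^esub> f) m"
        unfolding rank_one_def by (rule restrict_ext) (simp add: D1_closed[OF f] lm_assoc[OF M] m c)
      then show "from_functional \<phi> (c \<odot>\<^bsub>M\<^esub> m) X = (c \<odot>\<^bsub>tau\<^esub> from_functional \<phi> m) X"
        unfolding X tau_apply(2)[OF mem[OF m] c f] app[OF f cm] app[OF cf m] by simp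
    qed
  qed
qed

lemma to_from_functional:
  assumes \<phi>: "\<phi> \<in> carrier W"
  shows "to_functional (from_functional \<phi>) = \<phi>"
proof (rule extensionalityI[of _ "module_homs C P\<^sub>1 M"])
  show "to_functional (from_functional \<phi>) \<in> extensional (module_homs C P\<^sub>1 M)" by (simp add: to_functional_def)
  show "\<phi> \<in> extensional (module_homs C P\<^sub>1 M)" using \<phi> unfolding hom_functionals_mem by blast
  have \<phi>_add: "\<phi> (\<lambda>x\<in>carrier P\<^sub>1. u x \<oplus>\<^bsub>M\<^esub> v x) = \<phi> u + \<phi> v"
    if "u \<in> module_homs C P\<^sub>1 M" "v \<in> module_homs C P\<^sub>1 M" for u v
    using \<phi> that unfolding hom_functionals_mem by blast
  fix u assume u: "u \<in> module_homs C P\<^sub>1 M"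
  have ub: "u (b i) \<in> carrier M" if "i < r" for i using homs_closed[OF u dual_basisD(1)[OF B1 that]] .
  have "to_functional (from_functional \<phi>) u = (\<Sum>i<r. \<phi> (rk (\<beta> i) (u (b i))))"
    using u by (simp add: to_functional_def from_functional_apply[OF \<phi> D1_basis ub])
  also have "\<dots> = finsum class_ring (\<lambda>i. \<phi> (rk (\<beta> i) (u (b i)))) {..<r}" by (simp add: class_ring_simps)
  also have "\<dots> = \<phi> (finsum (hom_space C P\<^sub>1 M) (\<lambda>i. rk (\<beta> i) (u (b i))) {..<r})"
  proof (rule additive_finsum[OF hom_space_group[OF P1 M] abelian_group_class_ring, symmetric])
    show "\<phi> (v \<oplus>\<^bsub>hom_space C P\<^sub>1 M\<^esub> w) = \<phi> v \<oplus>\<^bsub>class_ring\<^esub> \<phi> w"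
      if "v \<in> carrier (hom_space C P\<^sub>1 M)" "w \<in> carrier (hom_space C P\<^sub>1 M)" for v w
      using \<phi>_add[of v w] that unfolding hom_space_simps by simp
  qed (use rk_hom[OF D1_basis ub] in simp_all)
  also have "\<dots> = \<phi> u" by (simp add: hom_expand[OF P1 M B1 u])
  finally show "to_functional (from_functional \<phi>) u = \<phi> u" .
qed

text \<open>
  This is \<open>Hom\<^sub>C(M, D Tr) = D(Tr \<otimes>\<^sub>C M) = D coker(Hom\<^sub>C(P\<^sub>0, M) \<rightarrow> Hom\<^sub>C(P\<^sub>1, M))\<close>.
\<close>

theorem hom_tau_dim:
  "vectorspace class_ring W"
  "vectorspace.dim class_ring (hom_space C M tau) = vectorspace.dim class_ring W"
proof -
  have "to_functional ` module_homs C M tau = carrier W"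
  proof
    show "to_functional ` module_homs C M tau \<subseteq> carrier W" using to_functional_mem by blast
    show "carrier W \<subseteq> to_functional ` module_homs C M tau"
    proof
      fix \<phi> assume \<phi>: "\<phi> \<in> carrier W"
      show "\<phi> \<in> to_functional ` module_homs C M tau"
        using imageI[OF from_functional_mem[OF \<phi>], of to_functional] unfolding to_from_functional[OF \<phi>] .
    qed
  qed
  then have bij: "bij_betw to_functional (carrier (hom_space C M tau)) (carrier W)"
    using to_functional_inj by (simp add: bij_betw_def)
  have ub: "u (b i) \<in> carrier M" "cls (\<beta> i) \<in> carrier Tr" if "i < r" "u \<in> module_homs C P\<^sub>1 M" for i u
    using homs_closed[OF that(2) dual_basisD(1)[OF B1 that(1)]] cls_mem[OF D1_basis[OF that(1)]] .
  have add: "to_functional (\<Phi> \<oplus>\<^bsub>hom_space C M tau\<^esub> \<Psi>) = to_functional \<Phi> \<oplus>\<^bsub>W\<^esub> to_functional \<Psi>" for \<Phi> \<Psi>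
    unfolding hom_functionals_simps to_functional_def
    by (rule restrict_ext) (simp add: ub sum.distrib)
  have smult: "to_functional (k \<odot>\<^bsub>hom_space C M tau\<^esub> \<Phi>) = k \<odot>\<^bsub>W\<^esub> to_functional \<Phi>"
    if \<Phi>: "\<Phi> \<in> carrier (hom_space C M tau)" for k \<Phi>
    unfolding hom_functionals_simps to_functional_def
    by (rule restrict_ext)
       (use \<Phi> in \<open>simp add: ub sum_distrib_left field_dual_scalar[OF Tr] homs_closed\<close>)
  have zero: "to_functional \<zero>\<^bsub>hom_space C M tau\<^esub> = \<zero>\<^bsub>W\<^esub>"
    unfolding hom_functionals_simps to_functional_def by (rule restrict_ext) (simp add: ub)
  show "vectorspace class_ring W"
    by (rule vectorspace_transport(1)[OF hom_tau bij]) (rule add smult zero; assumption)+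
  show "vectorspace.dim class_ring (hom_space C M tau) = vectorspace.dim class_ring W"
    by (rule vectorspace_transport(2)[OF hom_tau bij]) (rule add smult zero; assumption)+
qed

end

section \<open>Finite-dimensional modules\<close>

context K_algebra
begin

abbreviation module_dim :: "('c, 'm) module \<Rightarrow> nat" where
  "module_dim M \<equiv> vectorspace.dim class_ring (underlying_space C M)"

lemma fd_moduleD: "fd_module C M \<Longrightarrow> left_module C M"
  "fd_module C M \<Longrightarrow> vectorspace.fin_dim class_ring (underlying_space C M)"
  by (simp_all add: fd_module_def)

lemma underlying_sub: "underlying_space C (M\<lparr>carrier := U\<rparr>) = (underlying_space C M)\<lparr>carrier := U\<rparr>"
  by (simp add: underlying_space_def scalar_act_def fun_eq_iff)

lemma left_submodule_subspace:
  assumes M: "left_module C M" and U: "left_submodule C U M"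
  shows "submodule class_ring U (underlying_space C M)"
proof -
  interpret V: vectorspace class_ring "underlying_space C M" by (rule underlying_vectorspace[OF M])
  show ?thesis
  proof (rule submodule.intro)
    show "module class_ring (underlying_space C M)" by (rule V.module_axioms)
    show "U \<subseteq> carrier (underlying_space C M)" using left_submoduleD(1)[OF U] by simp
    show "\<zero>\<^bsub>underlying_space C M\<^esub> \<in> U" using left_submoduleD(2)[OF U] by simp
    show "v \<oplus>\<^bsub>underlying_space C M\<^esub> w \<in> U" if "v \<in> U" "w \<in> U" for v w
      using left_submoduleD(4)[OF U that] by simp
    show "k \<odot>\<^bsub>underlying_space C M\<^esub> v \<in> U" if "v \<in> U" for k v
      using left_submoduleD(5)[OF U scal that] by (simp add: scalar_act_def)
  qed
qed

lemma fd_submodule: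
  assumes M: "fd_module C M" and U: "left_submodule C U M"
  shows "fd_module C (M\<lparr>carrier := U\<rparr>)" and "module_dim (M\<lparr>carrier := U\<rparr>) \<le> module_dim M"
    and "module_dim (M\<lparr>carrier := U\<rparr>) = module_dim M \<Longrightarrow> U = carrier M"
proof -
  note M' = fd_moduleD[OF M]
  note sub = fin_dim_subspace[OF underlying_vectorspace[OF M'(1)] M'(2) left_submodule_subspace[OF M'(1) U],
      folded underlying_sub]
  show "fd_module C (M\<lparr>carrier := U\<rparr>)"
    using sub(1) left_submodule_left_module[OF M'(1) U] by (simp add: fd_module_def)
  show "module_dim (M\<lparr>carrier := U\<rparr>) \<le> module_dim M" by (rule sub(2))
  show "module_dim (M\<lparr>carrier := U\<rparr>) = module_dim M \<Longrightarrow> U = carrier M" using sub(3) by simp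
qed

lemma hom_linear_map:
  assumes M: "left_module C M" and N: "left_module C N" and f: "f \<in> module_homs C M N"
  shows "linear_map class_ring (underlying_space C M) (underlying_space C N) f"
proof -
  interpret V: vectorspace class_ring "underlying_space C M" by (rule underlying_vectorspace[OF M])
  interpret W: vectorspace class_ring "underlying_space C N" by (rule underlying_vectorspace[OF N])
  have "f \<in> module_hom class_ring (underlying_space C M) (underlying_space C N)"
    unfolding module_hom_def
    using homs_funcset[OF f] homs_add[OF f] homs_scalar[OF f] by simp
  then have "mod_hom class_ring (underlying_space C M) (underlying_space C N) f"
    using V.module_axioms W.module_axioms by (simp add: mod_hom_def mod_hom_axioms_def)
  then show ?thesis by (simp add: linear_map_def V.vectorspace_axioms W.vectorspace_axioms)
qed

lemma image_submodule:
  assumes M: "left_module C M" and N: "left_module C N" and f: "f \<in> module_homs C M N"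
    and U: "left_submodule C U M"
  shows "left_submodule C (f ` U) N"
proof (rule left_submoduleI[OF N])
  note UM = left_submoduleD(1)[OF U, THEN subsetD]
  show "f ` U \<subseteq> carrier N" using homs_closed[OF f] UM by blast
  show "\<zero>\<^bsub>N\<^esub> \<in> f ` U"
    using homs_zero[OF f lm_group[OF M] lm_group[OF N]] left_submoduleD(2)[OF U] by (metis imageI)
  fix x assume "x \<in> f ` U"
  then obtain u where u: "u \<in> U" "x = f u" by blast
  { fix y assume "y \<in> f ` U"
    then obtain v where v: "v \<in> U" "y = f v" by blast
    have "f (u \<oplus>\<^bsub>M\<^esub> v) = x \<oplus>\<^bsub>N\<^esub> y" using homs_add[OF f UM[OF u(1)] UM[OF v(1)]] u v by simp
    then show "x \<oplus>\<^bsub>N\<^esub> y \<in> f ` U" using left_submoduleD(4)[OF U u(1) v(1)] by (metis imageI) }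
  fix c assume c: "c \<in> carrier C"
  have "f (c \<odot>\<^bsub>M\<^esub> u) = c \<odot>\<^bsub>N\<^esub> x" using homs_act[OF f c UM[OF u(1)]] u by simp
  then show "c \<odot>\<^bsub>N\<^esub> x \<in> f ` U" using left_submoduleD(5)[OF U c u(1)] by (metis imageI)
qed

lemma carrier_submodule: assumes M: "left_module C M" shows "left_submodule C (carrier M) M"
  by (rule left_submoduleI[OF M]) (simp_all add: lm_zero[OF M] lm_add[OF M] lm_closed[OF M])

lemma kernel_submodule:
  assumes M: "left_module C M" and N: "left_module C N" and f: "f \<in> module_homs C M N"
  shows "left_submodule C (a_kernel M N f) M"
proof (rule left_submoduleI[OF M])
  interpret N: abelian_group N by (rule lm_group[OF N])
  show "a_kernel M N f \<subseteq> carrier M" by (auto simp: a_kernel_def')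
  show "\<zero>\<^bsub>M\<^esub> \<in> a_kernel M N f"
    using lm_zero[OF M] homs_zero[OF f lm_group[OF M] lm_group[OF N]] by (simp add: a_kernel_def')
  show "x \<oplus>\<^bsub>M\<^esub> y \<in> a_kernel M N f" if "x \<in> a_kernel M N f" "y \<in> a_kernel M N f" for x y
    using that lm_add[OF M] homs_add[OF f] by (simp add: a_kernel_def')
  show "c \<odot>\<^bsub>M\<^esub> x \<in> a_kernel M N f" if "c \<in> carrier C" "x \<in> a_kernel M N f" for c x
    using that lm_closed[OF M] homs_act[OF f] lm_act_zero[OF N] by (simp add: a_kernel_def')
qed

lemma subspace_finsum:
  assumes "submodule class_ring T (underlying_space C M)" and "abelian_group M" and "finite A"
    and "\<And>i. i \<in> A \<Longrightarrow> g i \<in> T"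
  shows "finsum M g A \<in> T"
  using \<open>finite A\<close> assms(4)
proof (induction A)
  interpret M: abelian_group M by fact
  note T = submodule.subset[OF assms(1)] submodule.zero_closed[OF assms(1)] submodule.m_closed[OF assms(1)]
  { case empty
    show ?case using T(2) by simp
  next
    case (insert i A)
    have "g j \<in> carrier M" if "j \<in> insert i A" for j using insert.prems[OF that] T(1) by auto
    then have "finsum M g (insert i A) = g i \<oplus>\<^bsub>M\<^esub> finsum M g A"
      by (intro M.finsum_insert[OF insert.hyps]) auto
    then show ?case using T(3)[OF insert.prems[of i] insert.IH] insert.prems by simp }
qed

definition generates :: "('c, 'm) module \<Rightarrow> nat \<Rightarrow> (nat \<Rightarrow> 'm) \<Rightarrow> bool" where
  "generates M r b \<longleftrightarrow> b \<in> {..<r} \<rightarrow> carrier M \<and>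
     (\<forall>x\<in>carrier M. \<exists>c\<in>{..<r} \<rightarrow> carrier C. finsum M (\<lambda>i. c i \<odot>\<^bsub>M\<^esub> b i) {..<r} = x)"

text \<open>
  If \<open>S\<close> spans \<open>C\<close> over \<open>K\<close>, then the products \<open>s b\<^sub>i\<close> with \<open>s \<in> S\<close> span \<open>M\<close> over \<open>K\<close>.
\<close>

lemma fd_if_generates:
  assumes C: "fd_module C (regular_module C)" and M: "left_module C M" and gen: "generates M r b"
  shows "fd_module C M"
proof -
  interpret R: vectorspace class_ring "underlying_space C (regular_module C)"
    by (rule underlying_vectorspace[OF regular_left_module])
  interpret V: vectorspace class_ring "underlying_space C M" by (rule underlying_vectorspace[OF M])
  have b: "b i \<in> carrier M" if "i < r" for i using gen that by (auto simp: generates_def)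
  obtain S where S: "finite S" "S \<subseteq> carrier C" "R.span S = carrier C"
    using fd_moduleD(2)[OF C] unfolding R.fin_dim_def by auto
  let ?G = "(\<lambda>(i, c). c \<odot>\<^bsub>M\<^esub> b i) ` ({..<r} \<times> S)"
  have G: "?G \<subseteq> carrier M" using b S(2) lm_closed[OF M] by auto
  have T: "submodule class_ring (V.span ?G) (underlying_space C M)"
    by (rule V.span_is_submodule) (use G in simp)
  note T' = submodule.zero_closed[OF T] submodule.m_closed[OF T] submodule.smult_closed[OF T]
  have cb: "c \<odot>\<^bsub>M\<^esub> b i \<in> V.span ?G" if i: "i < r" and c: "c \<in> carrier C" for c i
  proof -
    let ?T = "{c \<in> carrier C. c \<odot>\<^bsub>M\<^esub> b i \<in> V.span ?G}"
    have "submodule class_ring ?T (underlying_space C (regular_module C))"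
    proof (rule submodule.intro)
      show "module class_ring (underlying_space C (regular_module C))" by (rule R.module_axioms)
      show "\<zero>\<^bsub>underlying_space C (regular_module C)\<^esub> \<in> ?T"
        using T'(1) lm_zero_act[OF M b[OF i]] by simp
      show "v \<oplus>\<^bsub>underlying_space C (regular_module C)\<^esub> w \<in> ?T" if "v \<in> ?T" "w \<in> ?T" for v w
        using that T'(2)[of "v \<odot>\<^bsub>M\<^esub> b i" "w \<odot>\<^bsub>M\<^esub> b i"] lm_l_distr[OF M _ _ b[OF i]] by simp
      show "k \<odot>\<^bsub>underlying_space C (regular_module C)\<^esub> v \<in> ?T" if "v \<in> ?T" for k v
        using that T'(3)[of k "v \<odot>\<^bsub>M\<^esub> b i"] scal[of k] lm_assoc[OF M _ _ b[OF i]]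
        by (simp add: scalar_act_def)
    qed simp
    moreover have "S \<subseteq> ?T"
    proof
      fix c assume c: "c \<in> S"
      have "?G \<subseteq> V.span ?G" by (rule V.in_own_span) (use G in simp)
      moreover have "c \<odot>\<^bsub>M\<^esub> b i \<in> ?G" using c i by (auto intro!: image_eqI[of _ _ "(i, c)"])
      ultimately show "c \<in> ?T" using c S(2) by blast
    qed
    ultimately have "R.span S \<subseteq> ?T" by (rule R.span_is_subset[rotated])
    then show ?thesis using c S(3) by blast
  qed
  have "carrier M \<subseteq> V.span ?G"
  proof
    fix x assume "x \<in> carrier M"
    then obtain c where c: "c \<in> {..<r} \<rightarrow> carrier C" "finsum M (\<lambda>i. c i \<odot>\<^bsub>M\<^esub> b i) {..<r} = x"
      using gen unfolding generates_def by blast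
    have "finsum M (\<lambda>i. c i \<odot>\<^bsub>M\<^esub> b i) {..<r} \<in> V.span ?G"
      by (rule subspace_finsum[OF T lm_group[OF M]]) (use cb c(1) in auto)
    then show "x \<in> V.span ?G" using c(2) by simp
  qed
  moreover have "V.span ?G \<subseteq> carrier M" using submodule.subset[OF T] by simp
  ultimately have "V.fin_dim"
    unfolding V.fin_dim_def using S(1) G by (intro exI[of _ ?G]) (simp add: subset_antisym)
  then show ?thesis using M by (simp add: fd_module_def)
qed

lemma fd_generates:
  assumes fd: "fd_module C M"
  shows "\<exists>r b. generates M r b"
proof -
  note M = fd_moduleD(1)[OF fd]
  interpret V: vectorspace class_ring "underlying_space C M" by (rule underlying_vectorspace[OF M])
  interpret M: abelian_group M by (rule lm_group[OF M])
  obtain S where S: "finite S" "S \<subseteq> carrier M" "V.span S = carrier M"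
    using fd_moduleD(2)[OF fd] unfolding V.fin_dim_def by auto
  obtain b where b: "bij_betw b {..<card S} S"
    using ex_bij_betw_nat_finite[OF S(1)] by (auto simp: atLeast0LessThan)
  have bS: "b i \<in> S" if "i < card S" for i using b that by (auto simp: bij_betw_def)
  have "\<exists>c\<in>{..<card S} \<rightarrow> carrier C. finsum M (\<lambda>i. c i \<odot>\<^bsub>M\<^esub> b i) {..<card S} = x"
    if x: "x \<in> carrier M" for x
  proof -
    have "x \<in> {V.lincomb k S |k. k \<in> S \<rightarrow> carrier class_ring}"
      using x S V.finite_span[of S] by simp
    then obtain k where k: "x = V.lincomb k S" by blast
    have "x = finsum (underlying_space C M) (\<lambda>v. scalar_act C M (k v) v) S"
      unfolding k V.lincomb_def by simp
    also have "\<dots> = finsum M (\<lambda>v. scalar_act C M (k v) v) S"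
      by (rule finsum_cong_record) simp_all
    also have "\<dots> = finsum M (\<lambda>v. scalar_act C M (k v) v) (b ` {..<card S})"
      using b by (simp add: bij_betw_def)
    also have "\<dots> = finsum M (\<lambda>i. scalar_act C M (k (b i)) (b i)) {..<card S}"
    proof (rule M.finsum_reindex)
      show "(\<lambda>v. scalar_act C M (k v) v) \<in> b ` {..<card S} \<rightarrow> carrier M"
        using bS S(2) scalar_act_closed[OF M] by auto
      show "inj_on b {..<card S}" using b by (simp add: bij_betw_def)
    qed
    finally have "finsum M (\<lambda>i. (k (b i) \<odot> \<one>) \<odot>\<^bsub>M\<^esub> b i) {..<card S} = x"
      by (simp add: scalar_act_def)
    then show ?thesis using scal by (intro bexI[of _ "\<lambda>i. k (b i) \<odot> \<one>"]) auto
  qed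
  then have "generates M (card S) b" unfolding generates_def using bS S(2) by auto
  then show ?thesis by blast
qed

section \<open>Projective modules\<close>

definition basis_hom :: "('c, 'p) module \<Rightarrow> nat \<Rightarrow> (nat \<Rightarrow> 'p \<Rightarrow> 'c) \<Rightarrow> ('c, 'm) module \<Rightarrow> (nat \<Rightarrow> 'm) \<Rightarrow> 'p \<Rightarrow> 'm" where
  "basis_hom P r \<beta> M y = (\<lambda>x\<in>carrier P. finsum M (\<lambda>i. \<beta> i x \<odot>\<^bsub>M\<^esub> y i) {..<r})"

lemma basis_hom:
  assumes P: "left_module C P" and M: "left_module C M"
    and \<beta>: "\<beta> \<in> {..<r} \<rightarrow> module_homs C P (regular_module C)" and y: "y \<in> {..<r} \<rightarrow> carrier M"
  shows "basis_hom P r \<beta> M y \<in> module_homs C P M"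
proof -
  interpret H: abelian_group "hom_space C P M" by (rule hom_space_group[OF P M])
  interpret M: abelian_group M by (rule lm_group[OF M])
  let ?F = "\<lambda>i. rank_one P M (\<beta> i) (y i)"
  have F: "?F \<in> {..<r} \<rightarrow> module_homs C P M"
    using rank_one_hom[OF P M] \<beta> y by auto
  have yi: "y i \<in> carrier M" if "i < r" for i using y that by blast
  have \<beta>x: "\<beta> i x \<in> carrier C" if "i < r" "x \<in> carrier P" for i x
    using homs_closed[of "\<beta> i" C P "regular_module C" x] \<beta> that by auto
  have "finsum (hom_space C P M) ?F {..<r} \<in> module_homs C P M"
    using H.finsum_closed[of ?F "{..<r}"] F by simp
  moreover have "finsum (hom_space C P M) ?F {..<r} = basis_hom P r \<beta> M y"
  proof (rule extensionalityI[of _ "carrier P"])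
    show "finsum (hom_space C P M) ?F {..<r} \<in> extensional (carrier P)"
      by (rule homs_ext) fact
    show "basis_hom P r \<beta> M y \<in> extensional (carrier P)" by (simp add: basis_hom_def)
    fix x assume x: "x \<in> carrier P"
    have "finsum (hom_space C P M) ?F {..<r} x = finsum M (\<lambda>i. ?F i x) {..<r}"
      by (rule hom_space_finsum_apply[OF P M x _ F]) simp
    also have "\<dots> = finsum M (\<lambda>i. \<beta> i x \<odot>\<^bsub>M\<^esub> y i) {..<r}"
      by (rule M.finsum_cong'[OF refl]) (use x in \<open>simp_all add: rank_one_def yi \<beta>x lm_closed[OF M]\<close>)
    finally show "finsum (hom_space C P M) ?F {..<r} x = basis_hom P r \<beta> M y x"
      using x by (simp add: basis_hom_def)
  qed
  ultimately show ?thesis by simp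
qed

text \<open>
  Choose preimages \<open>y\<^sub>i\<close> of the \<open>f(b\<^sub>i)\<close>; the map \<open>x \<mapsto> \<Sum>\<^sub>i \<beta>\<^sub>i(x) y\<^sub>i\<close> lifts \<open>f\<close>.
\<close>

lemma dual_basis_lift:
  assumes P: "left_module C P" and B: "dual_basis C P r b \<beta>" and X: "left_module C X" and Y: "left_module C Y"
    and g: "g \<in> module_homs C X Y" "g ` carrier X = carrier Y" and f: "f \<in> module_homs C P Y"
  shows "\<exists>k\<in>module_homs C P X. \<forall>x\<in>carrier P. g (k x) = f x"
proof -
  have b: "b i \<in> carrier P" if "i < r" for i using dual_basisD(1)[OF B that] .
  have "\<exists>y\<in>carrier X. g y = f (b i)" if "i < r" for i
  proof -
    have "f (b i) \<in> g ` carrier X" using homs_closed[OF f b[OF that]] g(2) by simp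
    then show ?thesis by auto
  qed
  then obtain y where y: "\<And>i. i < r \<Longrightarrow> y i \<in> carrier X \<and> g (y i) = f (b i)" by metis
  have \<beta>: "\<beta> \<in> {..<r} \<rightarrow> module_homs C P (regular_module C)" using dual_basisD(2)[OF B] by auto
  show ?thesis
  proof (intro bexI[of _ "basis_hom P r \<beta> X y"] ballI)
    show "basis_hom P r \<beta> X y \<in> module_homs C P X" by (rule basis_hom[OF P X \<beta>]) (use y in auto)
    interpret Y: abelian_group Y by (rule lm_group[OF Y])
    fix x assume x: "x \<in> carrier P"
    note \<beta>x = dual_basisD(3)[OF B _ x]
    have "g (basis_hom P r \<beta> X y x) = finsum Y (\<lambda>i. g (\<beta> i x \<odot>\<^bsub>X\<^esub> y i)) {..<r}"
      using x by (simp add: basis_hom_def)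
        (rule homs_finsum[OF g(1) lm_group[OF X] lm_group[OF Y]]; use y lm_closed[OF X] \<beta>x in auto)
    also have "\<dots> = finsum Y (\<lambda>i. f (\<beta> i x \<odot>\<^bsub>P\<^esub> b i)) {..<r}"
      by (rule Y.finsum_cong'[OF refl])
         (use y \<beta>x b homs_act[OF g(1)] homs_act[OF f] homs_closed[OF f] lm_closed[OF P] lm_closed[OF Y] in auto)
    also have "\<dots> = f (finsum P (\<lambda>i. \<beta> i x \<odot>\<^bsub>P\<^esub> b i) {..<r})"
      by (rule homs_finsum[OF f lm_group[OF P] lm_group[OF Y], symmetric])
         (use \<beta>x b lm_closed[OF P] in auto)
    also have "\<dots> = f x" by (simp add: dual_basisD(4)[OF B x])
    finally show "g (basis_hom P r \<beta> X y x) = f x" .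
  qed
qed

lemma dual_basis_generates: assumes "dual_basis C P r b \<beta>" shows "generates P r b"
  unfolding generates_def
proof (intro conjI ballI)
  show "b \<in> {..<r} \<rightarrow> carrier P" using assms by (simp add: dual_basis_def)
  fix x assume x: "x \<in> carrier P"
  show "\<exists>c\<in>{..<r} \<rightarrow> carrier C. finsum P (\<lambda>i. c i \<odot>\<^bsub>P\<^esub> b i) {..<r} = x"
    by (rule bexI[of _ "\<lambda>i. \<beta> i x"]) (use dual_basisD(3,4)[OF assms] x in auto)
qed

lemma dual_basis_projective:
  assumes C: "fd_module C (regular_module C)" and P: "left_module C P" and B: "dual_basis C P r b \<beta>"
  shows "projective_module C P"
  unfolding projective_module_def
proof (intro conjI allI impI)
  show "fd_module C P" by (rule fd_if_generates[OF C P dual_basis_generates[OF B]])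
  fix X Y :: "('c, nat \<Rightarrow> 'c) module" and g f
  assume a: "fd_module C X \<and> fd_module C Y \<and>
        g \<in> module_homs C X Y \<and> g ` carrier X = carrier Y \<and> f \<in> module_homs C P Y"
  then obtain k where k: "k \<in> module_homs C P X" "\<And>x. x \<in> carrier P \<Longrightarrow> g (k x) = f x"
    using dual_basis_lift[OF P B, of X Y g f] fd_moduleD(1) by blast
  have "compose (carrier P) g k = f"
    by (rule extensionalityI[of _ "carrier P"]) (use k(2) a homs_ext in \<open>auto simp: compose_eq\<close>)
  then show "\<exists>h\<in>module_homs C P X. compose (carrier P) g h = f" using k(1) by blast
qed

text \<open>
  The module \<open>C\<^sup>r\<close>, on the type of modules against which projectivity is tested.
\<close>

definition free_module :: "nat \<Rightarrow> ('c, nat \<Rightarrow> 'c) module" where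
  "free_module r = \<lparr>carrier = {..<r} \<rightarrow>\<^sub>E carrier C, mult = undefined, one = undefined,
     zero = (\<lambda>i\<in>{..<r}. \<zero>), add = (\<lambda>x y. \<lambda>i\<in>{..<r}. x i \<oplus> y i),
     smult = (\<lambda>c x. \<lambda>i\<in>{..<r}. c \<otimes> x i)\<rparr>"

lemma free_simps [simp]:
  "carrier (free_module r) = ({..<r} \<rightarrow>\<^sub>E carrier C)" "zero (free_module r) = (\<lambda>i\<in>{..<r}. \<zero>)"
  "add (free_module r) = (\<lambda>x y. \<lambda>i\<in>{..<r}. x i \<oplus> y i)"
  "smult (free_module r) = (\<lambda>c x. \<lambda>i\<in>{..<r}. c \<otimes> x i)"
  by (simp_all add: free_module_def)

lemma free_left_module: "left_module C (free_module r)"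
proof (rule left_moduleI[OF ring_axioms])
  have mem: "x i \<in> carrier C" if "x \<in> carrier (free_module r)" "i < r" for x i
    using that by auto
  show "abelian_group (free_module r)"
  proof (rule pointwise_abelian_group[OF is_abelian_group, of "{..<r} \<rightarrow>\<^sub>E carrier C" "{..<r}"])
    fix x assume x: "x \<in> {..<r} \<rightarrow>\<^sub>E carrier C"
    have "(\<lambda>i\<in>{..<r}. \<ominus> x i) \<in> {..<r} \<rightarrow>\<^sub>E carrier C" using x by auto
    then show "\<exists>g\<in>{..<r} \<rightarrow>\<^sub>E carrier C. \<forall>i\<in>{..<r}. g i \<oplus> x i = \<zero>"
      by (rule bexI[rotated]) (use x l_neg in auto)
  qed auto
  fix c c' x y assume c: "c \<in> carrier C" and x: "x \<in> carrier (free_module r)"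
  show "c \<odot>\<^bsub>free_module r\<^esub> x \<in> carrier (free_module r)" using c x by auto
  { assume c': "c' \<in> carrier C"
    show "(c \<oplus> c') \<odot>\<^bsub>free_module r\<^esub> x = c \<odot>\<^bsub>free_module r\<^esub> x \<oplus>\<^bsub>free_module r\<^esub> c' \<odot>\<^bsub>free_module r\<^esub> x"
      unfolding free_simps by (rule restrict_ext) (simp add: c c' mem[OF x] l_distr)
    show "(c \<otimes> c') \<odot>\<^bsub>free_module r\<^esub> x = c \<odot>\<^bsub>free_module r\<^esub> (c' \<odot>\<^bsub>free_module r\<^esub> x)"
      unfolding free_simps by (rule restrict_ext) (simp add: c c' mem[OF x] m_assoc) }
  assume y: "y \<in> carrier (free_module r)"
  show "c \<odot>\<^bsub>free_module r\<^esub> (x \<oplus>\<^bsub>free_module r\<^esub> y)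
      = c \<odot>\<^bsub>free_module r\<^esub> x \<oplus>\<^bsub>free_module r\<^esub> c \<odot>\<^bsub>free_module r\<^esub> y"
    unfolding free_simps by (rule restrict_ext) (simp add: c mem[OF x] mem[OF y] r_distr)
next
  fix x assume x: "x \<in> carrier (free_module r)"
  then have "x i \<in> carrier C" if "i < r" for i using that by auto
  then show "\<one> \<odot>\<^bsub>free_module r\<^esub> x = x"
    by (intro extensionalityI[of _ "{..<r}"]) (use x in \<open>auto simp: PiE_def\<close>)
qed

lemma free_dual_basis:
  "dual_basis C (free_module r) r (\<lambda>j. \<lambda>i\<in>{..<r}. if i = j then \<one> else \<zero>) (\<lambda>i. \<lambda>x\<in>carrier (free_module r). x i)"
  unfolding dual_basis_def
proof (intro conjI ballI)
  let ?e = "\<lambda>j. \<lambda>i\<in>{..<r}. if i = j then \<one> else \<zero>" and ?F = "free_module r"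
  note F = free_left_module[of r]
  show e: "?e \<in> {..<r} \<rightarrow> carrier ?F" by auto
  show "(\<lambda>i. \<lambda>x\<in>carrier ?F. x i) \<in> {..<r} \<rightarrow> module_homs C ?F (regular_module C)"
  proof
    fix i assume i: "i \<in> {..<r}"
    show "(\<lambda>x\<in>carrier ?F. x i) \<in> module_homs C ?F (regular_module C)"
    proof (rule module_homsI)
      show "(\<lambda>x\<in>carrier ?F. x i) x \<in> carrier (regular_module C)" if "x \<in> carrier ?F" for x
        using that i by auto
      show "(\<lambda>x\<in>carrier ?F. x i) (x \<oplus>\<^bsub>?F\<^esub> y)
          = (\<lambda>x\<in>carrier ?F. x i) x \<oplus>\<^bsub>regular_module C\<^esub> (\<lambda>x\<in>carrier ?F. x i) y"
        if "x \<in> carrier ?F" "y \<in> carrier ?F" for x y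
        using lm_add[OF F that] that i by simp
      show "(\<lambda>x\<in>carrier ?F. x i) (c \<odot>\<^bsub>?F\<^esub> x) = c \<odot>\<^bsub>regular_module C\<^esub> (\<lambda>x\<in>carrier ?F. x i) x"
        if "c \<in> carrier C" "x \<in> carrier ?F" for c x
        using lm_closed[OF F that] that i by simp
    qed simp
  qed
  fix x assume x: "x \<in> carrier ?F"
  then have xi: "x i \<in> carrier C" if "i < r" for i using that by auto
  let ?s = "finsum ?F (\<lambda>i. (\<lambda>x\<in>carrier ?F. x i) x \<odot>\<^bsub>?F\<^esub> ?e i) {..<r}"
  have m: "(\<lambda>i. (\<lambda>x\<in>carrier ?F. x i) x \<odot>\<^bsub>?F\<^esub> ?e i) \<in> {..<r} \<rightarrow> carrier ?F"
    using x xi lm_closed[OF F] e by (intro funcsetI) (simp del: free_simps, blast)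
  show "?s = x"
  proof (rule extensionalityI[of _ "{..<r}"])
    show "?s \<in> extensional {..<r}" using lm_finsum[OF F m] by (auto simp: PiE_def)
    show "x \<in> extensional {..<r}" using x by (auto simp: PiE_def)
    fix j assume j: "j \<in> {..<r}"
    have "?s j = finsum C (\<lambda>i. ((\<lambda>x\<in>carrier ?F. x i) x \<odot>\<^bsub>?F\<^esub> ?e i) j) {..<r}"
      by (rule additive_finsum[OF lm_group[OF F] is_abelian_group _ _ _ m, of "\<lambda>x. x j"])
         (use j in auto)
    also have "\<dots> = finsum C (\<lambda>i. if j = i then x i else \<zero>) {..<r}"
      by (rule finsum_cong'[OF refl]) (use j x xi in auto)
    also have "\<dots> = x j" by (rule finsum_singleton) (use j xi in auto)
    finally show "?s j = x j" .
  qed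
qed

lemma free_hom:
  assumes P: "left_module C P" and gen: "generates P r b"
  shows "\<exists>p\<in>module_homs C (free_module r) P. p ` carrier (free_module r) = carrier P \<and>
    (\<forall>x\<in>carrier (free_module r). p x = finsum P (\<lambda>i. x i \<odot>\<^bsub>P\<^esub> b i) {..<r})"
proof -
  have b: "b \<in> {..<r} \<rightarrow> carrier P" using gen by (simp add: generates_def)
  let ?F = "free_module r" and ?\<epsilon> = "\<lambda>i. \<lambda>x\<in>carrier (free_module r). x i"
  note F = free_left_module[of r] and FB = free_dual_basis[of r]
  have \<epsilon>: "?\<epsilon> i \<in> module_homs C ?F (regular_module C)" if "i < r" for i using dual_basisD(2)[OF FB that] .
  define p where "p = basis_hom ?F r ?\<epsilon> P b"
  have p: "p \<in> module_homs C ?F P" unfolding p_def by (rule basis_hom[OF F P _ b]) (use \<epsilon> in blast)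
  have p_eq: "p x = finsum P (\<lambda>i. x i \<odot>\<^bsub>P\<^esub> b i) {..<r}" if "x \<in> carrier ?F" for x
    using that by (simp add: p_def basis_hom_def)
  have surj: "p ` carrier ?F = carrier P"
  proof
    show "p ` carrier ?F \<subseteq> carrier P" using homs_closed[OF p] by blast
    show "carrier P \<subseteq> p ` carrier ?F"
    proof
      fix y assume "y \<in> carrier P"
      then obtain c where c: "c \<in> {..<r} \<rightarrow> carrier C" "finsum P (\<lambda>i. c i \<odot>\<^bsub>P\<^esub> b i) {..<r} = y"
        using gen unfolding generates_def by blast
      have m: "restrict c {..<r} \<in> carrier ?F" using c(1) by auto
      interpret P: abelian_group P by (rule lm_group[OF P])
      have ci: "c i \<in> carrier C" "b i \<in> carrier P" if "i < r" for i using c(1) b that by blast+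
      have "p (restrict c {..<r}) = finsum P (\<lambda>i. c i \<odot>\<^bsub>P\<^esub> b i) {..<r}"
        unfolding p_eq[OF m] by (rule P.finsum_cong'[OF refl]) (simp_all add: ci lm_closed[OF P])
      then show "y \<in> p ` carrier ?F" using c(2) m by (metis imageI)
    qed
  qed
  then show ?thesis using p p_eq by blast
qed

text \<open>
  A surjection \<open>C\<^sup>r \<rightarrow> P\<close> splits, and a splitting composed with the coordinates of \<open>C\<^sup>r\<close> yields the \<open>\<beta>\<^sub>i\<close>.
\<close>

lemma projective_dual_basis:
  fixes P :: "('c, nat \<Rightarrow> 'c) module"
  assumes C: "fd_module C (regular_module C)" and proj: "projective_module C P"
  shows "\<exists>r b \<beta>. dual_basis C P r b \<beta>"
proof -
  have fd: "fd_module C P" using proj by (simp add: projective_module_def)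
  note P = fd_moduleD(1)[OF fd]
  obtain r b where gen: "generates P r b" using fd_generates[OF fd] by blast
  then have b: "b \<in> {..<r} \<rightarrow> carrier P" by (simp add: generates_def)
  let ?F = "free_module r" and ?\<epsilon> = "\<lambda>i. \<lambda>x\<in>carrier (free_module r). x i"
  note F = free_left_module[of r] and FB = free_dual_basis[of r]
  have Ffd: "fd_module C ?F" by (rule fd_if_generates[OF C F dual_basis_generates[OF FB]])
  have \<epsilon>: "?\<epsilon> i \<in> module_homs C ?F (regular_module C)" if "i < r" for i using dual_basisD(2)[OF FB that] .
  obtain p where p: "p \<in> module_homs C ?F P" and surj: "p ` carrier ?F = carrier P"
    and p_eq: "\<And>x. x \<in> carrier ?F \<Longrightarrow> p x = finsum P (\<lambda>i. x i \<odot>\<^bsub>P\<^esub> b i) {..<r}"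
    using free_hom[OF P gen] by blast
  have idP: "(\<lambda>x\<in>carrier P. x) \<in> module_homs C P P"
    by (rule module_homsI) (simp_all add: lm_add[OF P] lm_closed[OF P])
  obtain s where s: "s \<in> module_homs C P ?F" "compose (carrier P) p s = (\<lambda>x\<in>carrier P. x)"
    using proj Ffd fd p surj idP unfolding projective_module_def by blast
  have ps: "p (s x) = x" if "x \<in> carrier P" for x
    using fun_cong[OF s(2), of x] that by (simp add: compose_eq)
  have "dual_basis C P r b (\<lambda>i. compose (carrier P) (?\<epsilon> i) s)"
    unfolding dual_basis_def
  proof (intro conjI ballI b)
    show "(\<lambda>i. compose (carrier P) (?\<epsilon> i) s) \<in> {..<r} \<rightarrow> module_homs C P (regular_module C)"
      using homs_compose[OF s(1) \<epsilon> lm_group[OF P] lm_closed[OF P]] by blast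
    fix x assume x: "x \<in> carrier P"
    have sx: "s x \<in> carrier ?F" by (rule homs_closed[OF s(1) x])
    then show "finsum P (\<lambda>i. compose (carrier P) (?\<epsilon> i) s x \<odot>\<^bsub>P\<^esub> b i) {..<r} = x"
      using p_eq[OF sx] ps[OF x] x by (simp add: compose_eq del: free_simps)
  qed
  then show ?thesis by blast
qed

end

section \<open>Minimal projective presentations\<close>

context K_algebra
begin

text \<open>
  Superfluity of the kernel, in the form in which it is used: \<open>g(U) = g(P)\<close> means that \<open>U\<close> and the
  kernel of \<open>g\<close> together make up \<open>P\<close>.
\<close>

lemma projective_cover_superfluous:
  assumes cov: "projective_cover C P M g" and M: "left_module C M"
    and U: "left_submodule C U P" and surj: "\<And>x. x \<in> carrier P \<Longrightarrow> \<exists>u\<in>U. g u = g x"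
  shows "U = carrier P"
proof -
  have P: "left_module C P" and g: "g \<in> module_homs C P M"
    using cov by (simp_all add: projective_cover_def projective_module_def fd_module_def)
  interpret P: abelian_group P by (rule lm_group[OF P])
  interpret M: abelian_group M by (rule lm_group[OF M])
  note UP = left_submoduleD(1)[OF U, THEN subsetD]
  have "carrier P \<subseteq> U <+>\<^bsub>P\<^esub> a_kernel P M g"
  proof
    fix x assume x: "x \<in> carrier P"
    then obtain u where u: "u \<in> U" "g u = g x" using surj by blast
    note uP = UP[OF u(1)]
    have "g (x \<ominus>\<^bsub>P\<^esub> u) = \<zero>\<^bsub>M\<^esub>"
      using homs_minus[OF g lm_group[OF P] lm_group[OF M] x uP] u(2) homs_closed[OF g x]
      by (simp add: M.minus_eq M.r_neg)
    then have "x \<ominus>\<^bsub>P\<^esub> u \<in> a_kernel P M g" using x uP by (simp add: a_kernel_def')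
    moreover have "x = u \<oplus>\<^bsub>P\<^esub> (x \<ominus>\<^bsub>P\<^esub> u)"
      using x uP by (simp add: P.minus_eq P.a_lcomm[of u x] P.r_neg)
    ultimately show "x \<in> U <+>\<^bsub>P\<^esub> a_kernel P M g" using u(1) unfolding set_add_def' by blast
  qed
  moreover have "U <+>\<^bsub>P\<^esub> a_kernel P M g \<subseteq> carrier P"
    using UP by (auto simp: set_add_def' a_kernel_def')
  ultimately show ?thesis using cov U by (simp add: projective_cover_def subset_antisym)
qed

text \<open>
  Let \<open>P\<close> have the least dimension among the finitely generated projectives that map onto \<open>M\<close>.  Of the
  endomorphisms \<open>k\<close> with \<open>g \<circ> k = g\<close> choose one whose image \<open>N\<close> has least dimension.  As \<open>k \<circ> k\<close> is again
  such an endomorphism, \<open>k\<close> maps \<open>N\<close> onto itself, hence bijectively, and the inverse splits \<open>k : P \<rightarrow> N\<close>.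
  So \<open>N\<close> is projective; it maps onto \<open>M\<close>, so it has the dimension of \<open>P\<close>.  Then the image of every
  such endomorphism, of \<open>h\<close> in particular, has at least the dimension of \<open>P\<close>.
\<close>

lemma endomorphism_of_minimal_cover_surj:
  fixes P :: "('c, nat \<Rightarrow> 'c) module"
  assumes C: "fd_module C (regular_module C)"
    and P: "left_module C P" and B: "dual_basis C P r b \<beta>" and M: "left_module C M"
    and g: "g \<in> module_homs C P M" "g ` carrier P = carrier M"
    and min: "\<And>(P' :: ('c, nat \<Rightarrow> 'c) module) r' b' \<beta>' g'. \<lbrakk>left_module C P'; dual_basis C P' r' b' \<beta>';
       g' \<in> module_homs C P' M; g' ` carrier P' = carrier M\<rbrakk> \<Longrightarrow> module_dim P \<le> module_dim P'"
    and h: "h \<in> module_homs C P P" "\<And>x. x \<in> carrier P \<Longrightarrow> g (h x) = g x"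
  shows "h ` carrier P = carrier P"
proof -
  have fdP: "fd_module C P" by (rule fd_if_generates[OF C P dual_basis_generates[OF B]])
  define E where "E = {k \<in> module_homs C P P. \<forall>x\<in>carrier P. g (k x) = g x}"
  let ?I = "\<lambda>k. k ` carrier P"
  let ?PI = "\<lambda>k. P\<lparr>carrier := k ` carrier P\<rparr>"
  have sub: "left_submodule C (?I k) P" if "k \<in> E" for k
    using image_submodule[OF P P _ carrier_submodule[OF P]] that by (simp add: E_def)
  have "\<exists>k. k \<in> E \<and> (\<forall>k'. k' \<in> E \<longrightarrow> module_dim (?PI k) \<le> module_dim (?PI k'))"
    by (rule ex_has_least_nat[of "\<lambda>k. k \<in> E" h]) (use h in \<open>simp add: E_def\<close>)
  then obtain k where k: "k \<in> E" and kmin: "\<And>k'. k' \<in> E \<Longrightarrow> module_dim (?PI k) \<le> module_dim (?PI k')" by blast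
  have kh: "k \<in> module_homs C P P" and gk: "\<And>x. x \<in> carrier P \<Longrightarrow> g (k x) = g x"
    using k by (simp_all add: E_def)
  have IP: "x \<in> carrier P" if "x \<in> ?I k" for x using that homs_closed[OF kh] by blast
  let ?N = "?PI k"
  have N: "left_module C ?N" by (rule left_submodule_left_module[OF P sub[OF k]])
  have fdN: "fd_module C ?N" by (rule fd_submodule(1)[OF fdP sub[OF k]])
  have kN: "restrict k (?I k) \<in> module_homs C ?N ?N"
  proof (rule module_homsI)
    show "restrict k (?I k) (x \<oplus>\<^bsub>?N\<^esub> y) = restrict k (?I k) x \<oplus>\<^bsub>?N\<^esub> restrict k (?I k) y"
      if "x \<in> carrier ?N" "y \<in> carrier ?N" for x y
      using lm_add[OF N that] that homs_add[OF kh IP IP] by simp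
    show "restrict k (?I k) (c \<odot>\<^bsub>?N\<^esub> x) = c \<odot>\<^bsub>?N\<^esub> restrict k (?I k) x"
      if "c \<in> carrier C" "x \<in> carrier ?N" for c x
      using lm_closed[OF N that] that homs_act[OF kh _ IP] by simp
  qed (use IP in auto)
  \<comment> \<open>the image of \<open>k \<circ> k\<close> lies in that of \<open>k\<close>, and is not smaller by the choice of \<open>k\<close>\<close>
  have kk: "restrict k (?I k) ` ?I k = ?I k"
  proof -
    let ?k2 = "compose (carrier P) k k"
    have "?k2 \<in> E"
      unfolding E_def using homs_compose[OF kh kh lm_group[OF P] lm_closed[OF P]] gk homs_closed[OF kh]
      by (simp add: compose_eq)
    note le = kmin[OF this]
    have im: "?I ?k2 = restrict k (?I k) ` ?I k" by (auto simp: compose_eq image_iff)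
    have sub2: "left_submodule C (restrict k (?I k) ` ?I k) ?N"
      using image_submodule[OF N N kN carrier_submodule[OF N]] by simp
    have "module_dim (?N\<lparr>carrier := restrict k (?I k) ` ?I k\<rparr>) \<le> module_dim ?N" by (rule fd_submodule(2)[OF fdN sub2])
    then have "module_dim (?N\<lparr>carrier := restrict k (?I k) ` ?I k\<rparr>) = module_dim ?N" using le unfolding im by simp
    from fd_submodule(3)[OF fdN sub2 this] show ?thesis by simp
  qed
  have inj: "inj_on (restrict k (?I k)) (?I k)"
    using surj_endo_inj[OF hom_linear_map[OF N N kN] fd_moduleD(2)[OF fdN]] kk by simp
  define \<sigma> where "\<sigma> = restrict (inv_into (?I k) k) (?I k)"
  have injk: "inj_on k (?I k)" using inj by (simp add: inj_on_def)
  have kk': "k ` ?I k = ?I k" using kk by (simp cong: image_cong)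
  have \<sigma>: "\<sigma> x \<in> ?I k" "k (\<sigma> x) = x" if "x \<in> ?I k" for x
    using that inv_into_into[of x k "?I k"] f_inv_into_f[of x k "?I k"] kk' by (simp_all add: \<sigma>_def)
  have \<sigma>_eq: "\<sigma> x = y" if "x \<in> ?I k" "y \<in> ?I k" "k y = x" for x y
    using inj_onD[OF injk, of "\<sigma> x" y] \<sigma>[OF that(1)] that by simp
  have \<sigma>h: "\<sigma> \<in> module_homs C ?N P"
  proof (rule module_homsI)
    show "\<sigma> x \<in> carrier P" if "x \<in> carrier ?N" for x using \<sigma>(1) IP that by simp
    show "\<sigma> \<in> extensional (carrier ?N)" by (simp add: \<sigma>_def)
    show "\<sigma> (x \<oplus>\<^bsub>?N\<^esub> y) = \<sigma> x \<oplus>\<^bsub>P\<^esub> \<sigma> y" if "x \<in> carrier ?N" "y \<in> carrier ?N" for x y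
    proof (rule \<sigma>_eq)
      show "x \<oplus>\<^bsub>?N\<^esub> y \<in> ?I k" using lm_add[OF N that] by simp
      show "\<sigma> x \<oplus>\<^bsub>P\<^esub> \<sigma> y \<in> ?I k" using lm_add[OF N, of "\<sigma> x" "\<sigma> y"] \<sigma>(1) that by simp
      show "k (\<sigma> x \<oplus>\<^bsub>P\<^esub> \<sigma> y) = x \<oplus>\<^bsub>?N\<^esub> y"
        using homs_add[OF kh IP IP, of "\<sigma> x" "\<sigma> y"] \<sigma> that by simp
    qed
    show "\<sigma> (c \<odot>\<^bsub>?N\<^esub> x) = c \<odot>\<^bsub>P\<^esub> \<sigma> x" if "c \<in> carrier C" "x \<in> carrier ?N" for c x
    proof (rule \<sigma>_eq)
      show "c \<odot>\<^bsub>?N\<^esub> x \<in> ?I k" using lm_closed[OF N that] by simp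
      show "c \<odot>\<^bsub>P\<^esub> \<sigma> x \<in> ?I k" using lm_closed[OF N that(1), of "\<sigma> x"] \<sigma>(1) that by simp
      show "k (c \<odot>\<^bsub>P\<^esub> \<sigma> x) = c \<odot>\<^bsub>?N\<^esub> x"
        using homs_act[OF kh that(1) IP, of "\<sigma> x"] \<sigma> that by simp
    qed
  qed
  have finsum_N: "finsum ?N f {..<r} = finsum P f {..<r}" if "\<And>i. i < r \<Longrightarrow> f i \<in> ?I k" for f
  proof -
    have "(\<lambda>x\<in>?I k. x) \<in> module_homs C ?N P"
      by (rule module_homsI) (use IP lm_add[OF N] lm_closed[OF N] in simp_all)
    from homs_finsum[OF this lm_group[OF N] lm_group[OF P], of "{..<r}" f]
    have "(\<lambda>x\<in>?I k. x) (finsum ?N f {..<r}) = finsum P (\<lambda>i. (\<lambda>x\<in>?I k. x) (f i)) {..<r}"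
      using that by auto
    also have "\<dots> = finsum P f {..<r}"
    proof -
      interpret P: abelian_group P by (rule lm_group[OF P])
      show ?thesis by (rule P.finsum_cong'[OF refl]) (use that IP in auto)
    qed
    finally show ?thesis using lm_finsum[OF N, of f "{..<r}"] that by simp
  qed
  have bP: "b i \<in> carrier P" if "i < r" for i using dual_basisD(1)[OF B that] .
  \<comment> \<open>the dual basis of \<open>P\<close>, carried to its retract \<open>N\<close> by \<open>k\<close> and \<open>\<sigma>\<close>\<close>
  have "dual_basis C ?N r (\<lambda>i. k (b i)) (\<lambda>i. compose (carrier ?N) (\<beta> i) \<sigma>)"
    unfolding dual_basis_def
  proof (intro conjI ballI)
    show "(\<lambda>i. k (b i)) \<in> {..<r} \<rightarrow> carrier ?N" using bP by simp
    show "(\<lambda>i. compose (carrier ?N) (\<beta> i) \<sigma>) \<in> {..<r} \<rightarrow> module_homs C ?N (regular_module C)"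
      using homs_compose[OF \<sigma>h dual_basisD(2)[OF B] lm_group[OF N] lm_closed[OF N]] by blast
    fix x assume x: "x \<in> carrier ?N"
    have \<sigma>x: "\<sigma> x \<in> carrier P" by (rule homs_closed[OF \<sigma>h x])
    note \<beta>x = dual_basisD(3)[OF B _ \<sigma>x]
    have "finsum ?N (\<lambda>i. compose (carrier ?N) (\<beta> i) \<sigma> x \<odot>\<^bsub>?N\<^esub> k (b i)) {..<r}
        = finsum ?N (\<lambda>i. k (\<beta> i (\<sigma> x) \<odot>\<^bsub>P\<^esub> b i)) {..<r}"
    proof -
      interpret N: abelian_group ?N by (rule lm_group[OF N])
      show ?thesis
      proof (rule N.finsum_cong'[OF refl])
        show "(\<lambda>i. k (\<beta> i (\<sigma> x) \<odot>\<^bsub>P\<^esub> b i)) \<in> {..<r} \<rightarrow> carrier ?N"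
          using \<beta>x bP lm_closed[OF P] by simp
        show "compose (carrier ?N) (\<beta> i) \<sigma> x \<odot>\<^bsub>?N\<^esub> k (b i) = k (\<beta> i (\<sigma> x) \<odot>\<^bsub>P\<^esub> b i)" if "i \<in> {..<r}" for i
          using that x \<beta>x bP homs_act[OF kh] by (simp add: compose_eq)
      qed
    qed
    also have "\<dots> = finsum P (\<lambda>i. k (\<beta> i (\<sigma> x) \<odot>\<^bsub>P\<^esub> b i)) {..<r}"
      by (rule finsum_N) (use \<beta>x bP lm_closed[OF P] in simp)
    also have "\<dots> = k (finsum P (\<lambda>i. \<beta> i (\<sigma> x) \<odot>\<^bsub>P\<^esub> b i) {..<r})"
      by (rule homs_finsum[OF kh lm_group[OF P] lm_group[OF P], symmetric])
         (use \<beta>x bP lm_closed[OF P] in simp_all)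
    also have "\<dots> = x" using dual_basisD(4)[OF B \<sigma>x] \<sigma>(2) x by simp
    finally show "finsum ?N (\<lambda>i. compose (carrier ?N) (\<beta> i) \<sigma> x \<odot>\<^bsub>?N\<^esub> k (b i)) {..<r} = x" .
  qed
  moreover have "restrict g (?I k) \<in> module_homs C ?N M"
    by (rule module_homsI)
       (use IP homs_closed[OF g(1)] homs_add[OF g(1)] homs_act[OF g(1)] lm_add[OF N] lm_closed[OF N] in simp_all)
  moreover have "restrict g (?I k) ` carrier ?N = carrier M"
    unfolding g(2)[symmetric] by (auto simp: gk image_iff homs_closed[OF kh])
  ultimately have "module_dim P \<le> module_dim ?N" by (rule min[OF N])
  also have "\<dots> \<le> module_dim (?PI h)" by (rule kmin) (use h in \<open>simp add: E_def\<close>)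
  finally have "module_dim P \<le> module_dim (?PI h)" .
  moreover have "h \<in> E" using h by (simp add: E_def)
  ultimately show ?thesis
    using fd_submodule(2,3)[OF fdP sub[of h]] by simp
qed

text \<open>
  A projective \<open>P\<close> of least dimension with a surjection \<open>g\<close> onto \<open>M\<close> is a projective cover.  Indeed, if
  \<open>U\<close> and the kernel of \<open>g\<close> make up \<open>P\<close>, then \<open>g\<close> maps \<open>U\<close> onto \<open>M\<close>, and lifting \<open>g\<close> through this surjection gives
  an endomorphism of \<open>P\<close> over \<open>M\<close> with image in \<open>U\<close>.  By the previous lemma its image is \<open>P\<close>.
\<close>

lemma projective_cover_exists:
  assumes C: "fd_module C (regular_module C)" and fd: "fd_module C M"
  shows "\<exists>(P :: ('c, nat \<Rightarrow> 'c) module) g. projective_cover C P M g"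
proof -
  note M = fd_moduleD(1)[OF fd]
  define Q where "Q = (\<lambda>(P :: ('c, nat \<Rightarrow> 'c) module, g). left_module C P \<and> (\<exists>r b \<beta>. dual_basis C P r b \<beta>) \<and>
      g \<in> module_homs C P M \<and> g ` carrier P = carrier M)"
  have "\<exists>P g. Q (P, g)"
  proof -
    obtain r b where gen: "generates M r b" using fd_generates[OF fd] by blast
    then obtain p where "p \<in> module_homs C (free_module r) M" "p ` carrier (free_module r) = carrier M"
      using free_hom[OF M] by blast
    then have "Q (free_module r, p)"
      unfolding Q_def using free_left_module[of r] free_dual_basis[of r] by blast
    then show ?thesis by blast
  qed
  then obtain y where "Q y" by blast
  from ex_has_least_nat[of Q, OF this, of "\<lambda>y. module_dim (fst y)"]
  obtain z where z: "Q z" "\<And>y. Q y \<Longrightarrow> module_dim (fst z) \<le> module_dim (fst y)" by blast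
  obtain P g where zP: "z = (P, g)" by (cases z)
  have Qz: "Q (P, g)" using z(1) zP by simp
  have min: "module_dim P \<le> module_dim P'" if "left_module C P'" "dual_basis C P' r' b' \<beta>'"
       "g' \<in> module_homs C P' M" "g' ` carrier P' = carrier M"
    for P' :: "('c, nat \<Rightarrow> 'c) module" and r' b' \<beta>' g'
  proof -
    have "\<exists>r b \<beta>. dual_basis C P' r b \<beta>" using that(2) by (intro exI)
    then have "Q (P', g')" using that(1,3,4) by (simp add: Q_def)
    then show ?thesis using z(2)[of "(P', g')"] zP by simp
  qed
  have "\<exists>r b \<beta>. dual_basis C P r b \<beta>" and P: "left_module C P"
    and g: "g \<in> module_homs C P M" "g ` carrier P = carrier M"
    using Qz by (simp_all add: Q_def)
  then obtain r b \<beta> where B: "dual_basis C P r b \<beta>" by (elim exE)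
  have "projective_cover C P M g"
    unfolding projective_cover_def
  proof (intro conjI allI impI g)
    show "projective_module C P" by (rule dual_basis_projective[OF C P B])
    fix U assume "left_submodule C U P \<and> U <+>\<^bsub>P\<^esub> a_kernel P M g = carrier P"
    then have U: "left_submodule C U P" and UK: "U <+>\<^bsub>P\<^esub> a_kernel P M g = carrier P" by simp_all
    note UP = left_submoduleD(1)[OF U, THEN subsetD]
    let ?N = "P\<lparr>carrier := U\<rparr>"
    have N: "left_module C ?N" by (rule left_submodule_left_module[OF P U])
    have gN: "restrict g U \<in> module_homs C ?N M"
      by (rule module_homsI)
         (use UP homs_closed[OF g(1)] homs_add[OF g(1)] homs_act[OF g(1)] lm_add[OF N] lm_closed[OF N] in simp_all)
    have "restrict g U ` carrier ?N = carrier M"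
    proof
      show "restrict g U ` carrier ?N \<subseteq> carrier M" using homs_closed[OF gN] by blast
      show "carrier M \<subseteq> restrict g U ` carrier ?N"
      proof
        fix m assume "m \<in> carrier M"
        then have "m \<in> g ` carrier P" unfolding g(2) .
        then obtain x where x: "x \<in> carrier P" "g x = m" by auto
        from x(1) have "x \<in> U <+>\<^bsub>P\<^esub> a_kernel P M g" unfolding UK .
        then have "\<exists>u\<in>U. \<exists>l\<in>a_kernel P M g. x = u \<oplus>\<^bsub>P\<^esub> l" unfolding set_add_def' by simp
        then obtain u l where u: "u \<in> U" and "l \<in> a_kernel P M g" and xul: "x = u \<oplus>\<^bsub>P\<^esub> l"
          by (elim bexE)
        then have l: "l \<in> carrier P" "g l = \<zero>\<^bsub>M\<^esub>" by (simp_all add: a_kernel_def')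
        interpret M: abelian_group M by (rule lm_group[OF M])
        have "g u = m" using homs_add[OF g(1) UP[OF u] l(1)] l(2) x(2) homs_closed[OF g(1) UP[OF u]] xul by simp
        then show "m \<in> restrict g U ` carrier ?N" using u by auto
      qed
    qed
    from dual_basis_lift[OF P B N M gN this g(1)]
    obtain k where k: "k \<in> module_homs C P ?N" "\<And>x. x \<in> carrier P \<Longrightarrow> restrict g U (k x) = g x" by blast
    have kU: "k x \<in> U" if "x \<in> carrier P" for x using homs_closed[OF k(1) that] by simp
    have k': "k \<in> module_homs C P P"
      by (rule module_homsI)
         (use kU UP homs_ext[OF k(1)] homs_add[OF k(1)] homs_act[OF k(1)] in simp_all)
    have surj: "k ` carrier P = carrier P"
      by (rule endomorphism_of_minimal_cover_surj[OF C P B M g min k']) (use k(2) kU in auto)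
    have "k ` carrier P \<subseteq> U" using kU by (rule image_subsetI)
    then show "U = carrier P" unfolding surj using left_submoduleD(1)[OF U] by (rule subset_antisym[rotated])
  qed
  then show ?thesis by blast
qed

lemma minimal_projective_presentation_exists:
  assumes C: "fd_module C (regular_module C)" and fd: "fd_module C M"
  shows "\<exists>pres :: ('c, nat \<Rightarrow> 'c) module \<times> ((nat \<Rightarrow> 'c) \<Rightarrow> (nat \<Rightarrow> 'c)) \<times>
                        ('c, nat \<Rightarrow> 'c) module \<times> ((nat \<Rightarrow> 'c) \<Rightarrow> 'm).
      minimal_projective_presentation C M pres"
proof -
  obtain P\<^sub>0 :: "('c, nat \<Rightarrow> 'c) module" and g where cov: "projective_cover C P\<^sub>0 M g"
    using projective_cover_exists[OF C fd] by blast
  have P0: "fd_module C P\<^sub>0" and g: "g \<in> module_homs C P\<^sub>0 M"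
    using cov by (simp_all add: projective_cover_def projective_module_def)
  have "fd_module C (P\<^sub>0\<lparr>carrier := a_kernel P\<^sub>0 M g\<rparr>)"
    by (rule fd_submodule(1)[OF P0 kernel_submodule[OF fd_moduleD(1)[OF P0] fd_moduleD(1)[OF fd] g]])
  then obtain P\<^sub>1 :: "('c, nat \<Rightarrow> 'c) module" and h
    where "projective_cover C P\<^sub>1 (P\<^sub>0\<lparr>carrier := a_kernel P\<^sub>0 M g\<rparr>) h"
    using projective_cover_exists[OF C] by blast
  then have "minimal_projective_presentation C M (P\<^sub>1, h, P\<^sub>0, g)"
    using cov by (simp add: minimal_projective_presentation_def)
  then show ?thesis by blast
qed

end

section \<open>Passing to the quotient by an idempotent ideal\<close>

text \<open>
  The algebra \<open>B\<close> is \<open>C/J\<close> for an ideal with \<open>J = J\<^sup>2\<close>.  It is given by the surjection \<open>\<pi>\<close>, so that the arguments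
  need not mention cosets.
\<close>

locale idempotent_quotient = C: K_algebra C + B: K_algebra B
  for C :: "('k::field, 'c) module" and B :: "('k, 'b) module" +
  fixes \<pi> :: "'c \<Rightarrow> 'b" and J :: "'c set"
  assumes pi_surj: "\<pi> ` carrier C = carrier B"
    and pi_add: "\<lbrakk>a \<in> carrier C; b \<in> carrier C\<rbrakk> \<Longrightarrow> \<pi> (a \<oplus>\<^bsub>C\<^esub> b) = \<pi> a \<oplus>\<^bsub>B\<^esub> \<pi> b"
    and pi_mult: "\<lbrakk>a \<in> carrier C; b \<in> carrier C\<rbrakk> \<Longrightarrow> \<pi> (a \<otimes>\<^bsub>C\<^esub> b) = \<pi> a \<otimes>\<^bsub>B\<^esub> \<pi> b"
    and pi_one: "\<pi> \<one>\<^bsub>C\<^esub> = \<one>\<^bsub>B\<^esub>"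
    and pi_scale: "a \<in> carrier C \<Longrightarrow> \<pi> (k \<odot>\<^bsub>C\<^esub> a) = k \<odot>\<^bsub>B\<^esub> \<pi> a"
    and pi_kernel: "a \<in> carrier C \<Longrightarrow> \<pi> a = \<zero>\<^bsub>B\<^esub> \<longleftrightarrow> a \<in> J"
    and J_carrier: "J \<subseteq> carrier C"
    and J_idem: "J \<subseteq> ideal_prod C J J"
begin

lemma pi_closed: "a \<in> carrier C \<Longrightarrow> \<pi> a \<in> carrier B" using pi_surj by blast

lemma pi_obtain: "b \<in> carrier B \<Longrightarrow> \<exists>a\<in>carrier C. \<pi> a = b"
  unfolding pi_surj[symmetric] by auto

lemma pi_zero: "\<pi> \<zero>\<^bsub>C\<^esub> = \<zero>\<^bsub>B\<^esub>"
  by (rule additive_zero[OF C.is_abelian_group B.is_abelian_group]) (auto simp: pi_closed pi_add)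

text \<open>
  Restriction of scalars along \<open>\<pi>\<close>.
\<close>

definition pull :: "('b, 'n) module \<Rightarrow> ('c, 'n) module" where
  "pull N = \<lparr>carrier = carrier N, mult = undefined, one = undefined, zero = zero N, add = add N,
     smult = (\<lambda>a x. \<pi> a \<odot>\<^bsub>N\<^esub> x)\<rparr>"

lemma pull_simps [simp]:
  "carrier (pull N) = carrier N" "zero (pull N) = zero N" "add (pull N) = add N"
  "smult (pull N) = (\<lambda>a x. \<pi> a \<odot>\<^bsub>N\<^esub> x)"
  by (simp_all add: pull_def)

lemma pull_left_module:
  assumes N: "left_module B N"
  shows "left_module C (pull N)"
  by (rule left_moduleI[OF C.ring_axioms])
     (auto intro: abelian_group_cong[OF lm_group[OF N]]
       simp: pi_closed pi_add pi_mult pi_one lm_closed[OF N] lm_l_distr[OF N] lm_r_distr[OF N] lm_assoc[OF N] lm_one[OF N])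

lemma pull_submodule:
  assumes N: "left_module B N" and U: "left_submodule C U (pull N)"
  shows "left_submodule B U N"
proof (rule left_submoduleI[OF N])
  show "U \<subseteq> carrier N" "\<zero>\<^bsub>N\<^esub> \<in> U" using left_submoduleD(1,2)[OF U] by simp_all
  show "x \<oplus>\<^bsub>N\<^esub> y \<in> U" if "x \<in> U" "y \<in> U" for x y using left_submoduleD(4)[OF U that] by simp
  fix b x assume "b \<in> carrier B" and x: "x \<in> U"
  then obtain a where "a \<in> carrier C" "\<pi> a = b" using pi_obtain by blast
  then show "b \<odot>\<^bsub>N\<^esub> x \<in> U" using left_submoduleD(5)[OF U _ x, of a] unfolding pull_simps by simp
qed

text \<open>
  The submodule \<open>J P\<close> generated by the products \<open>j x\<close>.  Describing it as the least such submodule avoids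
  finite sums and gives at once that homomorphisms into modules killed by \<open>J\<close> vanish on it.
\<close>

definition JP :: "('c, 'p) module \<Rightarrow> 'p set" where
  "JP P = carrier P \<inter> \<Inter> {U. left_submodule C U P \<and> (\<forall>j\<in>J. \<forall>x\<in>carrier P. j \<odot>\<^bsub>P\<^esub> x \<in> U)}"

lemma JP_least: "\<lbrakk>left_submodule C U P; \<And>j x. \<lbrakk>j \<in> J; x \<in> carrier P\<rbrakk> \<Longrightarrow> j \<odot>\<^bsub>P\<^esub> x \<in> U; x \<in> JP P\<rbrakk> \<Longrightarrow> x \<in> U"
  unfolding JP_def by blast

lemma JP_carrier: "x \<in> JP P \<Longrightarrow> x \<in> carrier P"
  unfolding JP_def by blast

lemma JP_mem:
  assumes P: "left_module C P" and j: "j \<in> J" and x: "x \<in> carrier P"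
  shows "j \<odot>\<^bsub>P\<^esub> x \<in> JP P"
proof -
  have "j \<in> carrier C" using j J_carrier by (rule subsetD[rotated])
  from lm_closed[OF P this x] show ?thesis unfolding JP_def using j x by simp
qed

lemma JP_submodule:
  assumes P: "left_module C P"
  shows "left_submodule C (JP P) P"
proof (rule left_submoduleI[OF P])
  show "JP P \<subseteq> carrier P" by (rule subsetI, rule JP_carrier)
  show "\<zero>\<^bsub>P\<^esub> \<in> JP P" unfolding JP_def using lm_zero[OF P] by (auto dest: left_submoduleD(2))
  show "x \<oplus>\<^bsub>P\<^esub> y \<in> JP P" if "x \<in> JP P" "y \<in> JP P" for x y
    unfolding JP_def
  proof (intro IntI InterI)
    show "x \<oplus>\<^bsub>P\<^esub> y \<in> carrier P" by (rule lm_add[OF P JP_carrier[OF that(1)] JP_carrier[OF that(2)]])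
    fix U assume "U \<in> {U. left_submodule C U P \<and> (\<forall>j\<in>J. \<forall>x\<in>carrier P. j \<odot>\<^bsub>P\<^esub> x \<in> U)}"
    then have U: "left_submodule C U P" and "\<And>j x. \<lbrakk>j \<in> J; x \<in> carrier P\<rbrakk> \<Longrightarrow> j \<odot>\<^bsub>P\<^esub> x \<in> U" by simp_all
    then have "x \<in> U" "y \<in> U" using JP_least[OF U _ that(1)] JP_least[OF U _ that(2)] by simp_all
    then show "x \<oplus>\<^bsub>P\<^esub> y \<in> U" by (rule left_submoduleD(4)[OF U])
  qed
  show "c \<odot>\<^bsub>P\<^esub> x \<in> JP P" if "c \<in> carrier C" "x \<in> JP P" for c x
    unfolding JP_def
  proof (intro IntI InterI)
    show "c \<odot>\<^bsub>P\<^esub> x \<in> carrier P" by (rule lm_closed[OF P that(1) JP_carrier[OF that(2)]])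
    fix U assume "U \<in> {U. left_submodule C U P \<and> (\<forall>j\<in>J. \<forall>x\<in>carrier P. j \<odot>\<^bsub>P\<^esub> x \<in> U)}"
    then have U: "left_submodule C U P" and "\<And>j x. \<lbrakk>j \<in> J; x \<in> carrier P\<rbrakk> \<Longrightarrow> j \<odot>\<^bsub>P\<^esub> x \<in> U" by simp_all
    then have "x \<in> U" using JP_least[OF U _ that(2)] by simp
    then show "c \<odot>\<^bsub>P\<^esub> x \<in> U" by (rule left_submoduleD(5)[OF U that(1)])
  qed
qed

lemma hom_kills_JP:
  assumes P: "left_module C P" and N: "left_module C N" and u: "u \<in> module_homs C P N"
    and kill: "\<And>j y. \<lbrakk>j \<in> J; y \<in> carrier N\<rbrakk> \<Longrightarrow> j \<odot>\<^bsub>N\<^esub> y = \<zero>\<^bsub>N\<^esub>" and x: "x \<in> JP P"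
  shows "u x = \<zero>\<^bsub>N\<^esub>"
proof -
  have "x \<in> a_kernel P N u"
  proof (rule JP_least[OF C.kernel_submodule[OF P N u] _ x])
    fix j y assume j: "j \<in> J" and y: "y \<in> carrier P"
    then have "j \<in> carrier C" using J_carrier by blast
    then show "j \<odot>\<^bsub>P\<^esub> y \<in> a_kernel P N u"
      using lm_closed[OF P _ y] homs_act[OF u _ y] kill[OF j homs_closed[OF u y]] by (simp add: a_kernel_def')
  qed
  then show ?thesis by (simp add: a_kernel_def')
qed

lemma J_kills_pull:
  assumes "left_module B N" "j \<in> J" "y \<in> carrier N"
  shows "j \<odot>\<^bsub>pull N\<^esub> y = \<zero>\<^bsub>N\<^esub>"
proof -
  have "\<pi> j = \<zero>\<^bsub>B\<^esub>" using assms(2) J_carrier pi_kernel by blast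
  then show ?thesis using lm_zero_act[OF assms(1,3)] by simp
qed

text \<open>
  Lift the dual basis vectors \<open>b\<^sub>i\<close> of \<open>P'\<close> to elements \<open>e\<^sub>i\<close> of \<open>P\<close>, and let \<open>U\<close> consist of those \<open>y\<close> that are
  congruent modulo \<open>J P\<close> to a combination \<open>\<Sum>\<^sub>i a\<^sub>i e\<^sub>i\<close> whose coefficients lift the coordinates of \<open>\<alpha>(y)\<close>.
  This is a submodule.  Every \<open>y\<close> differs from such a combination by an element of the kernel of \<open>\<alpha>\<close>,
  on which \<open>g\<close> takes no values besides those on \<open>J P\<close>; so \<open>g(U) = g(P)\<close> and \<open>U = P\<close>.  For \<open>x\<close> in the kernel of \<open>\<alpha>\<close>
  the coordinates are zero, hence the \<open>a\<^sub>i\<close> lie in \<open>J\<close> and \<open>x\<close> lies in \<open>J P\<close>.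

  In effect, \<open>P'\<close> is a direct summand of \<open>P/JP\<close>, and the complement is zero because the kernel of \<open>g\<close> is
  superfluous.
\<close>

lemma kernel_eq_JP:
  assumes P: "left_module C P" and P': "left_module B P'" and D: "dual_basis B P' r b f"
    and \<alpha>: "\<alpha> \<in> module_homs C P (pull P')" and surj: "\<alpha> ` carrier P = carrier P'"
    and N: "left_module C N" and g: "g \<in> module_homs C P N"
    and superfl: "\<And>U. \<lbrakk>left_submodule C U P; \<And>x. x \<in> carrier P \<Longrightarrow> \<exists>u\<in>U. g u = g x\<rbrakk> \<Longrightarrow> U = carrier P"
    and ker: "\<And>x. \<lbrakk>x \<in> carrier P; \<alpha> x = \<zero>\<^bsub>P'\<^esub>\<rbrakk> \<Longrightarrow> \<exists>y\<in>JP P. g y = g x"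
    and x: "x \<in> carrier P" "\<alpha> x = \<zero>\<^bsub>P'\<^esub>"
  shows "x \<in> JP P"
proof -
  interpret P: abelian_group P by (rule lm_group[OF P])
  interpret P': abelian_group P' by (rule lm_group[OF P'])
  interpret N: abelian_group N by (rule lm_group[OF N])
  note pull = pull_left_module[OF P']
  have \<alpha>c: "\<alpha> y \<in> carrier P'" if "y \<in> carrier P" for y using homs_closed[OF \<alpha> that] by simp
  have \<alpha>add: "\<alpha> (y \<oplus>\<^bsub>P\<^esub> z) = \<alpha> y \<oplus>\<^bsub>P'\<^esub> \<alpha> z" if "y \<in> carrier P" "z \<in> carrier P" for y z
    using homs_add[OF \<alpha> that] by simp
  have \<alpha>act: "\<alpha> (c \<odot>\<^bsub>P\<^esub> y) = \<pi> c \<odot>\<^bsub>P'\<^esub> \<alpha> y" if "c \<in> carrier C" "y \<in> carrier P" for c y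
    using homs_act[OF \<alpha> that] by simp
  have \<alpha>JP: "\<alpha> y = \<zero>\<^bsub>P'\<^esub>" if "y \<in> JP P" for y
    using hom_kills_JP[OF P pull \<alpha> _ that] J_kills_pull[OF P'] by simp
  note JPs = JP_submodule[OF P]
  have "\<exists>y\<in>carrier P. \<alpha> y = b i" if "i < r" for i
  proof -
    have "b i \<in> \<alpha> ` carrier P" using dual_basisD(1)[OF D that] surj by simp
    then show ?thesis by auto
  qed
  then obtain e where e: "\<And>i. i < r \<Longrightarrow> e i \<in> carrier P \<and> \<alpha> (e i) = b i" by metis
  have fc: "f i y \<in> carrier B" if "i < r" "y \<in> carrier P'" for i y using dual_basisD(3)[OF D that] .
  have fh: "f i \<in> module_homs B P' (regular_module B)" if "i < r" for i using dual_basisD(2)[OF D that] .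
  define S where "S a = finsum P (\<lambda>i. a i \<odot>\<^bsub>P\<^esub> e i) {..<r}" for a
  have ae: "(\<lambda>i. a i \<odot>\<^bsub>P\<^esub> e i) \<in> {..<r} \<rightarrow> carrier P" if "a \<in> {..<r} \<rightarrow> carrier C" for a
    using that e lm_closed[OF P] by (simp add: Pi_iff)
  have Sc: "S a \<in> carrier P" if "a \<in> {..<r} \<rightarrow> carrier C" for a
    unfolding S_def by (rule P.finsum_closed[OF ae[OF that]])
  \<comment> \<open>the \<open>a\<^sub>i\<close> lift the coordinates of \<open>\<alpha> y\<close>\<close>
  define R where "R y a \<longleftrightarrow> a \<in> {..<r} \<rightarrow> carrier C \<and> (\<forall>i<r. \<pi> (a i) = f i (\<alpha> y))" for y a
  define U where "U = {y \<in> carrier P. \<exists>a j. R y a \<and> j \<in> JP P \<and> y = S a \<oplus>\<^bsub>P\<^esub> j}"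
  have Ra: "a i \<in> carrier C" "\<pi> (a i) = f i (\<alpha> y)" if "R y a" "i < r" for y a i
    using that unfolding R_def by blast+
  have RS: "S a \<in> carrier P" if "R y a" for y a using that Sc unfolding R_def by blast
  have "left_submodule C U P"
  proof (rule left_submoduleI[OF P])
    show "U \<subseteq> carrier P" unfolding U_def by blast
    have "R \<zero>\<^bsub>P\<^esub> (\<lambda>i. \<zero>\<^bsub>C\<^esub>)"
      unfolding R_def using homs_zero[OF fh lm_group[OF P']] B.is_abelian_group
        homs_zero[OF \<alpha> lm_group[OF P] lm_group[OF pull]] pi_zero
        lm_group[OF B.regular_left_module] by simp
    moreover have "S (\<lambda>i. \<zero>\<^bsub>C\<^esub>) = \<zero>\<^bsub>P\<^esub>"
    proof -
      have "S (\<lambda>i. \<zero>\<^bsub>C\<^esub>) = finsum P (\<lambda>i. \<zero>\<^bsub>P\<^esub>) {..<r}"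
        unfolding S_def by (rule P.finsum_cong'[OF refl]) (use e lm_zero_act[OF P] in simp_all)
      then show ?thesis by simp
    qed
    ultimately show "\<zero>\<^bsub>P\<^esub> \<in> U"
      unfolding U_def
      by (intro CollectI conjI exI[of _ "\<lambda>i. \<zero>\<^bsub>C\<^esub>"] exI[of _ "\<zero>\<^bsub>P\<^esub>"])
         (simp_all add: left_submoduleD(2)[OF JPs])
    fix y assume "y \<in> U"
    then obtain a j where y: "y \<in> carrier P" "R y a" "j \<in> JP P" "y = S a \<oplus>\<^bsub>P\<^esub> j" unfolding U_def by blast
    { fix z assume "z \<in> U"
      then obtain a' j' where z: "z \<in> carrier P" "R z a'" "j' \<in> JP P" "z = S a' \<oplus>\<^bsub>P\<^esub> j'" unfolding U_def by blast
      have "R (y \<oplus>\<^bsub>P\<^esub> z) (\<lambda>i. a i \<oplus>\<^bsub>C\<^esub> a' i)"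
        unfolding R_def
      proof (intro conjI allI impI)
        show "(\<lambda>i. a i \<oplus>\<^bsub>C\<^esub> a' i) \<in> {..<r} \<rightarrow> carrier C" using Ra[OF y(2)] Ra[OF z(2)] by simp
        show "\<pi> (a i \<oplus>\<^bsub>C\<^esub> a' i) = f i (\<alpha> (y \<oplus>\<^bsub>P\<^esub> z))" if "i < r" for i
          using Ra[OF y(2) that] Ra[OF z(2) that] homs_add[OF fh[OF that] \<alpha>c[OF y(1)] \<alpha>c[OF z(1)]]
          by (simp add: pi_add \<alpha>add y(1) z(1))
      qed
      moreover have "S (\<lambda>i. a i \<oplus>\<^bsub>C\<^esub> a' i) = S a \<oplus>\<^bsub>P\<^esub> S a'"
      proof -
        have "S (\<lambda>i. a i \<oplus>\<^bsub>C\<^esub> a' i) = finsum P (\<lambda>i. a i \<odot>\<^bsub>P\<^esub> e i \<oplus>\<^bsub>P\<^esub> a' i \<odot>\<^bsub>P\<^esub> e i) {..<r}"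
          unfolding S_def
          by (rule P.finsum_cong'[OF refl])
             (use e Ra[OF y(2)] Ra[OF z(2)] lm_l_distr[OF P] lm_closed[OF P] in simp_all)
        also have "\<dots> = S a \<oplus>\<^bsub>P\<^esub> S a'"
          unfolding S_def using y(2) z(2) ae unfolding R_def by (intro P.finsum_addf) blast+
        finally show ?thesis .
      qed
      then have "y \<oplus>\<^bsub>P\<^esub> z = S (\<lambda>i. a i \<oplus>\<^bsub>C\<^esub> a' i) \<oplus>\<^bsub>P\<^esub> (j \<oplus>\<^bsub>P\<^esub> j')"
        using y z RS[OF y(2)] RS[OF z(2)] JP_carrier[OF y(3)] JP_carrier[OF z(3)] by (simp add: P.a_ac)
      moreover have "j \<oplus>\<^bsub>P\<^esub> j' \<in> JP P" by (rule left_submoduleD(4)[OF JPs y(3) z(3)])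
      ultimately show "y \<oplus>\<^bsub>P\<^esub> z \<in> U" unfolding U_def using lm_add[OF P y(1) z(1)] by blast }
    fix c assume c: "c \<in> carrier C"
    have "R (c \<odot>\<^bsub>P\<^esub> y) (\<lambda>i. c \<otimes>\<^bsub>C\<^esub> a i)"
      unfolding R_def
    proof (intro conjI allI impI)
      show "(\<lambda>i. c \<otimes>\<^bsub>C\<^esub> a i) \<in> {..<r} \<rightarrow> carrier C" using Ra[OF y(2)] c by simp
      show "\<pi> (c \<otimes>\<^bsub>C\<^esub> a i) = f i (\<alpha> (c \<odot>\<^bsub>P\<^esub> y))" if "i < r" for i
        using Ra[OF y(2) that] c homs_act[OF fh[OF that] pi_closed[OF c] \<alpha>c[OF y(1)]]
        by (simp add: pi_mult \<alpha>act y(1))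
    qed
    moreover have "S (\<lambda>i. c \<otimes>\<^bsub>C\<^esub> a i) = c \<odot>\<^bsub>P\<^esub> S a"
    proof -
      have "S (\<lambda>i. c \<otimes>\<^bsub>C\<^esub> a i) = finsum P (\<lambda>i. c \<odot>\<^bsub>P\<^esub> (a i \<odot>\<^bsub>P\<^esub> e i)) {..<r}"
        unfolding S_def
        by (rule P.finsum_cong'[OF refl]) (use c e Ra[OF y(2)] lm_assoc[OF P] lm_closed[OF P] in simp_all)
      also have "\<dots> = c \<odot>\<^bsub>P\<^esub> S a"
        unfolding S_def using y(2) ae unfolding R_def by (intro lm_act_finsum[OF P c, symmetric]) blast+
      finally show ?thesis .
    qed
    then have "c \<odot>\<^bsub>P\<^esub> y = S (\<lambda>i. c \<otimes>\<^bsub>C\<^esub> a i) \<oplus>\<^bsub>P\<^esub> c \<odot>\<^bsub>P\<^esub> j"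
      using y(4) lm_r_distr[OF P c RS[OF y(2)] JP_carrier[OF y(3)]] by simp
    moreover have "c \<odot>\<^bsub>P\<^esub> j \<in> JP P" by (rule left_submoduleD(5)[OF JPs c y(3)])
    ultimately show "c \<odot>\<^bsub>P\<^esub> y \<in> U" unfolding U_def using lm_closed[OF P c y(1)] by blast
  qed
  moreover have "\<exists>u\<in>U. g u = g y" if y: "y \<in> carrier P" for y
  proof -
    have "\<exists>c\<in>carrier C. \<pi> c = f i (\<alpha> y)" if "i < r" for i
      by (rule pi_obtain[OF fc[OF that \<alpha>c[OF y]]])
    then obtain a where a: "\<And>i. i < r \<Longrightarrow> a i \<in> carrier C \<and> \<pi> (a i) = f i (\<alpha> y)" by metis
    then have a': "a \<in> {..<r} \<rightarrow> carrier C" by simp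
    have "\<alpha> (S a) = finsum (pull P') (\<lambda>i. \<alpha> (a i \<odot>\<^bsub>P\<^esub> e i)) {..<r}"
      unfolding S_def by (rule homs_finsum[OF \<alpha> lm_group[OF P] lm_group[OF pull] _ ae[OF a']]) simp
    also have "\<dots> = finsum P' (\<lambda>i. \<alpha> (a i \<odot>\<^bsub>P\<^esub> e i)) {..<r}" by (rule finsum_cong_record) simp_all
    also have "\<dots> = finsum P' (\<lambda>i. f i (\<alpha> y) \<odot>\<^bsub>P'\<^esub> b i) {..<r}"
      by (rule P'.finsum_cong'[OF refl])
         (use a e \<alpha>act fc \<alpha>c[OF y] dual_basisD(1)[OF D] lm_closed[OF P'] in simp_all)
    also have "\<dots> = \<alpha> y" by (rule dual_basisD(4)[OF D \<alpha>c[OF y]])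
    finally have \<alpha>S: "\<alpha> (S a) = \<alpha> y" .
    note Sa = Sc[OF a']
    have "\<alpha> (y \<ominus>\<^bsub>P\<^esub> S a) = \<zero>\<^bsub>P'\<^esub>"
    proof -
      have "\<alpha> (y \<ominus>\<^bsub>P\<^esub> S a) = \<alpha> y \<ominus>\<^bsub>P'\<^esub> \<alpha> (S a)"
        by (rule additive_minus[OF lm_group[OF P] lm_group[OF P'] _ \<alpha>add y Sa]) (use \<alpha>c in simp_all)
      then show ?thesis unfolding \<alpha>S using \<alpha>c[OF y] by (simp add: P'.minus_eq P'.r_neg)
    qed
    then obtain j where j: "j \<in> JP P" "g j = g (y \<ominus>\<^bsub>P\<^esub> S a)"
      using ker[OF P.minus_closed[OF y Sa]] by blast
    note jP = JP_carrier[OF j(1)]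
    have gj: "g j = g y \<ominus>\<^bsub>N\<^esub> g (S a)"
      unfolding j(2) by (rule homs_minus[OF g lm_group[OF P] lm_group[OF N] y Sa])
    have "\<alpha> (S a \<oplus>\<^bsub>P\<^esub> j) = \<alpha> y" using \<alpha>add[OF Sa jP] \<alpha>JP[OF j(1)] \<alpha>S \<alpha>c[OF y] by simp
    then have "R (S a \<oplus>\<^bsub>P\<^esub> j) a" unfolding R_def using a a' by simp
    then have "S a \<oplus>\<^bsub>P\<^esub> j \<in> U" unfolding U_def using j(1) lm_add[OF P Sa jP] by blast
    moreover have "g (S a \<oplus>\<^bsub>P\<^esub> j) = g y"
      using homs_add[OF g Sa jP] gj homs_closed[OF g Sa] homs_closed[OF g y]
      by (simp add: N.minus_eq N.a_lcomm[of "g (S a)" "g y"] N.r_neg)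
    ultimately show ?thesis by blast
  qed
  ultimately have "U = carrier P" by (rule superfl)
  then obtain a j where a: "R x a" and j: "j \<in> JP P" and xa: "x = S a \<oplus>\<^bsub>P\<^esub> j"
    using x(1) unfolding U_def by blast
  have "a i \<odot>\<^bsub>P\<^esub> e i \<in> JP P" if i: "i < r" for i
  proof (rule JP_mem[OF P])
    have "\<pi> (a i) = f i \<zero>\<^bsub>P'\<^esub>" using Ra(2)[OF a i] x(2) by simp
    also have "\<dots> = \<zero>\<^bsub>B\<^esub>" using homs_zero[OF fh[OF i] lm_group[OF P'] lm_group[OF B.regular_left_module]] by simp
    finally show "a i \<in> J" using pi_kernel[OF Ra(1)[OF a i]] by simp
    show "e i \<in> carrier P" using e[OF i] by simp
  qed
  then have "S a \<in> JP P"
    unfolding S_def by (intro C.subspace_finsum[OF C.left_submodule_subspace[OF P JPs] lm_group[OF P]]) simp_all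
  then show "x \<in> JP P" unfolding xa using left_submoduleD(4)[OF JPs _ j] by blast
qed

end

section \<open>Reducing minimal projective presentations\<close>

context idempotent_quotient
begin

lemma compose_pull_hom:
  assumes P: "left_module C P" and \<alpha>: "\<alpha> \<in> module_homs C P (pull P')"
    and u: "u \<in> module_homs B P' MB"
    and MC: "carrier MC = carrier MB" "add MC = add MB"
      "\<And>a m. \<lbrakk>a \<in> carrier C; m \<in> carrier MB\<rbrakk> \<Longrightarrow> a \<odot>\<^bsub>MC\<^esub> m = \<pi> a \<odot>\<^bsub>MB\<^esub> m"
  shows "compose (carrier P) u \<alpha> \<in> module_homs C P MC"
proof (rule module_homsI)
  have \<alpha>c: "\<alpha> x \<in> carrier P'" if "x \<in> carrier P" for x using homs_closed[OF \<alpha> that] by simp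
  show "compose (carrier P) u \<alpha> x \<in> carrier MC" if "x \<in> carrier P" for x
    using homs_closed[OF u \<alpha>c[OF that]] that MC(1) by (simp add: compose_eq)
  show "compose (carrier P) u \<alpha> (x \<oplus>\<^bsub>P\<^esub> y) = compose (carrier P) u \<alpha> x \<oplus>\<^bsub>MC\<^esub> compose (carrier P) u \<alpha> y"
    if "x \<in> carrier P" "y \<in> carrier P" for x y
    using lm_add[OF P that] homs_add[OF \<alpha> that] homs_add[OF u \<alpha>c[OF that(1)] \<alpha>c[OF that(2)]] that MC(2)
    by (simp add: compose_eq)
  show "compose (carrier P) u \<alpha> (c \<odot>\<^bsub>P\<^esub> x) = c \<odot>\<^bsub>MC\<^esub> compose (carrier P) u \<alpha> x"
    if "c \<in> carrier C" "x \<in> carrier P" for c x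
    using lm_closed[OF P that] homs_act[OF \<alpha> that] homs_act[OF u pi_closed[OF that(1)] \<alpha>c[OF that(2)]]
      MC(3)[OF that(1) homs_closed[OF u \<alpha>c[OF that(2)]]] that
    by (simp add: compose_eq)
qed (simp add: compose_def)

text \<open>
  Here \<open>MC\<close> is \<open>MB\<close> with scalars restricted along \<open>\<pi>\<close>.  The ideal \<open>J\<close> kills it, so homomorphisms from \<open>P\<close>
  to it vanish on the kernel of \<open>\<alpha>\<close>.
\<close>

lemma hom_factors_through_pull:
  assumes P: "left_module C P" and P': "left_module B P'"
    and \<alpha>: "\<alpha> \<in> module_homs C P (pull P')" and surj: "\<alpha> ` carrier P = carrier P'"
    and ker: "\<And>x. \<lbrakk>x \<in> carrier P; \<alpha> x = \<zero>\<^bsub>P'\<^esub>\<rbrakk> \<Longrightarrow> x \<in> JP P"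
    and MCm: "left_module C MC" and MB: "left_module B MB"
    and MC: "carrier MC = carrier MB" "add MC = add MB" "zero MC = zero MB"
      "\<And>a m. \<lbrakk>a \<in> carrier C; m \<in> carrier MB\<rbrakk> \<Longrightarrow> a \<odot>\<^bsub>MC\<^esub> m = \<pi> a \<odot>\<^bsub>MB\<^esub> m"
    and v: "v \<in> module_homs C P MC"
  shows "\<exists>u\<in>module_homs B P' MB. compose (carrier P) u \<alpha> = v"
proof -
  interpret P: abelian_group P by (rule lm_group[OF P])
  interpret P': abelian_group P' by (rule lm_group[OF P'])
  interpret M: abelian_group MC by (rule lm_group[OF MCm])
  have \<alpha>c: "\<alpha> x \<in> carrier P'" if "x \<in> carrier P" for x using homs_closed[OF \<alpha> that] by simp
  have \<alpha>add: "\<alpha> (y \<oplus>\<^bsub>P\<^esub> z) = \<alpha> y \<oplus>\<^bsub>P'\<^esub> \<alpha> z" if "y \<in> carrier P" "z \<in> carrier P" for y z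
    using homs_add[OF \<alpha> that] by simp
  have \<alpha>act: "\<alpha> (c \<odot>\<^bsub>P\<^esub> y) = \<pi> c \<odot>\<^bsub>P'\<^esub> \<alpha> y" if "c \<in> carrier C" "y \<in> carrier P" for c y
    using homs_act[OF \<alpha> that] by simp
  have kill: "j \<odot>\<^bsub>MC\<^esub> y = \<zero>\<^bsub>MC\<^esub>" if "j \<in> J" "y \<in> carrier MC" for j y
    using J_kills_pull[OF MB that(1), of y] that MC J_carrier by (simp add: subset_iff)
  have eq: "v x = v y" if x: "x \<in> carrier P" and y: "y \<in> carrier P" and xy: "\<alpha> x = \<alpha> y" for x y
  proof -
    have "\<alpha> (x \<ominus>\<^bsub>P\<^esub> y) = \<alpha> x \<ominus>\<^bsub>P'\<^esub> \<alpha> y"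
      by (rule additive_minus[OF lm_group[OF P] lm_group[OF P'] _ \<alpha>add x y]) (use \<alpha>c in simp_all)
    also have "\<dots> = \<zero>\<^bsub>P'\<^esub>" unfolding xy using \<alpha>c[OF y] by (simp add: P'.minus_eq P'.r_neg)
    finally have "x \<ominus>\<^bsub>P\<^esub> y \<in> JP P" by (rule ker[OF P.minus_closed[OF x y]])
    then have "v (x \<ominus>\<^bsub>P\<^esub> y) = \<zero>\<^bsub>MC\<^esub>" using hom_kills_JP[OF P MCm v] kill by blast
    then have "v x \<ominus>\<^bsub>MC\<^esub> v y = \<zero>\<^bsub>MC\<^esub>"
      using homs_minus[OF v lm_group[OF P] lm_group[OF MCm] x y] by simp
    then show ?thesis using M.minus_other_side[OF homs_closed[OF v x] homs_closed[OF v y]] by simp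
  qed
  define s where "s y = (SOME x. x \<in> carrier P \<and> \<alpha> x = y)" for y
  have s: "s y \<in> carrier P" "\<alpha> (s y) = y" if "y \<in> carrier P'" for y
  proof -
    have "y \<in> \<alpha> ` carrier P" unfolding surj by (rule that)
    then have "\<exists>x. x \<in> carrier P \<and> \<alpha> x = y" by auto
    from someI_ex[OF this] show "s y \<in> carrier P" "\<alpha> (s y) = y" unfolding s_def by blast+
  qed
  have vM: "v x \<in> carrier MB" if "x \<in> carrier P" for x using homs_closed[OF v that] MC(1) by simp
  let ?u = "\<lambda>y\<in>carrier P'. v (s y)"
  have "?u \<in> module_homs B P' MB"
  proof (rule module_homsI)
    show "?u y \<in> carrier MB" if "y \<in> carrier P'" for y using vM[OF s(1)[OF that]] that by simp
    show "?u (y \<oplus>\<^bsub>P'\<^esub> z) = ?u y \<oplus>\<^bsub>MB\<^esub> ?u z" if y: "y \<in> carrier P'" and z: "z \<in> carrier P'" for y z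
    proof -
      note yz = lm_add[OF P' y z]
      have "v (s (y \<oplus>\<^bsub>P'\<^esub> z)) = v (s y \<oplus>\<^bsub>P\<^esub> s z)"
        by (rule eq) (use s[OF yz] s[OF y] s[OF z] in \<open>simp_all add: \<alpha>add\<close>)
      then show ?thesis using homs_add[OF v s(1)[OF y] s(1)[OF z]] yz y z MC(2) by simp
    qed
    show "?u (c \<odot>\<^bsub>P'\<^esub> y) = c \<odot>\<^bsub>MB\<^esub> ?u y" if c: "c \<in> carrier B" and y: "y \<in> carrier P'" for c y
    proof -
      note cy = lm_closed[OF P' c y]
      obtain a where a: "a \<in> carrier C" "\<pi> a = c" using pi_obtain[OF c] by blast
      have "v (s (c \<odot>\<^bsub>P'\<^esub> y)) = v (a \<odot>\<^bsub>P\<^esub> s y)"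
        by (rule eq) (use s[OF cy] s[OF y] a lm_closed[OF P a(1) s(1)[OF y]] in \<open>simp_all add: \<alpha>act\<close>)
      then show ?thesis using homs_act[OF v a(1) s(1)[OF y]] MC(4)[OF a(1) vM[OF s(1)[OF y]]] cy y a(2) by simp
    qed
  qed simp
  moreover have "compose (carrier P) ?u \<alpha> = v"
  proof (rule extensionalityI[OF _ homs_ext[OF v]])
    show "compose (carrier P) ?u \<alpha> \<in> extensional (carrier P)" by (simp add: compose_def)
    show "compose (carrier P) ?u \<alpha> x = v x" if x: "x \<in> carrier P" for x
      using eq[OF s(1)[OF \<alpha>c[OF x]] x s(2)[OF \<alpha>c[OF x]]] x \<alpha>c[OF x] by (simp add: compose_eq)
  qed
  ultimately show ?thesis by blast
qed

lemma compose_pull_inj: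
  assumes surj: "\<alpha> ` carrier P = carrier P'"
    and u: "u \<in> module_homs B P' MB" and v: "v \<in> module_homs B P' MB"
    and eq: "compose (carrier P) u \<alpha> = compose (carrier P) v \<alpha>"
  shows "u = v"
proof (rule homs_eqI[OF u v])
  fix y assume "y \<in> carrier P'"
  then have "y \<in> \<alpha> ` carrier P" unfolding surj .
  then obtain x where "x \<in> carrier P" "y = \<alpha> x" by auto
  then show "u y = v y" using fun_cong[OF eq, of x] by (simp add: compose_eq)
qed

text \<open>
  Instead of forming \<open>P\<^sub>i/JP\<^sub>i\<close> and proving that these modules give a minimal presentation over \<open>B\<close>, one starts
  from minimal presentations over \<open>C\<close> and over \<open>B\<close>, lifts the identity of \<open>M\<close> to maps \<open>\<alpha>\<^sub>i\<close> between them, and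
  shows that \<open>\<alpha>\<^sub>i\<close> is onto with kernel \<open>JP\<^sub>i\<close>.  Both maps are onto because the images are submodules that
  already cover \<open>M\<close> and the kernel of \<open>g'\<close>, respectively.
\<close>

lemma presentation_reduction:
  fixes P\<^sub>1 :: "('c, nat \<Rightarrow> 'c) module" and P\<^sub>1' :: "('b, nat \<Rightarrow> 'b) module"
  assumes fdC: "fd_module C (regular_module C)" and fdB: "fd_module B (regular_module B)"
    and MCm: "left_module C MC" and MBm: "left_module B MB"
    and MC: "carrier MC = carrier MB" "add MC = add MB" "zero MC = zero MB"
      "\<And>a m. \<lbrakk>a \<in> carrier C; m \<in> carrier MB\<rbrakk> \<Longrightarrow> a \<odot>\<^bsub>MC\<^esub> m = \<pi> a \<odot>\<^bsub>MB\<^esub> m"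
    and pC: "minimal_projective_presentation C MC (P\<^sub>1, h, P\<^sub>0, g)"
    and pB: "minimal_projective_presentation B MB (P\<^sub>1', h', P\<^sub>0', g')"
    and D0: "dual_basis C P\<^sub>0 s0 a0 f0" and D1: "dual_basis C P\<^sub>1 s1 a1 f1"
    and D0': "dual_basis B P\<^sub>0' r0 b0 e0" and D1': "dual_basis B P\<^sub>1' r1 b1 e1"
  obtains \<alpha>\<^sub>0 \<alpha>\<^sub>1 where "\<alpha>\<^sub>0 \<in> module_homs C P\<^sub>0 (pull P\<^sub>0')" and "\<alpha>\<^sub>0 ` carrier P\<^sub>0 = carrier P\<^sub>0'"
    and "\<And>x. \<lbrakk>x \<in> carrier P\<^sub>0; \<alpha>\<^sub>0 x = \<zero>\<^bsub>P\<^sub>0'\<^esub>\<rbrakk> \<Longrightarrow> x \<in> JP P\<^sub>0"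
    and "\<alpha>\<^sub>1 \<in> module_homs C P\<^sub>1 (pull P\<^sub>1')" and "\<alpha>\<^sub>1 ` carrier P\<^sub>1 = carrier P\<^sub>1'"
    and "\<And>x. \<lbrakk>x \<in> carrier P\<^sub>1; \<alpha>\<^sub>1 x = \<zero>\<^bsub>P\<^sub>1'\<^esub>\<rbrakk> \<Longrightarrow> x \<in> JP P\<^sub>1"
    and "\<And>x. x \<in> carrier P\<^sub>1 \<Longrightarrow> h' (\<alpha>\<^sub>1 x) = \<alpha>\<^sub>0 (h x)"
proof -
  let ?\<Omega> = "P\<^sub>0\<lparr>carrier := a_kernel P\<^sub>0 MC g\<rparr>" and ?\<Omega>' = "P\<^sub>0'\<lparr>carrier := a_kernel P\<^sub>0' MB g'\<rparr>"
  have cov0: "projective_cover C P\<^sub>0 MC g" and cov1: "projective_cover C P\<^sub>1 ?\<Omega> h"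
    using pC by (simp_all add: minimal_projective_presentation_def)
  have cov0': "projective_cover B P\<^sub>0' MB g'" and cov1': "projective_cover B P\<^sub>1' ?\<Omega>' h'"
    using pB by (simp_all add: minimal_projective_presentation_def)
  have P0: "left_module C P\<^sub>0" and g: "g \<in> module_homs C P\<^sub>0 MC" and g_surj: "g ` carrier P\<^sub>0 = carrier MC"
    using cov0 by (simp_all add: projective_cover_def projective_module_def fd_module_def)
  have P1: "left_module C P\<^sub>1" and h: "h \<in> module_homs C P\<^sub>1 ?\<Omega>" and h_surj: "h ` carrier P\<^sub>1 = a_kernel P\<^sub>0 MC g"
    using cov1 by (simp_all add: projective_cover_def projective_module_def fd_module_def)
  have P0': "left_module B P\<^sub>0'" and g': "g' \<in> module_homs B P\<^sub>0' MB" and g'_surj: "g' ` carrier P\<^sub>0' = carrier MB"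
    using cov0' by (simp_all add: projective_cover_def projective_module_def fd_module_def)
  have P1': "left_module B P\<^sub>1'" and h': "h' \<in> module_homs B P\<^sub>1' ?\<Omega>'" and h'_surj: "h' ` carrier P\<^sub>1' = a_kernel P\<^sub>0' MB g'"
    using cov1' by (simp_all add: projective_cover_def projective_module_def fd_module_def)
  interpret MC: abelian_group MC by (rule lm_group[OF MCm])
  have kill: "j \<odot>\<^bsub>MC\<^esub> y = \<zero>\<^bsub>MC\<^esub>" if "j \<in> J" "y \<in> carrier MC" for j y
    using J_kills_pull[OF MBm that(1), of y] that MC J_carrier by (simp add: subset_iff)
  have sub\<Omega>: "left_submodule C (a_kernel P\<^sub>0 MC g) P\<^sub>0" by (rule C.kernel_submodule[OF P0 MCm g])
  have sub\<Omega>': "left_submodule B (a_kernel P\<^sub>0' MB g') P\<^sub>0'" by (rule B.kernel_submodule[OF P0' MBm g'])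
  have \<Omega>: "left_module C ?\<Omega>" by (rule left_submodule_left_module[OF P0 sub\<Omega>])
  have \<Omega>': "left_module B ?\<Omega>'" by (rule left_submodule_left_module[OF P0' sub\<Omega>'])
  have \<Omega>mem: "x \<in> a_kernel P\<^sub>0 MC g \<longleftrightarrow> x \<in> carrier P\<^sub>0 \<and> g x = \<zero>\<^bsub>MC\<^esub>" for x by (auto simp: a_kernel_def')
  have \<Omega>'mem: "x \<in> a_kernel P\<^sub>0' MB g' \<longleftrightarrow> x \<in> carrier P\<^sub>0' \<and> g' x = \<zero>\<^bsub>MB\<^esub>" for x by (auto simp: a_kernel_def')
  note pull0 = pull_left_module[OF P0'] and pull1 = pull_left_module[OF P1']

  have g'C: "g' \<in> module_homs C (pull P\<^sub>0') MC"
    by (rule module_homsI)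
       (use homs_closed[OF g'] homs_ext[OF g'] homs_add[OF g'] homs_act[OF g'] MC pi_closed in simp_all)
  have g'_surj': "g' ` carrier (pull P\<^sub>0') = carrier MC" using g'_surj MC(1) by simp
  obtain \<alpha>\<^sub>0 where \<alpha>0: "\<alpha>\<^sub>0 \<in> module_homs C P\<^sub>0 (pull P\<^sub>0')" and g\<alpha>0: "\<And>x. x \<in> carrier P\<^sub>0 \<Longrightarrow> g' (\<alpha>\<^sub>0 x) = g x"
    using C.dual_basis_lift[OF P0 D0 pull0 MCm g'C g'_surj' g] by blast
  have \<alpha>0c: "\<alpha>\<^sub>0 x \<in> carrier P\<^sub>0'" if "x \<in> carrier P\<^sub>0" for x using homs_closed[OF \<alpha>0 that] by simp
  have sub0: "left_submodule B (\<alpha>\<^sub>0 ` carrier P\<^sub>0) P\<^sub>0'"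
    by (rule pull_submodule[OF P0' C.image_submodule[OF P0 pull0 \<alpha>0 C.carrier_submodule[OF P0]]])
  have surj0: "\<alpha>\<^sub>0 ` carrier P\<^sub>0 = carrier P\<^sub>0'"
  proof (rule B.projective_cover_superfluous[OF cov0' MBm sub0])
    fix x assume x: "x \<in> carrier P\<^sub>0'"
    have "g' x \<in> g ` carrier P\<^sub>0" unfolding g_surj MC(1) by (rule homs_closed[OF g' x])
    then obtain y where y: "y \<in> carrier P\<^sub>0" "g' x = g y" by auto
    then show "\<exists>u\<in>\<alpha>\<^sub>0 ` carrier P\<^sub>0. g' u = g' x"
      by (intro bexI[of _ "\<alpha>\<^sub>0 y"]) (simp_all add: g\<alpha>0)
  qed
  have ker0: "x \<in> JP P\<^sub>0" if x: "x \<in> carrier P\<^sub>0" "\<alpha>\<^sub>0 x = \<zero>\<^bsub>P\<^sub>0'\<^esub>" for x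
  proof (rule kernel_eq_JP[OF P0 P0' D0' \<alpha>0 surj0 MCm g _ _ x])
    show "U = carrier P\<^sub>0" if "left_submodule C U P\<^sub>0" "\<And>x. x \<in> carrier P\<^sub>0 \<Longrightarrow> \<exists>u\<in>U. g u = g x" for U
      by (rule C.projective_cover_superfluous[OF cov0 MCm that])
    show "\<exists>y\<in>JP P\<^sub>0. g y = g x" if x: "x \<in> carrier P\<^sub>0" "\<alpha>\<^sub>0 x = \<zero>\<^bsub>P\<^sub>0'\<^esub>" for x
    proof -
      have "g x = g' \<zero>\<^bsub>P\<^sub>0'\<^esub>" using g\<alpha>0[OF x(1)] x(2) by simp
      also have "\<dots> = \<zero>\<^bsub>MC\<^esub>" using homs_zero[OF g' lm_group[OF P0'] lm_group[OF MBm]] MC(3) by simp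
      also have "\<dots> = g \<zero>\<^bsub>P\<^sub>0\<^esub>" using homs_zero[OF g lm_group[OF P0] lm_group[OF MCm]] by simp
      finally show ?thesis using left_submoduleD(2)[OF JP_submodule[OF P0]] by (intro bexI[of _ "\<zero>\<^bsub>P\<^sub>0\<^esub>"]) simp_all
    qed
  qed

  have hx: "h x \<in> carrier P\<^sub>0" "g (h x) = \<zero>\<^bsub>MC\<^esub>" if "x \<in> carrier P\<^sub>1" for x
    using homs_closed[OF h that] \<Omega>mem by simp_all
  have h_add: "h (x \<oplus>\<^bsub>P\<^sub>1\<^esub> y) = h x \<oplus>\<^bsub>P\<^sub>0\<^esub> h y" if "x \<in> carrier P\<^sub>1" "y \<in> carrier P\<^sub>1" for x y
    using homs_add[OF h that] by simp
  have h_act: "h (c \<odot>\<^bsub>P\<^sub>1\<^esub> x) = c \<odot>\<^bsub>P\<^sub>0\<^esub> h x" if "c \<in> carrier C" "x \<in> carrier P\<^sub>1" for c x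
    using homs_act[OF h that] by simp
  have h0: "h \<in> module_homs C P\<^sub>1 P\<^sub>0"
    by (rule module_homsI) (use hx h_add h_act homs_ext[OF h] in simp_all)
  have \<alpha>h: "compose (carrier P\<^sub>1) \<alpha>\<^sub>0 h \<in> module_homs C P\<^sub>1 (pull ?\<Omega>')"
  proof (rule module_homsI)
    show "compose (carrier P\<^sub>1) \<alpha>\<^sub>0 h x \<in> carrier (pull ?\<Omega>')" if "x \<in> carrier P\<^sub>1" for x
      using that \<alpha>0c[OF hx(1)[OF that]] g\<alpha>0[OF hx(1)[OF that]] hx(2)[OF that] MC(3) \<Omega>'mem by (simp add: compose_eq)
    show "compose (carrier P\<^sub>1) \<alpha>\<^sub>0 h (x \<oplus>\<^bsub>P\<^sub>1\<^esub> y)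
        = compose (carrier P\<^sub>1) \<alpha>\<^sub>0 h x \<oplus>\<^bsub>pull ?\<Omega>'\<^esub> compose (carrier P\<^sub>1) \<alpha>\<^sub>0 h y"
      if "x \<in> carrier P\<^sub>1" "y \<in> carrier P\<^sub>1" for x y
      using that lm_add[OF P1 that] h_add[OF that] homs_add[OF \<alpha>0 hx(1)[OF that(1)] hx(1)[OF that(2)]]
      by (simp add: compose_eq)
    show "compose (carrier P\<^sub>1) \<alpha>\<^sub>0 h (c \<odot>\<^bsub>P\<^sub>1\<^esub> x) = c \<odot>\<^bsub>pull ?\<Omega>'\<^esub> compose (carrier P\<^sub>1) \<alpha>\<^sub>0 h x"
      if "c \<in> carrier C" "x \<in> carrier P\<^sub>1" for c x
      using that lm_closed[OF P1 that] h_act[OF that] homs_act[OF \<alpha>0 that(1) hx(1)[OF that(2)]]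
      by (simp add: compose_eq)
  qed (simp add: compose_def)
  have h'C: "h' \<in> module_homs C (pull P\<^sub>1') (pull ?\<Omega>')"
    by (rule module_homsI)
       (use homs_closed[OF h'] homs_ext[OF h'] homs_add[OF h'] homs_act[OF h'] pi_closed in simp_all)
  have h'_surj': "h' ` carrier (pull P\<^sub>1') = carrier (pull ?\<Omega>')" using h'_surj by simp
  have "\<exists>k\<in>module_homs C P\<^sub>1 (pull P\<^sub>1'). \<forall>x\<in>carrier P\<^sub>1. h' (k x) = compose (carrier P\<^sub>1) \<alpha>\<^sub>0 h x"
    by (rule C.dual_basis_lift[OF P1 D1 pull1 pull_left_module[OF \<Omega>'] h'C h'_surj' \<alpha>h])
  then obtain \<alpha>\<^sub>1 where \<alpha>1: "\<alpha>\<^sub>1 \<in> module_homs C P\<^sub>1 (pull P\<^sub>1')"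
    and h\<alpha>1: "\<And>x. x \<in> carrier P\<^sub>1 \<Longrightarrow> h' (\<alpha>\<^sub>1 x) = \<alpha>\<^sub>0 (h x)"
    by (auto simp: compose_eq)
  have sub1: "left_submodule B (\<alpha>\<^sub>1 ` carrier P\<^sub>1) P\<^sub>1'"
    by (rule pull_submodule[OF P1' C.image_submodule[OF P1 pull1 \<alpha>1 C.carrier_submodule[OF P1]]])
  have surj1: "\<alpha>\<^sub>1 ` carrier P\<^sub>1 = carrier P\<^sub>1'"
  proof (rule B.projective_cover_superfluous[OF cov1' \<Omega>' sub1])
    fix x assume x: "x \<in> carrier P\<^sub>1'"
    have h'x: "h' x \<in> carrier P\<^sub>0'" "g' (h' x) = \<zero>\<^bsub>MB\<^esub>" using homs_closed[OF h' x] \<Omega>'mem by simp_all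
    then have "h' x \<in> \<alpha>\<^sub>0 ` carrier P\<^sub>0" unfolding surj0 by simp
    then obtain y where y: "y \<in> carrier P\<^sub>0" "h' x = \<alpha>\<^sub>0 y" by auto
    have "g y = \<zero>\<^bsub>MC\<^esub>" using g\<alpha>0[OF y(1)] y(2) h'x(2) MC(3) by simp
    then have "y \<in> h ` carrier P\<^sub>1" unfolding h_surj \<Omega>mem using y(1) by simp
    then obtain z where z: "z \<in> carrier P\<^sub>1" "y = h z" by auto
    then show "\<exists>u\<in>\<alpha>\<^sub>1 ` carrier P\<^sub>1. h' u = h' x"
      using y(2) by (intro bexI[of _ "\<alpha>\<^sub>1 z"]) (simp_all add: h\<alpha>1)
  qed
  \<comment> \<open>The only use of \<open>J = J\<^sup>2\<close>: since \<open>J\<close> kills \<open>M\<close>, one has \<open>J P\<^sub>0 \<subseteq> \<Omega>\<close>, so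
      \<open>J P\<^sub>0 = J (J P\<^sub>0) \<subseteq> J \<Omega> = h(J P\<^sub>1)\<close>.\<close>
  have JP0_image: "x \<in> h ` JP P\<^sub>1" if x: "x \<in> JP P\<^sub>0" for x
  proof (rule JP_least[OF _ _ x])
    show V: "left_submodule C (h ` JP P\<^sub>1) P\<^sub>0" by (rule C.image_submodule[OF P1 P0 h0 JP_submodule[OF P1]])
    fix j y assume "j \<in> J" and y: "y \<in> carrier P\<^sub>0"
    then have "j \<in> ideal_prod C J J" using J_idem by blast
    then have "j \<in> carrier C \<and> j \<odot>\<^bsub>P\<^sub>0\<^esub> y \<in> h ` JP P\<^sub>1"
    proof (induction j rule: ideal_prod.induct)
      case (prod i k)
      have ik: "i \<in> carrier C" "k \<in> carrier C" using prod J_carrier by blast+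
      have ky: "k \<odot>\<^bsub>P\<^sub>0\<^esub> y \<in> carrier P\<^sub>0" by (rule lm_closed[OF P0 ik(2) y])
      have "g (k \<odot>\<^bsub>P\<^sub>0\<^esub> y) = \<zero>\<^bsub>MC\<^esub>"
        using homs_act[OF g ik(2) y] kill[OF prod(2) homs_closed[OF g y]] by simp
      then have "k \<odot>\<^bsub>P\<^sub>0\<^esub> y \<in> h ` carrier P\<^sub>1" unfolding h_surj \<Omega>mem using ky by simp
      then obtain z where z: "z \<in> carrier P\<^sub>1" "k \<odot>\<^bsub>P\<^sub>0\<^esub> y = h z" by auto
      have "(i \<otimes>\<^bsub>C\<^esub> k) \<odot>\<^bsub>P\<^sub>0\<^esub> y = h (i \<odot>\<^bsub>P\<^sub>1\<^esub> z)"
        using lm_assoc[OF P0 ik y] h_act[OF ik(1) z(1)] z(2) by simp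
      then show ?case using JP_mem[OF P1 prod(1) z(1)] ik by simp
    next
      case (sum i k)
      then show ?case
        using left_submoduleD(4)[OF V, of "i \<odot>\<^bsub>P\<^sub>0\<^esub> y" "k \<odot>\<^bsub>P\<^sub>0\<^esub> y"] lm_l_distr[OF P0 _ _ y, of i k] by simp
    qed
    then show "j \<odot>\<^bsub>P\<^sub>0\<^esub> y \<in> h ` JP P\<^sub>1" by simp
  qed
  have ker1: "x \<in> JP P\<^sub>1" if x: "x \<in> carrier P\<^sub>1" "\<alpha>\<^sub>1 x = \<zero>\<^bsub>P\<^sub>1'\<^esub>" for x
  proof (rule kernel_eq_JP[OF P1 P1' D1' \<alpha>1 surj1, OF \<Omega> h, OF _ _ x])
    show "U = carrier P\<^sub>1" if "left_submodule C U P\<^sub>1" "\<And>x. x \<in> carrier P\<^sub>1 \<Longrightarrow> \<exists>u\<in>U. h u = h x" for U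
      by (rule C.projective_cover_superfluous[OF cov1 \<Omega> that])
    show "\<exists>y\<in>JP P\<^sub>1. h y = h x" if x: "x \<in> carrier P\<^sub>1" "\<alpha>\<^sub>1 x = \<zero>\<^bsub>P\<^sub>1'\<^esub>" for x
    proof -
      have "\<alpha>\<^sub>0 (h x) = h' \<zero>\<^bsub>P\<^sub>1'\<^esub>" using h\<alpha>1[OF x(1)] x(2) by simp
      also have "\<dots> = \<zero>\<^bsub>P\<^sub>0'\<^esub>" using homs_zero[OF h' lm_group[OF P1'] lm_group[OF \<Omega>']] by simp
      finally have "h x \<in> JP P\<^sub>0" by (rule ker0[OF hx(1)[OF x(1)]])
      from JP0_image[OF this] obtain y where "y \<in> JP P\<^sub>1" "h x = h y" by auto
      then show ?thesis by (intro bexI[of _ y]) simp_all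
    qed
  qed
  show thesis by (rule that[of \<alpha>\<^sub>0 \<alpha>\<^sub>1]) (fact \<alpha>0 surj0 ker0 \<alpha>1 surj1 ker1 h\<alpha>1)+
qed

text \<open>
  Composition with \<open>\<alpha>\<^sub>1\<close> identifies \<open>Hom\<^sub>B(P\<^sub>1', M)\<close> with \<open>Hom\<^sub>C(P\<^sub>1, M)\<close>, and maps that factor through \<open>h'\<close> with those
  that factor through \<open>h\<close>.  So the two spaces of linear forms that compute \<open>Hom(M, \<tau>M)\<close> over \<open>B\<close> and over \<open>C\<close>
  are isomorphic.
\<close>

theorem E_invariant_quotient:
  fixes MC :: "('c, 'm) module" and MB :: "('b, 'm) module"
  assumes fdC: "fd_module C (regular_module C)" and fdB: "fd_module B (regular_module B)"
    and MCfd: "fd_module C MC" and MBfd: "fd_module B MB"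
    and MC: "carrier MC = carrier MB" "add MC = add MB" "zero MC = zero MB"
      "\<And>a m. \<lbrakk>a \<in> carrier C; m \<in> carrier MB\<rbrakk> \<Longrightarrow> a \<odot>\<^bsub>MC\<^esub> m = \<pi> a \<odot>\<^bsub>MB\<^esub> m"
  shows "E_invariant C MC = E_invariant B MB"
proof -
  note MCm = C.fd_moduleD(1)[OF MCfd] and MBm = B.fd_moduleD(1)[OF MBfd]
  define pC where "pC = (SOME pres :: ('c, nat \<Rightarrow> 'c) module \<times> ((nat \<Rightarrow> 'c) \<Rightarrow> (nat \<Rightarrow> 'c)) \<times>
                        ('c, nat \<Rightarrow> 'c) module \<times> ((nat \<Rightarrow> 'c) \<Rightarrow> 'm). minimal_projective_presentation C MC pres)"
  define pB where "pB = (SOME pres :: ('b, nat \<Rightarrow> 'b) module \<times> ((nat \<Rightarrow> 'b) \<Rightarrow> (nat \<Rightarrow> 'b)) \<times>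
                        ('b, nat \<Rightarrow> 'b) module \<times> ((nat \<Rightarrow> 'b) \<Rightarrow> 'm). minimal_projective_presentation B MB pres)"
  have minC: "minimal_projective_presentation C MC pC"
    unfolding pC_def by (rule someI_ex[OF C.minimal_projective_presentation_exists[OF fdC MCfd]])
  have minB: "minimal_projective_presentation B MB pB"
    unfolding pB_def by (rule someI_ex[OF B.minimal_projective_presentation_exists[OF fdB MBfd]])
  obtain P\<^sub>1 h P\<^sub>0 g where pC: "pC = (P\<^sub>1, h, P\<^sub>0, g)" by (cases pC) auto
  obtain P\<^sub>1' h' P\<^sub>0' g' where pB: "pB = (P\<^sub>1', h', P\<^sub>0', g')" by (cases pB) auto
  have cov: "projective_cover C P\<^sub>0 MC g" "projective_cover C P\<^sub>1 (P\<^sub>0\<lparr>carrier := a_kernel P\<^sub>0 MC g\<rparr>) h"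
    using minC by (simp_all add: pC minimal_projective_presentation_def)
  have cov': "projective_cover B P\<^sub>0' MB g'" "projective_cover B P\<^sub>1' (P\<^sub>0'\<lparr>carrier := a_kernel P\<^sub>0' MB g'\<rparr>) h'"
    using minB by (simp_all add: pB minimal_projective_presentation_def)
  have pr: "projective_module C P\<^sub>0" "projective_module C P\<^sub>1" "projective_module B P\<^sub>0'" "projective_module B P\<^sub>1'"
    using cov cov' by (simp_all add: projective_cover_def)
  have P0: "left_module C P\<^sub>0" and P1: "left_module C P\<^sub>1" and P0': "left_module B P\<^sub>0'" and P1': "left_module B P\<^sub>1'"
    using pr by (simp_all add: projective_module_def fd_module_def)
  obtain s0 a0 f0 where D0: "dual_basis C P\<^sub>0 s0 a0 f0" using C.projective_dual_basis[OF fdC pr(1)] by blast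
  obtain s1 a1 f1 where D1: "dual_basis C P\<^sub>1 s1 a1 f1" using C.projective_dual_basis[OF fdC pr(2)] by blast
  obtain r0 b0 e0 where D0': "dual_basis B P\<^sub>0' r0 b0 e0" using B.projective_dual_basis[OF fdB pr(3)] by blast
  obtain r1 b1 e1 where D1': "dual_basis B P\<^sub>1' r1 b1 e1" using B.projective_dual_basis[OF fdB pr(4)] by blast
  have h: "h \<in> module_homs C P\<^sub>1 P\<^sub>0"
  proof -
    have "h \<in> module_homs C P\<^sub>1 (P\<^sub>0\<lparr>carrier := a_kernel P\<^sub>0 MC g\<rparr>)" using cov(2) by (simp add: projective_cover_def)
    then show ?thesis by (auto simp: module_homs_def a_kernel_def' PiE_iff)
  qed
  have h': "h' \<in> module_homs B P\<^sub>1' P\<^sub>0'"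
  proof -
    have "h' \<in> module_homs B P\<^sub>1' (P\<^sub>0'\<lparr>carrier := a_kernel P\<^sub>0' MB g'\<rparr>)" using cov'(2) by (simp add: projective_cover_def)
    then show ?thesis by (auto simp: module_homs_def a_kernel_def' PiE_iff)
  qed
  interpret CP: projective_presentation C MC P\<^sub>1 h P\<^sub>0 s1 a1 f1 s0 a0 f0
    by (intro projective_presentation.intro projective_presentation_axioms.intro C.K_algebra_axioms MCm P1 P0 h D1 D0)
  interpret BP: projective_presentation B MB P\<^sub>1' h' P\<^sub>0' r1 b1 e1 r0 b0 e0
    by (intro projective_presentation.intro projective_presentation_axioms.intro B.K_algebra_axioms MBm P1' P0' h' D1' D0')
  have EC: "E_invariant C MC = vectorspace.dim class_ring (hom_functionals C P\<^sub>1 h P\<^sub>0 MC)"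
    unfolding E_invariant_def AR_translate_def pC_def[symmetric] pC by (simp add: CP.hom_tau_dim(2))
  have EB: "E_invariant B MB = vectorspace.dim class_ring (hom_functionals B P\<^sub>1' h' P\<^sub>0' MB)"
    unfolding E_invariant_def AR_translate_def pB_def[symmetric] pB by (simp add: BP.hom_tau_dim(2))
  obtain \<alpha>\<^sub>0 \<alpha>\<^sub>1 where \<alpha>0: "\<alpha>\<^sub>0 \<in> module_homs C P\<^sub>0 (pull P\<^sub>0')" and surj0: "\<alpha>\<^sub>0 ` carrier P\<^sub>0 = carrier P\<^sub>0'"
    and ker0: "\<And>x. \<lbrakk>x \<in> carrier P\<^sub>0; \<alpha>\<^sub>0 x = \<zero>\<^bsub>P\<^sub>0'\<^esub>\<rbrakk> \<Longrightarrow> x \<in> JP P\<^sub>0"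
    and \<alpha>1: "\<alpha>\<^sub>1 \<in> module_homs C P\<^sub>1 (pull P\<^sub>1')" and surj1: "\<alpha>\<^sub>1 ` carrier P\<^sub>1 = carrier P\<^sub>1'"
    and ker1: "\<And>x. \<lbrakk>x \<in> carrier P\<^sub>1; \<alpha>\<^sub>1 x = \<zero>\<^bsub>P\<^sub>1'\<^esub>\<rbrakk> \<Longrightarrow> x \<in> JP P\<^sub>1"
    and h\<alpha>: "\<And>x. x \<in> carrier P\<^sub>1 \<Longrightarrow> h' (\<alpha>\<^sub>1 x) = \<alpha>\<^sub>0 (h x)"
  proof (rule presentation_reduction[OF fdC fdB MCm MBm MC(1-3) _ minC[unfolded pC] minB[unfolded pB] D0 D1 D0' D1'])
    show "a \<odot>\<^bsub>MC\<^esub> m = \<pi> a \<odot>\<^bsub>MB\<^esub> m" if "a \<in> carrier C" "m \<in> carrier MB" for a m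
      by (rule MC(4)[OF that])
  qed (rule that; assumption)
  let ?HB = "module_homs B P\<^sub>1' MB" and ?HC = "module_homs C P\<^sub>1 MC"
  let ?WC = "hom_functionals C P\<^sub>1 h P\<^sub>0 MC" and ?WB = "hom_functionals B P\<^sub>1' h' P\<^sub>0' MB"
  define F where "F u = compose (carrier P\<^sub>1) u \<alpha>\<^sub>1" for u :: "(nat \<Rightarrow> 'b) \<Rightarrow> 'm"
  have \<alpha>1c: "\<alpha>\<^sub>1 x \<in> carrier P\<^sub>1'" if "x \<in> carrier P\<^sub>1" for x using homs_closed[OF \<alpha>1 that] by simp
  have FC: "F u \<in> ?HC" if "u \<in> ?HB" for u
    unfolding F_def by (rule compose_pull_hom[OF P1 \<alpha>1 that MC(1,2,4)])
  have F_inj: "u = v" if "u \<in> ?HB" "v \<in> ?HB" "F u = F v" for u v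
    using that(3) unfolding F_def by (rule compose_pull_inj[OF surj1 that(1,2)])
  have F_surj: "\<exists>u\<in>?HB. F u = v" if "v \<in> ?HC" for v
    unfolding F_def by (rule hom_factors_through_pull[OF P1 P1' \<alpha>1 surj1 ker1 MCm MBm MC that])
  define G where "G v = (SOME u. u \<in> ?HB \<and> F u = v)" for v
  have G: "G v \<in> ?HB" "F (G v) = v" if "v \<in> ?HC" for v
  proof -
    have "\<exists>u. u \<in> ?HB \<and> F u = v" using F_surj[OF that] by blast
    from someI_ex[OF this] show "G v \<in> ?HB" "F (G v) = v" unfolding G_def by blast+
  qed
  have GF: "G (F u) = u" if "u \<in> ?HB" for u by (rule F_inj[OF G(1)[OF FC[OF that]] that G(2)[OF FC[OF that]]])
  have scal: "scalar_act B MB k m = scalar_act C MC k m" if "m \<in> carrier MB" for k m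
    using MC(4)[OF C.scal that, of k] by (simp add: scalar_act_def pi_scale pi_one)
  have F_add: "F (\<lambda>y\<in>carrier P\<^sub>1'. u y \<oplus>\<^bsub>MB\<^esub> v y) = (\<lambda>x\<in>carrier P\<^sub>1. F u x \<oplus>\<^bsub>MC\<^esub> F v x)" for u v
    unfolding F_def compose_def by (rule restrict_ext) (simp add: \<alpha>1c MC(2))
  have F_scal: "F (\<lambda>y\<in>carrier P\<^sub>1'. scalar_act B MB k (u y)) = (\<lambda>x\<in>carrier P\<^sub>1. scalar_act C MC k (F u x))"
    if "u \<in> ?HB" for u k
    unfolding F_def compose_def by (rule restrict_ext) (simp add: \<alpha>1c scal homs_closed[OF that])
  have h_comm: "F (compose (carrier P\<^sub>1') v h') = compose (carrier P\<^sub>1) (compose (carrier P\<^sub>0) v \<alpha>\<^sub>0) h" for v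
    unfolding F_def compose_def by (rule restrict_ext) (simp add: \<alpha>1c h\<alpha> CP.hx)
  define T where "T \<phi> = (\<lambda>u\<in>?HB. \<phi> (F u))" for \<phi> :: "((nat \<Rightarrow> 'c) \<Rightarrow> 'm) \<Rightarrow> 'k"
  have T_mem: "T \<phi> \<in> carrier ?WB" if \<phi>: "\<phi> \<in> carrier ?WC" for \<phi>
    unfolding hom_functionals_mem
  proof (intro conjI ballI allI)
    have \<phi>_add: "\<phi> (\<lambda>x\<in>carrier P\<^sub>1. u x \<oplus>\<^bsub>MC\<^esub> v x) = \<phi> u + \<phi> v" if "u \<in> ?HC" "v \<in> ?HC" for u v
      using \<phi> that unfolding hom_functionals_mem by blast
    have \<phi>_sc: "\<phi> (\<lambda>x\<in>carrier P\<^sub>1. scalar_act C MC k (u x)) = k * \<phi> u" if "u \<in> ?HC" for u k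
      using \<phi> that unfolding hom_functionals_mem by blast
    have \<phi>_0: "\<phi> (compose (carrier P\<^sub>1) v h) = 0" if "v \<in> module_homs C P\<^sub>0 MC" for v
      using \<phi> that unfolding hom_functionals_mem by blast
    show "T \<phi> \<in> extensional ?HB" by (simp add: T_def)
    fix u assume u: "u \<in> ?HB"
    show "T \<phi> (\<lambda>y\<in>carrier P\<^sub>1'. u y \<oplus>\<^bsub>MB\<^esub> v y) = T \<phi> u + T \<phi> v" if v: "v \<in> ?HB" for v
      using u v B.hom_add_mem[OF P1' MBm u v] \<phi>_add[OF FC[OF u] FC[OF v]] by (simp add: T_def F_add)
    show "T \<phi> (\<lambda>y\<in>carrier P\<^sub>1'. scalar_act B MB k (u y)) = k * T \<phi> u" for k
      using u B.hom_scalar_mem[OF P1' MBm u] \<phi>_sc[OF FC[OF u]] by (simp add: T_def F_scal)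
  next
    fix v assume v: "v \<in> module_homs B P\<^sub>0' MB"
    have "\<phi> (compose (carrier P\<^sub>1) (compose (carrier P\<^sub>0) v \<alpha>\<^sub>0) h) = 0"
      using \<phi> compose_pull_hom[OF P0 \<alpha>0 v MC(1,2,4)] unfolding hom_functionals_mem by blast
    then show "T \<phi> (compose (carrier P\<^sub>1') v h') = 0"
      using BP.compose_h[OF v] by (simp add: T_def h_comm)
  qed
  have T_inj: "inj_on T (carrier ?WC)"
  proof (rule inj_onI)
    fix \<phi> \<psi> assume \<phi>: "\<phi> \<in> carrier ?WC" and \<psi>: "\<psi> \<in> carrier ?WC" and eq: "T \<phi> = T \<psi>"
    show "\<phi> = \<psi>"
    proof (rule extensionalityI[of _ ?HC])
      show "\<phi> \<in> extensional ?HC" "\<psi> \<in> extensional ?HC" using \<phi> \<psi> unfolding hom_functionals_mem by blast+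
      show "\<phi> v = \<psi> v" if "v \<in> ?HC" for v
        using fun_cong[OF eq, of "G v"] G[OF that] by (simp add: T_def)
    qed
  qed
  have T_surj: "\<exists>\<phi>\<in>carrier ?WC. T \<phi> = \<psi>" if \<psi>: "\<psi> \<in> carrier ?WB" for \<psi>
  proof (rule bexI)
    let ?\<phi> = "\<lambda>v\<in>?HC. \<psi> (G v)"
    have \<psi>_add: "\<psi> (\<lambda>x\<in>carrier P\<^sub>1'. u x \<oplus>\<^bsub>MB\<^esub> v x) = \<psi> u + \<psi> v" if "u \<in> ?HB" "v \<in> ?HB" for u v
      using \<psi> that unfolding hom_functionals_mem by blast
    have \<psi>_sc: "\<psi> (\<lambda>x\<in>carrier P\<^sub>1'. scalar_act B MB k (u x)) = k * \<psi> u" if "u \<in> ?HB" for u k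
      using \<psi> that unfolding hom_functionals_mem by blast
    have \<psi>_0: "\<psi> (compose (carrier P\<^sub>1') v h') = 0" if "v \<in> module_homs B P\<^sub>0' MB" for v
      using \<psi> that unfolding hom_functionals_mem by blast
    show "?\<phi> \<in> carrier ?WC"
      unfolding hom_functionals_mem
    proof (intro conjI ballI allI)
      show "?\<phi> \<in> extensional ?HC" by simp
      fix u assume u: "u \<in> ?HC"
      show "?\<phi> (\<lambda>x\<in>carrier P\<^sub>1. u x \<oplus>\<^bsub>MC\<^esub> v x) = ?\<phi> u + ?\<phi> v" if v: "v \<in> ?HC" for v
      proof -
        let ?s = "\<lambda>y\<in>carrier P\<^sub>1'. G u y \<oplus>\<^bsub>MB\<^esub> G v y"
        have "?s \<in> ?HB" by (rule B.hom_add_mem[OF P1' MBm G(1)[OF u] G(1)[OF v]])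
        then have "G (F ?s) = ?s" by (rule GF)
        then have "G (\<lambda>x\<in>carrier P\<^sub>1. u x \<oplus>\<^bsub>MC\<^esub> v x) = ?s" by (simp only: F_add G(2)[OF u] G(2)[OF v])
        then show ?thesis using u v C.hom_add_mem[OF P1 MCm u v] \<psi>_add[OF G(1)[OF u] G(1)[OF v]] by simp
      qed
      show "?\<phi> (\<lambda>x\<in>carrier P\<^sub>1. scalar_act C MC k (u x)) = k * ?\<phi> u" for k
      proof -
        let ?s = "\<lambda>y\<in>carrier P\<^sub>1'. scalar_act B MB k (G u y)"
        have "?s \<in> ?HB" by (rule B.hom_scalar_mem[OF P1' MBm G(1)[OF u]])
        then have "G (F ?s) = ?s" by (rule GF)
        then have "G (\<lambda>x\<in>carrier P\<^sub>1. scalar_act C MC k (u x)) = ?s" by (simp only: F_scal[OF G(1)[OF u]] G(2)[OF u])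
        then show ?thesis using u C.hom_scalar_mem[OF P1 MCm u] \<psi>_sc[OF G(1)[OF u]] by simp
      qed
    next
      fix v assume v: "v \<in> module_homs C P\<^sub>0 MC"
      obtain v' where v': "v' \<in> module_homs B P\<^sub>0' MB" "compose (carrier P\<^sub>0) v' \<alpha>\<^sub>0 = v"
        using hom_factors_through_pull[OF P0 P0' \<alpha>0 surj0 ker0 MCm MBm MC v] by blast
      have "G (compose (carrier P\<^sub>1) v h) = compose (carrier P\<^sub>1') v' h'"
        using GF[OF BP.compose_h[OF v'(1)]] by (simp add: h_comm v'(2))
      then show "?\<phi> (compose (carrier P\<^sub>1) v h) = 0"
        using CP.compose_h[OF v] \<psi>_0[OF v'(1)] by simp
    qed
    show "T ?\<phi> = \<psi>"
    proof (rule extensionalityI[of _ ?HB])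
      show "T ?\<phi> \<in> extensional ?HB" by (simp add: T_def)
      show "\<psi> \<in> extensional ?HB" using \<psi> unfolding hom_functionals_mem by blast
      show "T ?\<phi> u = \<psi> u" if "u \<in> ?HB" for u using that FC[OF that] GF[OF that] by (simp add: T_def)
    qed
  qed
  have "T ` carrier ?WC = carrier ?WB"
  proof
    show "T ` carrier ?WC \<subseteq> carrier ?WB" using T_mem by (rule image_subsetI)
    show "carrier ?WB \<subseteq> T ` carrier ?WC"
    proof
      fix \<psi> assume "\<psi> \<in> carrier ?WB"
      from T_surj[OF this] obtain \<phi> where "\<phi> \<in> carrier ?WC" "T \<phi> = \<psi>" by blast
      then show "\<psi> \<in> T ` carrier ?WC" by auto
    qed
  qed
  then have bij: "bij_betw T (carrier ?WC) (carrier ?WB)" using T_inj by (simp add: bij_betw_def)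
  have add: "T (\<phi> \<oplus>\<^bsub>?WC\<^esub> \<psi>) = T \<phi> \<oplus>\<^bsub>?WB\<^esub> T \<psi>" for \<phi> \<psi>
    unfolding hom_functionals_simps T_def by (rule restrict_ext) (simp add: FC)
  have smult: "T (k \<odot>\<^bsub>?WC\<^esub> \<phi>) = k \<odot>\<^bsub>?WB\<^esub> T \<phi>" for k \<phi>
    unfolding hom_functionals_simps T_def by (rule restrict_ext) (simp add: FC)
  have zero: "T \<zero>\<^bsub>?WC\<^esub> = \<zero>\<^bsub>?WB\<^esub>"
    unfolding hom_functionals_simps T_def by (rule restrict_ext) (simp add: FC)
  show ?thesis unfolding EC EB
    by (rule vectorspace_transport(2)[OF CP.hom_tau_dim(1) bij]) (rule add smult zero)+
qed

end

section \<open>Quotient algebras and factor modules\<close>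

lemma ring_cong:
  assumes "ring R" "carrier S = carrier R" "mult S = mult R" "one S = one R" "add S = add R" "zero S = zero R"
  shows "ring S"
proof -
  interpret R: ring R by fact
  show ?thesis
  proof (rule ringI)
    show "abelian_group S" by (rule abelian_group_cong[OF R.is_abelian_group]) (use assms in simp_all)
    show "Group.monoid S" by (rule monoidI) (simp_all add: assms R.m_assoc)
  qed (simp_all add: assms R.l_distr R.r_distr)
qed

lemma quotient_algebra_simps [simp]:
  "carrier (quotient_algebra C J) = a_rcosets\<^bsub>C\<^esub> J" "zero (quotient_algebra C J) = J"
  "one (quotient_algebra C J) = J +>\<^bsub>C\<^esub> \<one>\<^bsub>C\<^esub>" "add (quotient_algebra C J) = set_add C"
  "mult (quotient_algebra C J) = rcoset_mult C J"
  "smult (quotient_algebra C J) = (\<lambda>k X. \<Union>x\<in>X. J +>\<^bsub>C\<^esub> (k \<odot>\<^bsub>C\<^esub> x))"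
  by (simp_all add: quotient_algebra_def ring.defs module.defs FactRing_def)

lemma factor_module_simps [simp]:
  "carrier (factor_module M) = carrier M" "zero (factor_module M) = zero M" "add (factor_module M) = add M"
  by (simp_all add: factor_module_def)

locale algebra_ideal = K_algebra C + ideal J C for C :: "('k::field, 'c) module" (structure) and J
begin

abbreviation factor_algebra where "factor_algebra \<equiv> quotient_algebra C J"
abbreviation residue where "residue x \<equiv> J +> x"

lemma scale_ideal: "j \<in> J \<Longrightarrow> k \<odot> j \<in> J"
proof -
  assume j: "j \<in> J"
  have "(k \<odot> \<one>) \<otimes> j \<in> J" by (rule I_l_closed[OF j scal])
  then show ?thesis using j by (simp add: scale_mult_left)
qed

lemma residue_closed: "x \<in> carrier C \<Longrightarrow> residue x \<in> carrier factor_algebra"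
  by (simp add: a_rcosetsI[OF a_subset])

lemma residue_surj: "residue ` carrier C = carrier factor_algebra"
  unfolding quotient_algebra_simps A_RCOSETS_def' a_r_coset_def' by blast

lemma residue_obtain: "X \<in> carrier factor_algebra \<Longrightarrow> \<exists>x\<in>carrier C. X = residue x"
  unfolding residue_surj[symmetric] by auto

lemma residue_add: "\<lbrakk>x \<in> carrier C; y \<in> carrier C\<rbrakk> \<Longrightarrow> residue (x \<oplus> y) = residue x \<oplus>\<^bsub>factor_algebra\<^esub> residue y"
  using a_rcos_sum by simp

lemma residue_mult: "\<lbrakk>x \<in> carrier C; y \<in> carrier C\<rbrakk> \<Longrightarrow> residue (x \<otimes> y) = residue x \<otimes>\<^bsub>factor_algebra\<^esub> residue y"
  using rcoset_mult_add by simp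

lemma residue_one: "residue \<one> = \<one>\<^bsub>factor_algebra\<^esub>" by simp

lemma residue_scale: assumes x: "x \<in> carrier C" shows "residue (k \<odot> x) = k \<odot>\<^bsub>factor_algebra\<^esub> residue x"
proof -
  have "residue (k \<odot> y) = residue (k \<odot> x)" if y: "y \<in> residue x" for y
  proof -
    obtain j where j: "j \<in> J" "y = j \<oplus> x" using y by (auto simp: a_r_coset_def')
    have "k \<odot> y = k \<odot> j \<oplus> k \<odot> x" using j x by (simp add: scale_r_distr)
    then have "k \<odot> y \<in> residue (k \<odot> x)" using scale_ideal[OF j(1)] by (auto simp: a_r_coset_def')
    then show ?thesis by (rule a_repr_independence'[symmetric]) (simp add: scale_closed x)
  qed
  then have "(\<Union>y\<in>residue x. residue (k \<odot> y)) = (\<Union>y\<in>residue x. residue (k \<odot> x))" by (rule SUP_cong[OF refl])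
  moreover have "residue x \<noteq> {}" using a_rcos_self[OF x] by blast
  ultimately show ?thesis by simp
qed

lemma residue_kernel: "x \<in> carrier C \<Longrightarrow> residue x = \<zero>\<^bsub>factor_algebra\<^esub> \<longleftrightarrow> x \<in> J"
  using a_rcos_self a_rcos_const by auto

lemma quotient_K_algebra: "K_algebra factor_algebra"
proof (intro K_algebra.intro K_algebra_axioms.intro)
  show "ring factor_algebra" by (rule ring_cong[OF quotient_is_ring]) (simp_all add: FactRing_def)
  fix X Y and k l :: 'k
  assume "X \<in> carrier factor_algebra"
  then obtain x where x: "x \<in> carrier C" and X: "X = residue x" using residue_obtain by blast
  note kx = scale_closed[OF x]
  show "k \<odot>\<^bsub>factor_algebra\<^esub> X \<in> carrier factor_algebra"
    unfolding X residue_scale[OF x, symmetric] by (rule residue_closed[OF kx])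
  show "(k + l) \<odot>\<^bsub>factor_algebra\<^esub> X = k \<odot>\<^bsub>factor_algebra\<^esub> X \<oplus>\<^bsub>factor_algebra\<^esub> l \<odot>\<^bsub>factor_algebra\<^esub> X"
    unfolding X residue_scale[OF x, symmetric] residue_add[OF kx kx, symmetric] scale_l_distr[OF x] by (rule refl)
  show "(k * l) \<odot>\<^bsub>factor_algebra\<^esub> X = k \<odot>\<^bsub>factor_algebra\<^esub> (l \<odot>\<^bsub>factor_algebra\<^esub> X)"
    unfolding X residue_scale[OF x, symmetric] residue_scale[OF kx, symmetric] scale_assoc[OF x] by (rule refl)
  show "1 \<odot>\<^bsub>factor_algebra\<^esub> X = X" unfolding X residue_scale[OF x, symmetric] scale_one[OF x] by (rule refl)
  assume "Y \<in> carrier factor_algebra"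
  then obtain y where y: "y \<in> carrier C" and Y: "Y = residue y" using residue_obtain by blast
  note ky = scale_closed[OF y]
  show "k \<odot>\<^bsub>factor_algebra\<^esub> (X \<oplus>\<^bsub>factor_algebra\<^esub> Y) = k \<odot>\<^bsub>factor_algebra\<^esub> X \<oplus>\<^bsub>factor_algebra\<^esub> k \<odot>\<^bsub>factor_algebra\<^esub> Y"
    unfolding X Y residue_add[OF x y, symmetric] residue_scale[OF add.m_closed[OF x y], symmetric] residue_scale[OF x, symmetric]
      residue_scale[OF y, symmetric] residue_add[OF kx ky, symmetric] scale_r_distr[OF x y] by (rule refl)
  show "(k \<odot>\<^bsub>factor_algebra\<^esub> X) \<otimes>\<^bsub>factor_algebra\<^esub> Y = k \<odot>\<^bsub>factor_algebra\<^esub> (X \<otimes>\<^bsub>factor_algebra\<^esub> Y)"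
    unfolding X Y residue_mult[OF x y, symmetric] residue_scale[OF m_closed[OF x y], symmetric] residue_scale[OF x, symmetric]
      residue_mult[OF kx y, symmetric] scale_mult_left[OF x y] by (rule refl)
  show "X \<otimes>\<^bsub>factor_algebra\<^esub> (k \<odot>\<^bsub>factor_algebra\<^esub> Y) = k \<odot>\<^bsub>factor_algebra\<^esub> (X \<otimes>\<^bsub>factor_algebra\<^esub> Y)"
    unfolding X Y residue_mult[OF x y, symmetric] residue_scale[OF m_closed[OF x y], symmetric] residue_scale[OF y, symmetric]
      residue_mult[OF x ky, symmetric] scale_mult_right[OF x y] by (rule refl)
qed

lemma factor_act:
  assumes M: "left_module C M" and ann: "annihilates J M" and x: "x \<in> carrier C" and v: "v \<in> carrier M"
  shows "residue x \<odot>\<^bsub>factor_module M\<^esub> v = x \<odot>\<^bsub>M\<^esub> v"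
proof -
  interpret M: abelian_group M by (rule lm_group[OF M])
  have eq: "y \<odot>\<^bsub>M\<^esub> v = x \<odot>\<^bsub>M\<^esub> v" if y: "y \<in> residue x" for y
  proof -
    obtain j where j: "j \<in> J" "y = j \<oplus> x" using y by (auto simp: a_r_coset_def')
    have "j \<odot>\<^bsub>M\<^esub> v = \<zero>\<^bsub>M\<^esub>" using ann j(1) v by (simp add: annihilates_def)
    then show ?thesis
      using lm_l_distr[OF M a_Hcarr[OF j(1)] x v] lm_closed[OF M x v] j(2) by simp
  qed
  have "(THE w. \<exists>y\<in>residue x. w = y \<odot>\<^bsub>M\<^esub> v) = x \<odot>\<^bsub>M\<^esub> v"
  proof (rule the_equality)
    show "\<exists>y\<in>residue x. x \<odot>\<^bsub>M\<^esub> v = y \<odot>\<^bsub>M\<^esub> v" using a_rcos_self[OF x] by blast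
    show "w = x \<odot>\<^bsub>M\<^esub> v" if "\<exists>y\<in>residue x. w = y \<odot>\<^bsub>M\<^esub> v" for w using that eq by blast
  qed
  then show ?thesis by (simp add: factor_module_def)
qed

lemma factor_left_module:
  assumes M: "left_module C M" and ann: "annihilates J M"
  shows "left_module factor_algebra (factor_module M)"
proof -
  interpret Q: K_algebra factor_algebra by (rule quotient_K_algebra)
  note act = factor_act[OF M ann]
  show ?thesis
  proof (rule left_moduleI[OF Q.ring_axioms])
    show "abelian_group (factor_module M)" by (rule abelian_group_cong[OF lm_group[OF M]]) simp_all
    fix X Y v w assume v': "v \<in> carrier (factor_module M)"
    then have v: "v \<in> carrier M" by simp
    show "\<one>\<^bsub>factor_algebra\<^esub> \<odot>\<^bsub>factor_module M\<^esub> v = v"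
      unfolding residue_one[symmetric] act[OF one_closed v] by (rule lm_one[OF M v])
    assume "X \<in> carrier factor_algebra"
    then obtain x where x: "x \<in> carrier C" and X: "X = residue x" using residue_obtain by blast
    note xv = lm_closed[OF M x v]
    show "X \<odot>\<^bsub>factor_module M\<^esub> v \<in> carrier (factor_module M)"
      unfolding X act[OF x v] factor_module_simps by (rule xv)
    { assume "w \<in> carrier (factor_module M)"
      then have w: "w \<in> carrier M" by simp
      show "X \<odot>\<^bsub>factor_module M\<^esub> (v \<oplus>\<^bsub>factor_module M\<^esub> w)
          = X \<odot>\<^bsub>factor_module M\<^esub> v \<oplus>\<^bsub>factor_module M\<^esub> X \<odot>\<^bsub>factor_module M\<^esub> w"
        unfolding X factor_module_simps act[OF x v] act[OF x w] act[OF x lm_add[OF M v w]]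
        by (rule lm_r_distr[OF M x v w]) }
    assume "Y \<in> carrier factor_algebra"
    then obtain y where y: "y \<in> carrier C" and Y: "Y = residue y" using residue_obtain by blast
    note yv = lm_closed[OF M y v]
    show "(X \<oplus>\<^bsub>factor_algebra\<^esub> Y) \<odot>\<^bsub>factor_module M\<^esub> v
        = X \<odot>\<^bsub>factor_module M\<^esub> v \<oplus>\<^bsub>factor_module M\<^esub> Y \<odot>\<^bsub>factor_module M\<^esub> v"
      unfolding X Y residue_add[OF x y, symmetric] factor_module_simps act[OF x v] act[OF y v] act[OF add.m_closed[OF x y] v]
      by (rule lm_l_distr[OF M x y v])
    show "(X \<otimes>\<^bsub>factor_algebra\<^esub> Y) \<odot>\<^bsub>factor_module M\<^esub> v = X \<odot>\<^bsub>factor_module M\<^esub> (Y \<odot>\<^bsub>factor_module M\<^esub> v)"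
      unfolding X Y residue_mult[OF x y, symmetric] act[OF y v] act[OF x yv] act[OF m_closed[OF x y] v]
      by (rule lm_assoc[OF M x y v])
  qed
qed

lemma fd_surjective_image:
  assumes M: "left_module C M" and B: "K_algebra B" and N: "left_module B N"
    and fd: "vectorspace.fin_dim class_ring (underlying_space C M)"
    and f: "f ` carrier M = carrier N"
    and add: "\<And>x y. \<lbrakk>x \<in> carrier M; y \<in> carrier M\<rbrakk> \<Longrightarrow> f (x \<oplus>\<^bsub>M\<^esub> y) = f x \<oplus>\<^bsub>N\<^esub> f y"
    and scal: "\<And>k x. x \<in> carrier M \<Longrightarrow> f (scalar_act C M k x) = scalar_act B N k (f x)"
  shows "fd_module B N"
proof -
  interpret B: K_algebra B by fact
  interpret V: vectorspace class_ring "underlying_space C M" by (rule underlying_vectorspace[OF M])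
  interpret W: vectorspace class_ring "underlying_space B N" by (rule B.underlying_vectorspace[OF N])
  have "f x \<in> carrier N" if "x \<in> carrier M" for x using that f by blast
  then have "f \<in> module_hom class_ring (underlying_space C M) (underlying_space B N)"
    unfolding module_hom_def using add scal by simp
  then have "mod_hom class_ring (underlying_space C M) (underlying_space B N) f"
    using V.module_axioms W.module_axioms by (simp add: mod_hom_def mod_hom_axioms_def)
  then have "linear_map class_ring (underlying_space C M) (underlying_space B N) f"
    by (simp add: linear_map_def V.vectorspace_axioms W.vectorspace_axioms)
  from linear_map.surj_fin_dim[OF this fd] f have "W.fin_dim" by simp
  then show ?thesis using N by (simp add: fd_module_def)
qed

lemma factor_fd:
  assumes M: "left_module C M" and ann: "annihilates J M"
    and fd: "vectorspace.fin_dim class_ring (underlying_space C M)"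
  shows "fd_module factor_algebra (factor_module M)"
proof (rule fd_surjective_image[OF M quotient_K_algebra factor_left_module[OF M ann] fd, of "\<lambda>x. x"])
  show "scalar_act C M k x = scalar_act factor_algebra (factor_module M) k x" if x: "x \<in> carrier M" for k x
    unfolding scalar_act_def residue_one[symmetric] residue_scale[OF one_closed, symmetric] factor_act[OF M ann scal x]
    by (rule refl)
qed simp_all

lemma quotient_fd:
  assumes fd: "fd_module C (regular_module C)"
  shows "fd_module factor_algebra (regular_module factor_algebra)"
proof -
  interpret Q: K_algebra factor_algebra by (rule quotient_K_algebra)
  show ?thesis
  proof (rule fd_surjective_image[OF regular_left_module quotient_K_algebra Q.regular_left_module _ , of residue])
    show "vectorspace.fin_dim class_ring (underlying_space C (regular_module C))" by (rule fd_moduleD(2)[OF fd])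
    show "residue ` carrier (regular_module C) = carrier (regular_module factor_algebra)" unfolding regular_simps by (rule residue_surj)
    show "residue (x \<oplus>\<^bsub>regular_module C\<^esub> y) = residue x \<oplus>\<^bsub>regular_module factor_algebra\<^esub> residue y"
      if "x \<in> carrier (regular_module C)" "y \<in> carrier (regular_module C)" for x y
      using that unfolding regular_simps by (rule residue_add)
    show "residue (scalar_act C (regular_module C) k x) = scalar_act factor_algebra (regular_module factor_algebra) k (residue x)"
      if "x \<in> carrier (regular_module C)" for k x
    proof -
      have x: "x \<in> carrier C" using that by simp
      show ?thesis
        unfolding scalar_act_def regular_simps residue_one[symmetric] residue_scale[OF one_closed, symmetric]
          residue_mult[OF scal x, symmetric] by (rule refl)
    qed
  qed
qed

theorem E_invariant_factor:
  assumes idem: "J \<subseteq> ideal_prod C J J" and fdC: "fd_module C (regular_module C)"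
    and fdM: "fd_module C M" and ann: "annihilates J M"
  shows "E_invariant C M = E_invariant factor_algebra (factor_module M)"
proof -
  interpret iq: idempotent_quotient C factor_algebra residue J
  proof (intro idempotent_quotient.intro idempotent_quotient_axioms.intro)
    show "K_algebra C" by (rule K_algebra_axioms)
    show "K_algebra factor_algebra" by (rule quotient_K_algebra)
  qed (fact residue_surj residue_add residue_mult residue_one residue_scale residue_kernel a_subset idem)+
  note M = fd_moduleD[OF fdM]
  show ?thesis
    by (rule iq.E_invariant_quotient[OF fdC quotient_fd[OF fdC] fdM factor_fd[OF M(1) ann M(2)]])
       (simp_all add: factor_act[OF M(1) ann])
qed

end

lemma (in ring) idempotent_ideal_ideal:
  assumes e: "e \<in> carrier R"
  shows "ideal (ideal_prod R {a \<otimes> e |a. a \<in> carrier R} (carrier R)) R" (is "ideal ?J R")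
proof (rule idealI[OF ring_axioms])
  have carr: "x \<in> carrier R" if "x \<in> ?J" for x
    using that by (induction rule: ideal_prod.induct) (use e in auto)
  show "subgroup ?J (add_monoid R)"
  proof (rule add.subgroupI)
    show "?J \<subseteq> carrier R" using carr by blast
    have "(\<zero> \<otimes> e) \<otimes> \<zero> \<in> ?J" by (rule ideal_prod.prod) auto
    then show "?J \<noteq> {}" by blast
    show "\<ominus> x \<in> ?J" if "x \<in> ?J" for x
      using that
    proof (induction rule: ideal_prod.induct)
      case (prod i j)
      then obtain a where a: "a \<in> carrier R" "i = a \<otimes> e" by blast
      have "\<ominus> (i \<otimes> j) = ((\<ominus> a) \<otimes> e) \<otimes> j" using a e prod by (simp add: l_minus)
      also have "\<dots> \<in> ?J" by (rule ideal_prod.prod) (use a prod in auto)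
      finally show ?case .
    next
      case (sum x y)
      then show ?case using carr by (simp add: minus_add ideal_prod.sum)
    qed
    show "x \<oplus> y \<in> ?J" if "x \<in> ?J" "y \<in> ?J" for x y using that by (rule ideal_prod.sum)
  qed
  fix x c assume x: "x \<in> ?J" and c: "c \<in> carrier R"
  show "c \<otimes> x \<in> ?J"
    using x
  proof (induction rule: ideal_prod.induct)
    case (prod i j)
    then obtain a where a: "a \<in> carrier R" "i = a \<otimes> e" by blast
    have "c \<otimes> (i \<otimes> j) = ((c \<otimes> a) \<otimes> e) \<otimes> j" using a e prod c by (simp add: m_assoc)
    also have "\<dots> \<in> ?J" by (rule ideal_prod.prod) (use a prod c in auto)
    finally show ?case .
  next
    case (sum x y)
    then show ?case using carr c by (simp add: r_distr ideal_prod.sum)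
  qed
  show "x \<otimes> c \<in> ?J"
    using x
  proof (induction rule: ideal_prod.induct)
    case (prod i j)
    then obtain a where a: "a \<in> carrier R" "i = a \<otimes> e" by blast
    have "(i \<otimes> j) \<otimes> c = i \<otimes> (j \<otimes> c)" using a e prod c by (simp add: m_assoc)
    also have "\<dots> \<in> ?J" by (rule ideal_prod.prod) (use prod c in auto)
    finally show ?case .
  next
    case (sum x y)
    then show ?case using carr c by (simp add: l_distr ideal_prod.sum)
  qed
qed

text \<open>
  A generator \<open>a e b\<close> equals \<open>(a e 1)(1 e b)\<close>.
\<close>

lemma (in ring) idempotent_ideal_idem:
  assumes e: "e \<in> carrier R" "e \<otimes> e = e"
  defines "J \<equiv> ideal_prod R {a \<otimes> e |a. a \<in> carrier R} (carrier R)"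
  shows "J \<subseteq> ideal_prod R J J"
proof
  fix x assume "x \<in> J"
  then show "x \<in> ideal_prod R J J"
    unfolding J_def
  proof (induction rule: ideal_prod.induct)
    case (prod i j)
    then obtain a where a: "a \<in> carrier R" "i = a \<otimes> e" by blast
    have "e \<in> {a \<otimes> e |a. a \<in> carrier R}" using e by force
    then have ej: "e \<otimes> j \<in> J" unfolding J_def by (rule ideal_prod.prod[OF _ prod(2)])
    have i1: "i \<otimes> \<one> \<in> J" unfolding J_def by (rule ideal_prod.prod[OF prod(1) one_closed])
    have "i \<otimes> j = (i \<otimes> \<one>) \<otimes> (e \<otimes> j)"
      using a e prod(2) by (simp add: m_assoc flip: m_assoc[of e e j])
    also have "\<dots> \<in> ideal_prod R J J" by (rule ideal_prod.prod[OF i1 ej])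
    finally show ?case unfolding J_def .
  next
    case (sum x y)
    then show ?case by (intro ideal_prod.sum)
  qed
qed

section \<open>Path algebras\<close>

text \<open>
  The contribution of the paths \<open>p\<close> and \<open>q\<close> to a product, where \<open>c\<close> is the product of their coefficients.
  Since it vanishes for \<open>c = 0\<close>, products can be summed over any finite sets containing the keys, which
  makes their additivity visible.
\<close>

definition path_term :: "'q path \<Rightarrow> 'q path \<Rightarrow> 'k \<Rightarrow> ('q path \<Rightarrow>\<^sub>0 'k::field)" where
  "path_term p q c = (case p of (j', u, k) \<Rightarrow> case q of (i, w, j) \<Rightarrow>
     if j = j' then Poly_Mapping.single (i, w @ u, k) c else 0)"

lemma path_term_zero [simp]: "path_term p q 0 = 0"
  by (simp add: path_term_def split: prod.splits)

lemma path_term_add: "path_term p q (a + b) = path_term p q a + path_term p q b"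
  by (simp add: path_term_def single_add split: prod.splits)

lemma path_mult_superset:
  assumes "finite S" "finite T" "Poly_Mapping.keys x \<subseteq> S" "Poly_Mapping.keys y \<subseteq> T"
  shows "path_mult x y = (\<Sum>p\<in>S. \<Sum>q\<in>T. path_term p q (Poly_Mapping.lookup x p * Poly_Mapping.lookup y q))"
proof -
  have "path_mult x y = (\<Sum>p\<in>Poly_Mapping.keys x. \<Sum>q\<in>Poly_Mapping.keys y.
      path_term p q (Poly_Mapping.lookup x p * Poly_Mapping.lookup y q))"
    by (simp add: path_mult_def path_term_def)
  also have "\<dots> = (\<Sum>p\<in>Poly_Mapping.keys x. \<Sum>q\<in>T. path_term p q (Poly_Mapping.lookup x p * Poly_Mapping.lookup y q))"
    by (intro sum.cong refl sum.mono_neutral_left) (use assms in \<open>auto simp: in_keys_iff\<close>)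
  also have "\<dots> = (\<Sum>p\<in>S. \<Sum>q\<in>T. path_term p q (Poly_Mapping.lookup x p * Poly_Mapping.lookup y q))"
    by (intro sum.mono_neutral_left) (use assms in \<open>auto simp: in_keys_iff\<close>)
  finally show ?thesis .
qed

lemma path_mult_add_left: "path_mult (x + x') y = path_mult x y + path_mult x' y"
proof -
  let ?S = "Poly_Mapping.keys x \<union> Poly_Mapping.keys x'" and ?T = "Poly_Mapping.keys y"
  have s: "path_mult z y = (\<Sum>p\<in>?S. \<Sum>q\<in>?T. path_term p q (Poly_Mapping.lookup z p * Poly_Mapping.lookup y q))"
    if "Poly_Mapping.keys z \<subseteq> ?S" for z
    by (rule path_mult_superset) (use that in simp_all)
  show ?thesis
    by (simp add: s s[OF keys_add] lookup_add distrib_right path_term_add sum.distrib)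
qed

lemma path_mult_add_right: "path_mult x (y + y') = path_mult x y + path_mult x y'"
proof -
  let ?S = "Poly_Mapping.keys x" and ?T = "Poly_Mapping.keys y \<union> Poly_Mapping.keys y'"
  have s: "path_mult x z = (\<Sum>p\<in>?S. \<Sum>q\<in>?T. path_term p q (Poly_Mapping.lookup x p * Poly_Mapping.lookup z q))"
    if "Poly_Mapping.keys z \<subseteq> ?T" for z
    by (rule path_mult_superset) (use that in simp_all)
  show ?thesis
    by (simp add: s s[OF keys_add] lookup_add distrib_left path_term_add sum.distrib)
qed

lemma path_mult_zero [simp]: "path_mult 0 y = 0" "path_mult x 0 = 0"
  by (simp_all add: path_mult_def)

lemma path_mult_single:
  "path_mult (Poly_Mapping.single p a) (Poly_Mapping.single q b) = path_term p q (a * b)"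
  by (subst path_mult_superset[of "{p}" "{q}"]) simp_all

lemma path_mult_sum_left: "finite A \<Longrightarrow> path_mult (\<Sum>i\<in>A. f i) y = (\<Sum>i\<in>A. path_mult (f i) y)"
  by (induction A rule: finite_induct) (simp_all add: path_mult_add_left)

lemma path_mult_sum_right: "finite A \<Longrightarrow> path_mult x (\<Sum>i\<in>A. f i) = (\<Sum>i\<in>A. path_mult x (f i))"
  by (induction A rule: finite_induct) (simp_all add: path_mult_add_right)

text \<open>
  Products and actions are additive, so with this rule identities in path algebras have to be checked
  on multiples of single paths only.
\<close>

lemma poly_mapping_additive_induct [consumes 1, case_names zero single add]:
  fixes x :: "'a \<Rightarrow>\<^sub>0 'b::comm_monoid_add"
  assumes "Poly_Mapping.keys x \<subseteq> S" and zero: "P 0"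
    and single: "\<And>p a. p \<in> S \<Longrightarrow> P (Poly_Mapping.single p a)" and add: "\<And>x y. P x \<Longrightarrow> P y \<Longrightarrow> P (x + y)"
  shows "P x"
proof -
  have "P (\<Sum>p\<in>A. Poly_Mapping.single p (Poly_Mapping.lookup x p))" if "finite A" "A \<subseteq> S" for A
    using that by (induction A rule: finite_induct) (auto intro: zero single add)
  moreover have "x = (\<Sum>p\<in>Poly_Mapping.keys x. Poly_Mapping.single p (Poly_Mapping.lookup x p))"
  proof (rule poly_mapping_eqI)
    fix q
    have "Poly_Mapping.lookup (\<Sum>p\<in>Poly_Mapping.keys x. Poly_Mapping.single p (Poly_Mapping.lookup x p)) q
        = (\<Sum>p\<in>Poly_Mapping.keys x. if q = p then Poly_Mapping.lookup x p else 0)"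
      by (simp add: lookup_sum lookup_single when_def eq_commute)
    also have "\<dots> = Poly_Mapping.lookup x q" by (simp add: in_keys_iff)
    finally show "Poly_Mapping.lookup x q = Poly_Mapping.lookup
        (\<Sum>p\<in>Poly_Mapping.keys x. Poly_Mapping.single p (Poly_Mapping.lookup x p)) q" by simp
  qed
  ultimately show ?thesis using assms(1) finite_keys by metis
qed

lemma lookup_scale: "Poly_Mapping.lookup (Poly_Mapping.map ((*) k) x) p = k * Poly_Mapping.lookup x (p :: 'a)"
  for k :: "'k::field"
  by (simp add: Poly_Mapping.map.rep_eq when_def)

lemma scale_add: "Poly_Mapping.map ((*) k) (x + y) = Poly_Mapping.map ((*) k) x + Poly_Mapping.map ((*) k) y"
  for k :: "'k::field"
  by (rule poly_mapping_eqI) (simp add: lookup_scale lookup_add distrib_left)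

lemma scale_zero [simp]: "Poly_Mapping.map ((*) k) 0 = 0" for k :: "'k::field"
  by (rule poly_mapping_eqI) (simp add: lookup_scale)

lemma scale_path_term: "Poly_Mapping.map ((*) k) (path_term p q c) = path_term p q (k * c)"
  by (simp add: path_term_def map_single split: prod.splits)

lemma path_mult_scale_left: "path_mult (Poly_Mapping.map ((*) k) x) y = Poly_Mapping.map ((*) k) (path_mult x y)"
proof (induction x rule: poly_mapping_additive_induct[OF subset_UNIV])
  case (2 p a)
  show ?case
    by (induction y rule: poly_mapping_additive_induct[OF subset_UNIV])
       (simp_all add: map_single path_mult_single scale_path_term path_mult_add_right scale_add mult.assoc)
qed (simp_all add: path_mult_add_left scale_add)

lemma path_mult_scale_right: "path_mult x (Poly_Mapping.map ((*) k) y) = Poly_Mapping.map ((*) k) (path_mult x y)"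
proof (induction x rule: poly_mapping_additive_induct[OF subset_UNIV])
  case (2 p a)
  show ?case
    by (induction y rule: poly_mapping_additive_induct[OF subset_UNIV])
       (simp_all add: map_single path_mult_single scale_path_term path_mult_add_right scale_add mult.left_commute)
qed (simp_all add: path_mult_add_left scale_add)

lemma path_mult_assoc: "path_mult (path_mult x y) z = path_mult x (path_mult y z)"
proof (induction x rule: poly_mapping_additive_induct[OF subset_UNIV])
  case (2 p a)
  show ?case
  proof (induction y rule: poly_mapping_additive_induct[OF subset_UNIV])
    case (2 q b)
    show ?case
    proof (induction z rule: poly_mapping_additive_induct[OF subset_UNIV])
      case (2 r c)
      obtain i w j where p: "p = (i, w, j)" by (cases p)
      obtain i' w' j' where q: "q = (i', w', j')" by (cases q)
      obtain i'' w'' j'' where r: "r = (i'', w'', j'')" by (cases r)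
      show ?case by (simp add: p q r path_mult_single path_term_def mult.assoc)
    qed (simp_all add: path_mult_add_right)
  qed (simp_all add: path_mult_add_left path_mult_add_right)
qed (simp_all add: path_mult_add_left)

lemma path_algebra_simps [simp]:
  "carrier (path_algebra Q) = {x. Poly_Mapping.keys x \<subseteq> paths Q}" "zero (path_algebra Q) = 0"
  "one (path_algebra Q) = (\<Sum>i\<in>verts Q. Poly_Mapping.single (i, [], i) 1)" "add (path_algebra Q) = (+)"
  "mult (path_algebra Q) = path_mult" "smult (path_algebra Q) = (\<lambda>k x. Poly_Mapping.map ((*) k) x)"
  by (simp_all add: path_algebra_def)

locale quiver = fin_digraph Q for Q :: "(nat, 'q) pre_digraph"
begin

lemma mem_paths: "(i, w, j) \<in> paths Q \<longleftrightarrow> awalk i w j"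
  by (simp add: paths_def)

definition long_paths :: "nat \<Rightarrow> 'q path set" where
  "long_paths m = {p \<in> paths Q. m \<le> length (fst (snd p))}"

lemma long_paths_0 [simp]: "long_paths 0 = paths Q"
  by (simp add: long_paths_def)

lemma path_term_keys_long:
  assumes "p \<in> long_paths m" "q \<in> long_paths n"
  shows "Poly_Mapping.keys (path_term p q c) \<subseteq> long_paths (m + n)"
proof -
  obtain j' u k where p: "p = (j', u, k)" by (cases p)
  obtain i w j where q: "q = (i, w, j)" by (cases q)
  show ?thesis
    using assms awalk_appendI[of i w j u k] by (auto simp: p q path_term_def mem_paths long_paths_def)
qed

lemma keys_path_mult_long:
  assumes x: "Poly_Mapping.keys x \<subseteq> long_paths m" and y: "Poly_Mapping.keys y \<subseteq> long_paths n"
  shows "Poly_Mapping.keys (path_mult x y) \<subseteq> long_paths (m + n)"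
  using x
proof (induction x rule: poly_mapping_additive_induct)
  case (single p a)
  from y show ?case
  proof (induction y rule: poly_mapping_additive_induct)
    case (single q b)
    show ?case unfolding path_mult_single by (rule path_term_keys_long) fact+
  next
    case (add x y)
    show ?case unfolding path_mult_add_right by (rule order_trans[OF keys_add]) (use add in simp)
  qed simp
next
  case (add x y)
  show ?case unfolding path_mult_add_left by (rule order_trans[OF keys_add]) (use add in simp)
qed simp

lemma keys_path_mult:
  assumes "Poly_Mapping.keys x \<subseteq> paths Q" "Poly_Mapping.keys y \<subseteq> paths Q"
  shows "Poly_Mapping.keys (path_mult x y) \<subseteq> paths Q"
  using keys_path_mult_long[of x 0 y 0] assms by simp

lemma keys_vertex_sum:
  "Poly_Mapping.keys (\<Sum>i\<in>verts Q. Poly_Mapping.single (i, [], i) (c i :: 'k::field)) \<subseteq> paths Q"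
proof -
  have "Poly_Mapping.keys (\<Sum>i\<in>A. Poly_Mapping.single (i, [], i) (c i)) \<subseteq> paths Q"
    if "finite A" "A \<subseteq> verts Q" for A
    using that
  proof (induction A rule: finite_induct)
    case (insert i A)
    have "(i, [], i) \<in> paths Q" using insert.prems by (simp add: mem_paths awalk_Nil_iff)
    moreover have "Poly_Mapping.keys (\<Sum>i\<in>A. Poly_Mapping.single (i, [], i) (c i)) \<subseteq> paths Q"
      using insert.IH insert.prems by simp
    ultimately show ?case
      unfolding sum.insert[OF insert.hyps] by (intro order_trans[OF keys_add] Un_least) simp_all
  qed simp
  then show ?thesis by simp
qed

lemma path_mult_one_left:
  assumes "Poly_Mapping.keys x \<subseteq> paths Q"
  shows "path_mult (\<Sum>i\<in>verts Q. Poly_Mapping.single (i, [], i) 1) x = x"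
  using assms
proof (induction x rule: poly_mapping_additive_induct)
  case (single p a)
  obtain i w j where p: "p = (i, w, j)" by (cases p)
  have "j \<in> verts Q" using single awalk_last_in_verts by (simp add: p mem_paths)
  have "path_mult (\<Sum>l\<in>verts Q. Poly_Mapping.single (l, [], l) 1) (Poly_Mapping.single p a)
      = (\<Sum>l\<in>verts Q. if j = l then Poly_Mapping.single (i, w, j) a else 0)"
    by (simp add: path_mult_sum_left path_mult_single p path_term_def cong: if_cong)
  then show ?case using \<open>j \<in> verts Q\<close> by (simp add: p)
qed (simp_all add: path_mult_add_right)

lemma path_mult_one_right:
  assumes "Poly_Mapping.keys x \<subseteq> paths Q"
  shows "path_mult x (\<Sum>i\<in>verts Q. Poly_Mapping.single (i, [], i) 1) = x"
  using assms
proof (induction x rule: poly_mapping_additive_induct)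
  case (single p a)
  obtain i w j where p: "p = (i, w, j)" by (cases p)
  have "i \<in> verts Q" using single awalk_hd_in_verts by (simp add: p mem_paths)
  have "path_mult (Poly_Mapping.single p a) (\<Sum>l\<in>verts Q. Poly_Mapping.single (l, [], l) 1)
      = (\<Sum>l\<in>verts Q. if i = l then Poly_Mapping.single (i, w, j) a else 0)"
    by (simp add: path_mult_sum_right path_mult_single p path_term_def cong: if_cong)
  then show ?case using \<open>i \<in> verts Q\<close> by (simp add: p)
qed (simp_all add: path_mult_add_left)

lemma path_K_algebra: "K_algebra (path_algebra Q :: ('k::field, 'q path \<Rightarrow>\<^sub>0 'k) module)"
proof (intro K_algebra.intro K_algebra_axioms.intro)
  let ?A = "path_algebra Q :: ('k, 'q path \<Rightarrow>\<^sub>0 'k) module"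
  have k_add: "Poly_Mapping.keys (x + y) \<subseteq> paths Q"
    if "Poly_Mapping.keys x \<subseteq> paths Q" "Poly_Mapping.keys y \<subseteq> paths Q" for x y :: "'q path \<Rightarrow>\<^sub>0 'k"
    using that keys_add[of x y] by blast
  have k_scale: "Poly_Mapping.keys (Poly_Mapping.map ((*) k) x) \<subseteq> paths Q"
    if "Poly_Mapping.keys x \<subseteq> paths Q" for k and x :: "'q path \<Rightarrow>\<^sub>0 'k"
    using that by (auto simp: in_keys_iff lookup_scale)
  have "abelian_group ?A"
  proof (rule abelian_groupI)
    fix x assume x: "x \<in> carrier ?A"
    have "Poly_Mapping.keys (- x) \<subseteq> paths Q" using x by (auto simp: in_keys_iff)
    then show "\<exists>y\<in>carrier ?A. y \<oplus>\<^bsub>?A\<^esub> x = \<zero>\<^bsub>?A\<^esub>" by (intro bexI[of _ "- x"]) simp_all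
  qed (simp_all add: k_add ac_simps)
  moreover have "Group.monoid ?A"
    by (rule monoidI) (simp_all add: keys_path_mult keys_vertex_sum path_mult_assoc path_mult_one_left path_mult_one_right)
  ultimately show "ring ?A"
    by (rule ringI) (simp_all add: path_mult_add_left path_mult_add_right)
  show "k \<odot>\<^bsub>?A\<^esub> x \<in> carrier ?A" if "x \<in> carrier ?A" for k x using that k_scale by simp
  show "(k + l) \<odot>\<^bsub>?A\<^esub> x = k \<odot>\<^bsub>?A\<^esub> x \<oplus>\<^bsub>?A\<^esub> l \<odot>\<^bsub>?A\<^esub> x" for k l x
    by (simp, rule poly_mapping_eqI) (simp add: lookup_scale lookup_add distrib_right)
  show "(k * l) \<odot>\<^bsub>?A\<^esub> x = k \<odot>\<^bsub>?A\<^esub> (l \<odot>\<^bsub>?A\<^esub> x)" for k l x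
    by (simp, rule poly_mapping_eqI) (simp add: lookup_scale mult.assoc)
  show "1 \<odot>\<^bsub>?A\<^esub> x = x" for x
    by (simp, rule poly_mapping_eqI) (simp add: lookup_scale)
qed (simp_all add: scale_add path_mult_scale_left path_mult_scale_right)

lemma single_path_in_arrow_ideal_power:
  assumes "awalk i w j" and "m \<le> length w"
  shows "Poly_Mapping.single (i, w, j) (c :: 'k::field) \<in> ideal_power (path_algebra Q) (arrow_ideal Q) m"
  using assms
proof (induction m arbitrary: i w)
  case 0
  then show ?case by (simp add: mem_paths)
next
  case (Suc m)
  then obtain a u where w: "w = a # u" by (cases w) auto
  have a: "a \<in> arcs Q" "tail Q a = i" "awalk (head Q a) u j" using Suc.prems by (auto simp: w awalk_Cons_iff)
  have "Poly_Mapping.single (head Q a, u, j) c \<in> ideal_power (path_algebra Q) (arrow_ideal Q) m"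
    by (rule Suc.IH[OF a(3)]) (use Suc.prems in \<open>simp add: w\<close>)
  moreover have "Poly_Mapping.single (tail Q a, [a], head Q a) (1 :: 'k) \<in> arrow_ideal Q"
    unfolding arrow_ideal_def genideal_def using a(1) by blast
  ultimately have "Poly_Mapping.single (head Q a, u, j) c \<otimes>\<^bsub>path_algebra Q\<^esub>
      Poly_Mapping.single (tail Q a, [a], head Q a) 1 \<in> ideal_power (path_algebra Q) (arrow_ideal Q) (Suc m)"
    unfolding ideal_power.simps by (rule ideal_prod.prod)
  then show ?case by (simp add: path_mult_single path_term_def w a)
qed

lemma finite_short_paths: "finite {p \<in> paths Q. length (fst (snd p)) < m}"
proof (rule finite_subset)
  show "{p \<in> paths Q. length (fst (snd p)) < m}
      \<subseteq> verts Q \<times> {w. set w \<subseteq> arcs Q \<and> length w \<le> m} \<times> verts Q"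
  proof
    fix p assume p: "p \<in> {p \<in> paths Q. length (fst (snd p)) < m}"
    obtain i w j where ijw: "p = (i, w, j)" by (cases p)
    have w: "awalk i w j" "length w < m" using p by (simp_all add: ijw mem_paths)
    have "set w \<subseteq> arcs Q" using w(1) by (simp add: awalk_def)
    then show "p \<in> verts Q \<times> {w. set w \<subseteq> arcs Q \<and> length w \<le> m} \<times> verts Q"
      using w(2) awalk_hd_in_verts[OF w(1)] awalk_last_in_verts[OF w(1)] by (simp add: ijw)
  qed
  show "finite (verts Q \<times> {w. set w \<subseteq> arcs Q \<and> length w \<le> m} \<times> verts Q)"
    by (intro finite_cartesian_product finite_lists_length_le) simp_all
qed

text \<open>
  All paths of length at least \<open>m\<close> lie in \<open>I\<close>, so the finitely many shorter ones span the quotient.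
\<close>

lemma path_quotient_fd:
  fixes I :: "('q path \<Rightarrow>\<^sub>0 'k::field) set"
  assumes I: "ideal I (path_algebra Q)"
    and m: "ideal_power (path_algebra Q) (arrow_ideal Q) m \<subseteq> I"
  shows "fd_module (quotient_algebra (path_algebra Q) I) (regular_module (quotient_algebra (path_algebra Q) I))"
proof -
  let ?KQ = "path_algebra Q :: ('k, 'q path \<Rightarrow>\<^sub>0 'k) module"
  interpret AI: algebra_ideal ?KQ I
    by (intro algebra_ideal.intro path_K_algebra I)
  let ?A = "quotient_algebra ?KQ I"
  interpret A: K_algebra ?A by (rule AI.quotient_K_algebra)
  let ?V = "underlying_space ?A (regular_module ?A)"
  note R = A.regular_left_module
  interpret V: vectorspace class_ring ?V by (rule A.underlying_vectorspace[OF R])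
  let ?s = "\<lambda>p. AI.residue (Poly_Mapping.single p (1 :: 'k))"
  let ?G = "?s ` {p \<in> paths Q. length (fst (snd p)) < m}"
  have single: "Poly_Mapping.single p c \<in> carrier ?KQ" if "p \<in> paths Q" for p c
    using that by simp
  have G: "?G \<subseteq> carrier ?V"
    using AI.residue_closed[OF single] by (auto simp del: path_algebra_simps quotient_algebra_simps)
  have T: "submodule class_ring (V.span ?G) ?V" by (rule V.span_is_submodule[OF G])
  note T' = submodule.zero_closed[OF T] submodule.m_closed[OF T] submodule.smult_closed[OF T]
  have "AI.residue x \<in> V.span ?G" if "x \<in> carrier ?KQ" for x
  proof -
    have "Poly_Mapping.keys x \<subseteq> paths Q" using that by simp
    then have "x \<in> carrier ?KQ \<and> AI.residue x \<in> V.span ?G"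
    proof (induction x rule: poly_mapping_additive_induct)
      case zero
      have "AI.residue \<zero>\<^bsub>?KQ\<^esub> = \<zero>\<^bsub>?A\<^esub>"
        using AI.residue_kernel[of "\<zero>\<^bsub>?KQ\<^esub>"] AI.zero_closed by blast
      then have "AI.residue 0 = \<zero>\<^bsub>?V\<^esub>" by simp
      then show ?case using T'(1) by simp
    next
      case (single p a)
      obtain i w j where p: "p = (i, w, j)" by (cases p)
      have pc: "Poly_Mapping.single p a \<in> carrier ?KQ" using single by simp
      have "AI.residue (Poly_Mapping.single p a) \<in> V.span ?G"
      proof (cases "length w < m")
        case True
        have p1: "Poly_Mapping.single p 1 \<in> carrier ?KQ" using single by simp
        have "?s p \<in> ?G" using True single by (auto simp: p)
        then have "?s p \<in> V.span ?G" using V.in_own_span[OF G] by blast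
        then have "a \<odot>\<^bsub>?V\<^esub> ?s p \<in> V.span ?G" by (intro T'(3)) simp_all
        moreover have "a \<odot>\<^bsub>?V\<^esub> ?s p = AI.residue (a \<odot>\<^bsub>?KQ\<^esub> Poly_Mapping.single p 1)"
        proof -
          have "a \<odot>\<^bsub>?V\<^esub> ?s p = (a \<odot>\<^bsub>?A\<^esub> \<one>\<^bsub>?A\<^esub>) \<otimes>\<^bsub>?A\<^esub> ?s p"
            by (simp only: A.underlying_simps scalar_act_def regular_simps)
          also have "\<dots> = a \<odot>\<^bsub>?A\<^esub> ?s p"
            using A.scale_mult_left[OF A.one_closed AI.residue_closed[OF p1]] A.l_one[OF AI.residue_closed[OF p1]] by metis
          finally show ?thesis unfolding AI.residue_scale[OF p1] .
        qed
        moreover have "a \<odot>\<^bsub>?KQ\<^esub> Poly_Mapping.single p 1 = Poly_Mapping.single p a"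
          by (simp add: map_single)
        ultimately show ?thesis by simp
      next
        case False
        then have "Poly_Mapping.single p a \<in> I"
          using single_path_in_arrow_ideal_power[of i w j m a] single m by (auto simp: p mem_paths)
        then have "AI.residue (Poly_Mapping.single p a) = \<zero>\<^bsub>?A\<^esub>" using AI.residue_kernel[OF pc] by blast
        then show ?thesis using T'(1) by simp
      qed
      then show ?case using pc by blast
    next
      case (add x y)
      then have xy: "x \<in> carrier ?KQ" "y \<in> carrier ?KQ" by blast+
      have "AI.residue (x + y) = AI.residue x \<oplus>\<^bsub>?V\<^esub> AI.residue y" using AI.residue_add[OF xy] by simp
      also have "\<dots> \<in> V.span ?G" by (rule T'(2)) (use add in blast)+
      finally have "AI.residue (x + y) \<in> V.span ?G" .
      moreover have "x + y \<in> carrier ?KQ" using AI.add.m_closed[OF xy] by simp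
      ultimately show ?case by (rule conjI[rotated])
    qed
    then show ?thesis by blast
  qed
  then have "AI.residue ` carrier ?KQ \<subseteq> V.span ?G" by (rule image_subsetI)
  then have "carrier ?V \<subseteq> V.span ?G" by (simp only: AI.residue_surj A.underlying_simps regular_simps)
  moreover have "V.span ?G \<subseteq> carrier ?V" by (rule submodule.subset[OF T])
  moreover have "finite ?G" using finite_short_paths by (rule finite_imageI)
  ultimately have "V.fin_dim"
    unfolding V.fin_dim_def using G by (intro exI[of _ ?G] conjI subset_antisym)
  then show ?thesis using R by (simp add: fd_module_def)
qed

end

section \<open>Representations as modules over the path algebra\<close>

lemma walk_act_simps [simp]:
  "walk_act M [] v = v" "walk_act M (a # w) v = walk_act M w (M a *\<^sub>v v)"
  "walk_act M (w @ u) v = walk_act M u (walk_act M w v)"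
  by (simp_all add: walk_act_def)

text \<open>
  Extending the coordinate by zero to paths that do not end at \<open>j\<close> turns the action into a sum over all
  keys, and then over any finite set containing the keys.
\<close>

definition path_coord :: "('q \<Rightarrow> 'k::field mat) \<Rightarrow> (nat \<Rightarrow> 'k vec) \<Rightarrow> nat \<Rightarrow> nat \<Rightarrow> 'q path \<Rightarrow> 'k" where
  "path_coord M v j r p = (case p of (i, w, j') \<Rightarrow> if j' = j then walk_act M w (v i) $ r else 0)"

lemma rep_module_simps [simp]:
  "carrier (rep_module Q d M) = (\<Pi>\<^sub>E i\<in>verts Q. carrier_vec (d i))"
  "zero (rep_module Q d M) = (\<lambda>i\<in>verts Q. 0\<^sub>v (d i))"
  "add (rep_module Q d M) = (\<lambda>v v'. \<lambda>i\<in>verts Q. v i + v' i)"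
  by (simp_all add: rep_module_def)

lemma rep_module_act:
  "x \<odot>\<^bsub>rep_module Q d M\<^esub> v = (\<lambda>j\<in>verts Q. vec (d j) (\<lambda>r. \<Sum>p\<in>Poly_Mapping.keys x.
     Poly_Mapping.lookup x p * path_coord M v j r p))"
proof -
  have "(\<Sum>(i, w, j')\<in>{(i, w, j'). (i, w, j') \<in> Poly_Mapping.keys x \<and> j' = j}.
          Poly_Mapping.lookup x (i, w, j') * walk_act M w (v i) $ r)
      = (\<Sum>p\<in>Poly_Mapping.keys x. Poly_Mapping.lookup x p * path_coord M v j r p)" for j r
    by (rule sum.mono_neutral_cong_left) (auto simp: path_coord_def split: if_splits)
  then show ?thesis by (simp add: rep_module_def)
qed

lemma rep_module_act_superset:
  assumes "finite S" "Poly_Mapping.keys x \<subseteq> S" "j \<in> verts Q" "r < d j"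
  shows "(x \<odot>\<^bsub>rep_module Q d M\<^esub> v) j $ r = (\<Sum>p\<in>S. Poly_Mapping.lookup x p * path_coord M v j r p)"
proof -
  have "(\<Sum>p\<in>Poly_Mapping.keys x. Poly_Mapping.lookup x p * path_coord M v j r p)
      = (\<Sum>p\<in>S. Poly_Mapping.lookup x p * path_coord M v j r p)"
    by (rule sum.mono_neutral_left) (use assms in \<open>auto simp: in_keys_iff\<close>)
  then show ?thesis using assms(3,4) by (simp add: rep_module_act)
qed

locale quiver_rep = quiver Q for Q :: "(nat, 'q) pre_digraph" +
  fixes d :: "nat \<Rightarrow> nat" and M :: "'q \<Rightarrow> 'k::field mat"
  assumes M_rep: "M \<in> rep Q d"
begin

abbreviation R where "R \<equiv> rep_module Q d M"
abbreviation KQ where "KQ \<equiv> path_algebra Q :: ('k, 'q path \<Rightarrow>\<^sub>0 'k) module"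

lemma M_carrier: "a \<in> arcs Q \<Longrightarrow> M a \<in> carrier_mat (d (head Q a)) (d (tail Q a))"
  using M_rep by (auto simp: rep_def)

lemma walk_act_carrier: "\<lbrakk>awalk i w j; v \<in> carrier_vec (d i)\<rbrakk> \<Longrightarrow> walk_act M w v \<in> carrier_vec (d j)"
proof (induction w arbitrary: i v)
  case (Cons a w)
  have "a \<in> arcs Q" "i = tail Q a" "awalk (head Q a) w j" using Cons.prems(1) by (simp_all add: awalk_Cons_iff)
  then show ?case using Cons.IH Cons.prems(2) mult_mat_vec_carrier[OF M_carrier] by simp
qed (simp add: awalk_Nil_iff)

lemma walk_act_add:
  "\<lbrakk>awalk i w j; u \<in> carrier_vec (d i); v \<in> carrier_vec (d i)\<rbrakk>
    \<Longrightarrow> walk_act M w (u + v) = walk_act M w u + walk_act M w v"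
proof (induction w arbitrary: i u v)
  case (Cons a w)
  have a: "a \<in> arcs Q" "i = tail Q a" "awalk (head Q a) w j" using Cons.prems(1) by (simp_all add: awalk_Cons_iff)
  note Ma = M_carrier[OF a(1)]
  have "M a *\<^sub>v (u + v) = M a *\<^sub>v u + M a *\<^sub>v v"
    by (rule mult_add_distrib_mat_vec[OF Ma]) (use Cons.prems a in simp_all)
  then show ?case
    using Cons.IH[OF a(3), of "M a *\<^sub>v u" "M a *\<^sub>v v"] mult_mat_vec_carrier[OF Ma] Cons.prems a(2) by simp
qed simp

lemma walk_act_smult:
  "\<lbrakk>awalk i w j; v \<in> carrier_vec (d i)\<rbrakk> \<Longrightarrow> walk_act M w (k \<cdot>\<^sub>v v) = k \<cdot>\<^sub>v walk_act M w v"
proof (induction w arbitrary: i v)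
  case (Cons a w)
  have a: "a \<in> arcs Q" "i = tail Q a" "awalk (head Q a) w j" using Cons.prems(1) by (simp_all add: awalk_Cons_iff)
  note Ma = M_carrier[OF a(1)]
  have "M a *\<^sub>v (k \<cdot>\<^sub>v v) = k \<cdot>\<^sub>v (M a *\<^sub>v v)"
    by (rule mult_mat_vec[OF Ma]) (use Cons.prems a in simp)
  then show ?case
    using Cons.IH[OF a(3), of "M a *\<^sub>v v"] mult_mat_vec_carrier[OF Ma] Cons.prems a(2) by simp
qed simp

lemma walk_act_zero: assumes "awalk i w j" shows "walk_act M w (0\<^sub>v (d i)) = 0\<^sub>v (d j)"
proof -
  have c: "walk_act M w (0\<^sub>v (d i)) \<in> carrier_vec (d j)" by (rule walk_act_carrier[OF assms]) simp
  have "0 \<cdot>\<^sub>v 0\<^sub>v (d i) = (0\<^sub>v (d i) :: 'k vec)" by (rule eq_vecI) simp_all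
  then have "walk_act M w (0\<^sub>v (d i)) = 0 \<cdot>\<^sub>v walk_act M w (0\<^sub>v (d i))"
    using walk_act_smult[OF assms, of "0\<^sub>v (d i)" 0] by simp
  also have "\<dots> = 0\<^sub>v (d j)" by (rule eq_vecI) (use c in simp_all)
  finally show ?thesis .
qed

lemma R_eqI:
  assumes "u \<in> extensional (verts Q)" "v \<in> extensional (verts Q)"
    and "\<And>j. j \<in> verts Q \<Longrightarrow> dim_vec (u j) = d j" "\<And>j. j \<in> verts Q \<Longrightarrow> dim_vec (v j) = d j"
    and "\<And>j r. \<lbrakk>j \<in> verts Q; r < d j\<rbrakk> \<Longrightarrow> u j $ r = v j $ r"
  shows "u = v"
  by (rule extensionalityI[OF assms(1,2)], rule eq_vecI) (use assms(3-5) in simp_all)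

lemma act_mem: "x \<odot>\<^bsub>R\<^esub> v \<in> carrier R"
  by (simp add: rep_module_act)

lemma R_vec: "\<lbrakk>v \<in> carrier R; j \<in> verts Q\<rbrakk> \<Longrightarrow> v j \<in> carrier_vec (d j)"
  by auto

lemma R_dim: "\<lbrakk>v \<in> carrier R; j \<in> verts Q\<rbrakk> \<Longrightarrow> dim_vec (v j) = d j"
  using R_vec carrier_vecD by blast

lemma R_ext: "v \<in> carrier R \<Longrightarrow> v \<in> extensional (verts Q)"
  by (auto simp: PiE_def)

lemma act_ext: "x \<odot>\<^bsub>R\<^esub> v \<in> extensional (verts Q)"
  by (rule R_ext[OF act_mem])

lemma act_dim: "j \<in> verts Q \<Longrightarrow> dim_vec ((x \<odot>\<^bsub>R\<^esub> v) j) = d j"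
  by (rule R_dim[OF act_mem])

lemma R_group: "abelian_group R"
proof (rule abelian_groupI)
  show "\<zero>\<^bsub>R\<^esub> \<in> carrier R" by simp
  fix u assume u: "u \<in> carrier R"
  have "(\<lambda>i\<in>verts Q. - u i) \<in> carrier R" using R_vec[OF u] by simp
  moreover have "(\<lambda>i\<in>verts Q. - u i) \<oplus>\<^bsub>R\<^esub> u = \<zero>\<^bsub>R\<^esub>"
    by (rule R_eqI) (use R_dim[OF u] in simp_all)
  ultimately show "\<exists>y\<in>carrier R. y \<oplus>\<^bsub>R\<^esub> u = \<zero>\<^bsub>R\<^esub>" by blast
  show "\<zero>\<^bsub>R\<^esub> \<oplus>\<^bsub>R\<^esub> u = u" by (rule R_eqI) (use R_dim[OF u] R_ext[OF u] in simp_all)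
  fix v assume v: "v \<in> carrier R"
  show "u \<oplus>\<^bsub>R\<^esub> v \<in> carrier R" using R_vec[OF u] R_vec[OF v] by simp
  show "u \<oplus>\<^bsub>R\<^esub> v = v \<oplus>\<^bsub>R\<^esub> u" by (rule R_eqI) (use R_dim[OF u] R_dim[OF v] in simp_all)
  fix w assume w: "w \<in> carrier R"
  show "u \<oplus>\<^bsub>R\<^esub> v \<oplus>\<^bsub>R\<^esub> w = u \<oplus>\<^bsub>R\<^esub> (v \<oplus>\<^bsub>R\<^esub> w)"
    by (rule R_eqI) (use R_dim[OF u] R_dim[OF v] R_dim[OF w] in \<open>simp_all add: add.assoc\<close>)
qed

lemma act_add_left: "(x + y) \<odot>\<^bsub>R\<^esub> v = x \<odot>\<^bsub>R\<^esub> v \<oplus>\<^bsub>R\<^esub> y \<odot>\<^bsub>R\<^esub> v"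
proof (rule R_eqI)
  let ?S = "Poly_Mapping.keys x \<union> Poly_Mapping.keys y"
  fix j r assume j: "j \<in> verts Q" and r: "r < d j"
  have s: "(z \<odot>\<^bsub>R\<^esub> v) j $ r = (\<Sum>p\<in>?S. Poly_Mapping.lookup z p * path_coord M v j r p)"
    if "Poly_Mapping.keys z \<subseteq> ?S" for z
    by (rule rep_module_act_superset) (use that j r in simp_all)
  show "((x + y) \<odot>\<^bsub>R\<^esub> v) j $ r = (x \<odot>\<^bsub>R\<^esub> v \<oplus>\<^bsub>R\<^esub> y \<odot>\<^bsub>R\<^esub> v) j $ r"
    using j r act_dim[OF j, of x v] act_dim[OF j, of y v]
    by (simp add: s[OF keys_add] s[of x] s[of y] lookup_add distrib_right sum.distrib)
qed (simp_all add: act_ext act_dim)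

lemma act_zero_left: "0 \<odot>\<^bsub>R\<^esub> v = \<zero>\<^bsub>R\<^esub>"
  by (rule R_eqI) (simp_all add: rep_module_act)

lemma act_scale: "\<lbrakk>j \<in> verts Q; r < d j\<rbrakk> \<Longrightarrow> (Poly_Mapping.map ((*) k) x \<odot>\<^bsub>R\<^esub> v) j $ r = k * (x \<odot>\<^bsub>R\<^esub> v) j $ r"
proof -
  assume j: "j \<in> verts Q" and r: "r < d j"
  have "Poly_Mapping.keys (Poly_Mapping.map ((*) k) x) \<subseteq> Poly_Mapping.keys x"
    by (auto simp: in_keys_iff lookup_scale)
  then show ?thesis
    using rep_module_act_superset[of "Poly_Mapping.keys x" "Poly_Mapping.map ((*) k) x" j Q r d M v]
      rep_module_act_superset[of "Poly_Mapping.keys x" x j Q r d M v] j r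
    by (simp add: lookup_scale sum_distrib_left mult.assoc)
qed

lemma act_single:
  assumes "(i, w, j) \<in> paths Q" and v: "v \<in> carrier R"
  shows "Poly_Mapping.single (i, w, j) a \<odot>\<^bsub>R\<^esub> v
    = (\<lambda>l\<in>verts Q. if l = j then a \<cdot>\<^sub>v walk_act M w (v i) else 0\<^sub>v (d l))"
proof (rule R_eqI)
  have w: "awalk i w j" using assms(1) by (simp add: mem_paths)
  have c: "walk_act M w (v i) \<in> carrier_vec (d j)"
    by (rule walk_act_carrier[OF w R_vec[OF v awalk_hd_in_verts[OF w]]])
  show "dim_vec ((\<lambda>l\<in>verts Q. if l = j then a \<cdot>\<^sub>v walk_act M w (v i) else 0\<^sub>v (d l)) l) = d l"
    if "l \<in> verts Q" for l using that c by simp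
  fix l r assume l: "l \<in> verts Q" "r < d l"
  show "(Poly_Mapping.single (i, w, j) a \<odot>\<^bsub>R\<^esub> v) l $ r
      = (\<lambda>l\<in>verts Q. if l = j then a \<cdot>\<^sub>v walk_act M w (v i) else 0\<^sub>v (d l)) l $ r"
    using l c by (subst rep_module_act_superset[of "{(i, w, j)}"]) (auto simp: path_coord_def)
qed (simp_all add: act_ext act_dim)

lemma act_add_right:
  assumes "Poly_Mapping.keys x \<subseteq> paths Q" and u: "u \<in> carrier R" and v: "v \<in> carrier R"
  shows "x \<odot>\<^bsub>R\<^esub> (u \<oplus>\<^bsub>R\<^esub> v) = x \<odot>\<^bsub>R\<^esub> u \<oplus>\<^bsub>R\<^esub> x \<odot>\<^bsub>R\<^esub> v"
  using assms(1)
proof (induction x rule: poly_mapping_additive_induct)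
  case zero
  interpret R: abelian_group R by (rule R_group)
  show ?case unfolding act_zero_left using R.l_zero[OF R.zero_closed] by (rule sym)
next
  case (single p a)
  obtain i w j where p: "p = (i, w, j)" by (cases p)
  have w: "awalk i w j" using single by (simp add: p mem_paths)
  note i = awalk_hd_in_verts[OF w]
  note c = walk_act_carrier[OF w R_vec[OF u i]] walk_act_carrier[OF w R_vec[OF v i]]
  have uv: "u \<oplus>\<^bsub>R\<^esub> v \<in> carrier R" using R_vec[OF u] R_vec[OF v] by simp
  have "walk_act M w ((u \<oplus>\<^bsub>R\<^esub> v) i) = walk_act M w (u i) + walk_act M w (v i)"
    using walk_act_add[OF w R_vec[OF u i] R_vec[OF v i]] i by simp
  then show ?case
    unfolding p act_single[OF single[unfolded p] u] act_single[OF single[unfolded p] v]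
      act_single[OF single[unfolded p] uv]
    unfolding rep_module_simps(3)
    by (intro restrict_ext) (use c smult_add_distrib_vec[of _ "d j"] in auto)
next
  case (add x y)
  interpret R: abelian_group R by (rule R_group)
  show ?case unfolding act_add_left add by (simp only: R.a_ac R.add.m_closed act_mem)
qed

lemma act_assoc:
  assumes x: "Poly_Mapping.keys x \<subseteq> paths Q" and y: "Poly_Mapping.keys y \<subseteq> paths Q" and v: "v \<in> carrier R"
  shows "path_mult x y \<odot>\<^bsub>R\<^esub> v = x \<odot>\<^bsub>R\<^esub> (y \<odot>\<^bsub>R\<^esub> v)"
  using x
proof (induction x rule: poly_mapping_additive_induct)
  case (single p a)
  have pk: "Poly_Mapping.keys (Poly_Mapping.single p a) \<subseteq> paths Q" using single by simp
  from y show ?case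
  proof (induction y rule: poly_mapping_additive_induct)
    case zero
    obtain j' u k where p: "p = (j', u, k)" by (cases p)
    have u: "awalk j' u k" using single by (simp add: p mem_paths)
    have z: "\<zero>\<^bsub>R\<^esub> \<in> carrier R" by simp
    show ?case
      unfolding path_mult_zero act_zero_left p act_single[OF single[unfolded p] z]
      unfolding rep_module_simps(2)
      by (intro restrict_ext eq_vecI) (use walk_act_zero[OF u] awalk_hd_in_verts[OF u] in auto)
  next
    case (single q b)
    obtain j' u k where p: "p = (j', u, k)" by (cases p)
    obtain i w j where q: "q = (i, w, j)" by (cases q)
    have pP: "(j', u, k) \<in> paths Q" and qP: "(i, w, j) \<in> paths Q"
      using \<open>p \<in> paths Q\<close> \<open>q \<in> paths Q\<close> by (simp_all add: p q)
    have u: "awalk j' u k" and w: "awalk i w j" using pP qP by (simp_all add: mem_paths)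
    note c = walk_act_carrier[OF w R_vec[OF v awalk_hd_in_verts[OF w]]]
    have j': "j' \<in> verts Q" by (rule awalk_hd_in_verts[OF u])
    let ?z = "Poly_Mapping.single (i, w, j) b \<odot>\<^bsub>R\<^esub> v"
    have z: "?z j' = (if j' = j then b \<cdot>\<^sub>v walk_act M w (v i) else 0\<^sub>v (d j'))"
      using act_single[OF qP v] j' by simp
    show ?case
    proof (cases "j = j'")
      case True
      then have "(i, w @ u, k) \<in> paths Q" using awalk_appendI[OF w] u by (simp add: mem_paths)
      moreover have "walk_act M u (?z j') = b \<cdot>\<^sub>v walk_act M u (walk_act M w (v i))"
        using walk_act_smult[OF u, of "walk_act M w (v i)"] c True z by simp
      ultimately have "Poly_Mapping.single (i, w @ u, k) (a * b) \<odot>\<^bsub>R\<^esub> v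
          = Poly_Mapping.single (j', u, k) a \<odot>\<^bsub>R\<^esub> ?z"
        unfolding act_single[OF pP act_mem]
        by (simp only: act_single[OF _ v]) (intro restrict_ext, simp add: smult_smult_assoc)
      then show ?thesis using True by (simp only: p q path_mult_single path_term_def prod.case refl if_True)
    next
      case False
      then have "walk_act M u (?z j') = 0\<^sub>v (d k)" using walk_act_zero[OF u] z by simp
      then have "Poly_Mapping.single (j', u, k) a \<odot>\<^bsub>R\<^esub> ?z = \<zero>\<^bsub>R\<^esub>"
        unfolding act_single[OF pP act_mem] rep_module_simps(2) by (intro restrict_ext eq_vecI) auto
      then show ?thesis using False act_zero_left[of v]
        by (simp add: p q path_mult_single path_term_def del: rep_module_simps)
    qed
  next
    case (add y y')
    show ?case unfolding path_mult_add_right act_add_left add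
      by (rule act_add_right[OF pk act_mem act_mem, symmetric])
  qed
next
  case (add x x')
  show ?case unfolding path_mult_add_left act_add_left add by (rule refl)
qed (simp only: path_mult_zero act_zero_left)

lemma act_vertex_sum:
  assumes v: "v \<in> carrier R" and l: "l \<in> verts Q" "r < d l"
  shows "((\<Sum>i\<in>verts Q. Poly_Mapping.single (i, [], i) (c i)) \<odot>\<^bsub>R\<^esub> v) l $ r = c l * v l $ r"
proof -
  have *: "((\<Sum>i\<in>A. Poly_Mapping.single (i, [], i) (c i)) \<odot>\<^bsub>R\<^esub> v) l $ r = (if l \<in> A then c l * v l $ r else 0)"
    if "finite A" "A \<subseteq> verts Q" for A
    using that
  proof (induction A rule: finite_induct)
    case empty
    show ?case using l by (simp add: act_zero_left)
  next
    case (insert i A)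
    have i: "(i, [], i) \<in> paths Q" using insert.prems by (simp add: mem_paths awalk_Nil_iff)
    have "(Poly_Mapping.single (i, [], i) (c i) \<odot>\<^bsub>R\<^esub> v) l $ r = (if l = i then c l * v l $ r else 0)"
      unfolding act_single[OF i v] using l R_dim[OF v l(1)] by auto
    then show ?case
      unfolding sum.insert[OF insert.hyps] act_add_left
      using insert l act_dim[OF l(1)] by auto
  qed
  show ?thesis using *[of "verts Q"] l(1) by simp
qed

lemma act_one:
  assumes v: "v \<in> carrier R"
  shows "(\<Sum>i\<in>verts Q. Poly_Mapping.single (i, [], i) 1) \<odot>\<^bsub>R\<^esub> v = v"
  by (rule R_eqI) (simp_all add: act_vertex_sum[OF v] act_ext act_dim R_ext[OF v] R_dim[OF v])

lemma rep_left_module: "left_module KQ R"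
proof (rule left_moduleI[OF _ R_group])
  show "ring KQ" using path_K_algebra by (rule K_algebra.axioms(1))
  show "c \<odot>\<^bsub>R\<^esub> u \<in> carrier R" for c u by (rule act_mem)
  show "(c \<oplus>\<^bsub>KQ\<^esub> c') \<odot>\<^bsub>R\<^esub> u = c \<odot>\<^bsub>R\<^esub> u \<oplus>\<^bsub>R\<^esub> c' \<odot>\<^bsub>R\<^esub> u" for c c' u
    unfolding path_algebra_simps by (rule act_add_left)
  show "c \<odot>\<^bsub>R\<^esub> (u \<oplus>\<^bsub>R\<^esub> v) = c \<odot>\<^bsub>R\<^esub> u \<oplus>\<^bsub>R\<^esub> c \<odot>\<^bsub>R\<^esub> v"
    if "c \<in> carrier KQ" "u \<in> carrier R" "v \<in> carrier R" for c u v
    by (rule act_add_right[OF _ that(2,3)]) (use that(1) in simp)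
  show "(c \<otimes>\<^bsub>KQ\<^esub> c') \<odot>\<^bsub>R\<^esub> u = c \<odot>\<^bsub>R\<^esub> (c' \<odot>\<^bsub>R\<^esub> u)"
    if "c \<in> carrier KQ" "c' \<in> carrier KQ" "u \<in> carrier R" for c c' u
    unfolding path_algebra_simps(5) by (rule act_assoc[OF _ _ that(3)]) (use that(1,2) in simp_all)
  show "\<one>\<^bsub>KQ\<^esub> \<odot>\<^bsub>R\<^esub> u = u" if "u \<in> carrier R" for u
    unfolding path_algebra_simps by (rule act_one[OF that])
qed

lemma scalar_act_coord:
  assumes v: "v \<in> carrier R" and j: "j \<in> verts Q" and r: "r < d j"
  shows "scalar_act KQ R k v j $ r = k * v j $ r"
  using act_scale[OF j r, of k "\<Sum>i\<in>verts Q. Poly_Mapping.single (i, [], i) 1" v] act_one[OF v]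
  by (simp add: scalar_act_def)

lemma rep_fd: "vectorspace.fin_dim class_ring (underlying_space KQ R)"
proof -
  interpret A: K_algebra KQ by (rule path_K_algebra)
  note Rm = rep_left_module
  interpret V: vectorspace class_ring "underlying_space KQ R" by (rule A.underlying_vectorspace[OF Rm])
  let ?e = "\<lambda>(i, s). \<lambda>j\<in>verts Q. vec (d j) (\<lambda>r. if j = i \<and> r = s then 1 else 0 :: 'k)"
  let ?X = "SIGMA i:verts Q. {..<d i}"
  have e: "?e x \<in> carrier R" for x by (cases x) simp
  have G: "?e ` ?X \<subseteq> carrier (underlying_space KQ R)" using e by auto
  have T: "submodule class_ring (V.span (?e ` ?X)) (underlying_space KQ R)" by (rule V.span_is_submodule[OF G])
  have "v \<in> V.span (?e ` ?X)" if v: "v \<in> carrier R" for v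
  proof -
    let ?f = "\<lambda>x. scalar_act KQ R (case x of (i, s) \<Rightarrow> v i $ s) (?e x)"
    have f: "?f x \<in> carrier R" for x by (rule A.scalar_act_closed[OF Rm e])
    have "finsum R ?f ?X = v"
    proof (rule R_eqI)
      have s: "finsum R ?f ?X \<in> carrier R" by (rule lm_finsum[OF Rm]) (use f in simp)
      show "finsum R ?f ?X \<in> extensional (verts Q)" "v \<in> extensional (verts Q)"
        by (rule R_ext[OF s], rule R_ext[OF v])
      show "dim_vec (finsum R ?f ?X j) = d j" "dim_vec (v j) = d j" if "j \<in> verts Q" for j
        by (rule R_dim[OF s that], rule R_dim[OF v that])
      fix j r assume j: "j \<in> verts Q" and r: "r < d j"
      have "finsum R ?f ?X j $ r = finsum class_ring (\<lambda>x. ?f x j $ r) ?X"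
      proof (rule additive_finsum[OF R_group abelian_group_class_ring, of "\<lambda>u. u j $ r"])
        show "(u \<oplus>\<^bsub>R\<^esub> w) j $ r = u j $ r \<oplus>\<^bsub>class_ring\<^esub> w j $ r" if "u \<in> carrier R" "w \<in> carrier R" for u w
          using R_dim[OF that(2) j] j r by simp
        show "?f \<in> ?X \<rightarrow> carrier R" using f by simp
      qed simp_all
      also have "\<dots> = (\<Sum>x\<in>?X. ?f x j $ r)" by (simp add: class_ring_simps)
      also have "\<dots> = (\<Sum>x\<in>?X. if x = (j, r) then v j $ r else 0)"
        by (rule sum.cong[OF refl]) (use scalar_act_coord[OF e j r] j r in \<open>auto split: prod.splits\<close>)
      also have "\<dots> = v j $ r" using j r by simp
      finally show "finsum R ?f ?X j $ r = v j $ r" .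
    qed
    moreover have "finsum R ?f ?X \<in> V.span (?e ` ?X)"
    proof (rule A.subspace_finsum[OF T R_group])
      fix x assume "x \<in> ?X"
      then have "?e x \<in> V.span (?e ` ?X)" using V.in_own_span[OF G] by blast
      then show "?f x \<in> V.span (?e ` ?X)"
        using submodule.smult_closed[OF T] by simp
    qed simp
    ultimately show ?thesis by simp
  qed
  then have "carrier (underlying_space KQ R) \<subseteq> V.span (?e ` ?X)" by auto
  moreover have "V.span (?e ` ?X) \<subseteq> carrier (underlying_space KQ R)" by (rule submodule.subset[OF T])
  moreover have "finite (?e ` ?X)" by (intro finite_imageI finite_SigmaI) simp_all
  ultimately show ?thesis
    unfolding V.fin_dim_def using G by (intro exI[of _ "?e ` ?X"] conjI subset_antisym)
qed

end

section \<open>Idempotents and dimension vectors\<close>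

lemma idempotent_ideal_annihilates:
  assumes A: "left_module A F" and e: "e \<in> carrier A" and z: "\<And>v. v \<in> carrier F \<Longrightarrow> e \<odot>\<^bsub>F\<^esub> v = \<zero>\<^bsub>F\<^esub>"
  shows "annihilates (idempotent_ideal A e) F"
proof -
  interpret left_module A F by fact
  have "x \<in> carrier A \<and> (\<forall>v\<in>carrier F. x \<odot>\<^bsub>F\<^esub> v = \<zero>\<^bsub>F\<^esub>)" if "x \<in> idempotent_ideal A e" for x
    using that unfolding idempotent_ideal_def
  proof (induction rule: ideal_prod.induct)
    case (prod i j)
    then obtain a where a: "a \<in> carrier A" "i = a \<otimes>\<^bsub>A\<^esub> e" by blast
    have "(i \<otimes>\<^bsub>A\<^esub> j) \<odot>\<^bsub>F\<^esub> v = \<zero>\<^bsub>F\<^esub>" if v: "v \<in> carrier F" for v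
      using z[OF act_closed[OF prod(2) v]] prod(2) a e v lm_act_zero[OF A a(1)]
      by (simp add: act_assoc act_closed)
    then show ?case using a prod(2) e by simp
  next
    case (sum x y)
    then show ?case by (simp add: act_l_distr)
  qed
  then show ?thesis by (simp add: annihilates_def)
qed

context quiver
begin

text \<open>
  The sum \<open>D\<close> collects the trivial paths of \<open>x\<close>.  The first difference is used when \<open>D\<close> acts as zero, the
  second when \<open>x\<close> does.
\<close>

lemma keys_minus_vertex_part:
  fixes x :: "'q path \<Rightarrow>\<^sub>0 'k::field"
  assumes x: "Poly_Mapping.keys x \<subseteq> paths Q"
  defines "D \<equiv> \<Sum>i\<in>verts Q. Poly_Mapping.single (i, [], i) (Poly_Mapping.lookup x (i, [], i))"
  shows "Poly_Mapping.keys (x - D) \<subseteq> long_paths 1" "Poly_Mapping.keys (D - x) \<subseteq> long_paths 1"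
proof -
  have D: "Poly_Mapping.keys D \<subseteq> paths Q" unfolding D_def by (rule keys_vertex_sum)
  have *: "p \<in> long_paths 1" if p: "Poly_Mapping.lookup x p \<noteq> Poly_Mapping.lookup D p" for p
  proof -
    obtain i w j where ijw: "p = (i, w, j)" by (cases p)
    have "p \<in> Poly_Mapping.keys x \<or> p \<in> Poly_Mapping.keys D" using p by (auto simp: in_keys_iff)
    then have "p \<in> paths Q" using x D by blast
    moreover have "w \<noteq> []"
    proof
      assume "w = []"
      then have i: "i \<in> verts Q" "j = i" using \<open>p \<in> paths Q\<close> by (auto simp: ijw mem_paths awalk_Nil_iff)
      have "Poly_Mapping.lookup D p = (\<Sum>l\<in>verts Q. if l = i then Poly_Mapping.lookup x p else 0)"
        unfolding D_def lookup_sum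
        by (rule sum.cong) (auto simp: lookup_single when_def ijw \<open>w = []\<close> i(2))
      also have "\<dots> = Poly_Mapping.lookup x p" using i(1) by simp
      finally show False using p by simp
    qed
    ultimately show ?thesis by (cases w) (simp_all add: long_paths_def ijw)
  qed
  show "Poly_Mapping.keys (x - D) \<subseteq> long_paths 1" "Poly_Mapping.keys (D - x) \<subseteq> long_paths 1"
    using * by (auto simp: in_keys_iff lookup_minus)
qed

end

context quiver_rep
begin

lemma long_act_zero:
  assumes m: "ideal_power KQ (arrow_ideal Q) m \<subseteq> I" and ann: "annihilates I R"
    and x: "Poly_Mapping.keys x \<subseteq> long_paths m" and v: "v \<in> carrier R"
  shows "x \<odot>\<^bsub>R\<^esub> v = \<zero>\<^bsub>R\<^esub>"
  using x
proof (induction x rule: poly_mapping_additive_induct)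
  case zero
  show ?case by (rule act_zero_left)
next
  case (single p a)
  obtain i w j where p: "p = (i, w, j)" by (cases p)
  have "awalk i w j" "m \<le> length w" using single by (simp_all add: p long_paths_def mem_paths)
  then have "Poly_Mapping.single p a \<in> I"
    using single_path_in_arrow_ideal_power[of i w j m a] m unfolding p by blast
  then show ?case using ann v unfolding annihilates_def by blast
next
  case (add x y)
  interpret R: abelian_group R by (rule R_group)
  show ?case unfolding act_add_left add by (rule R.l_zero[OF R.zero_closed])
qed

text \<open>
  The power \<open>y\<^sup>m\<close> involves only paths of length at least \<open>m\<close>, and these lie in \<open>I\<close>.
\<close>

lemma arrow_part_nilpotent:
  assumes m: "ideal_power KQ (arrow_ideal Q) m \<subseteq> I" and ann: "annihilates I R"
    and y: "Poly_Mapping.keys y \<subseteq> long_paths 1" and v: "v \<in> carrier R"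
  shows "((\<lambda>u. y \<odot>\<^bsub>R\<^esub> u) ^^ m) v = \<zero>\<^bsub>R\<^esub>"
proof -
  have yp: "Poly_Mapping.keys y \<subseteq> paths Q" using y by (auto simp: long_paths_def)
  have "\<exists>z. Poly_Mapping.keys z \<subseteq> long_paths n \<and> z \<odot>\<^bsub>R\<^esub> v = ((\<lambda>u. y \<odot>\<^bsub>R\<^esub> u) ^^ n) v" for n
  proof (induction n)
    case 0
    show ?case using keys_vertex_sum[of "\<lambda>_. 1"] act_one[OF v]
      by (intro exI[of _ "\<Sum>i\<in>verts Q. Poly_Mapping.single (i, [], i) 1"]) simp
  next
    case (Suc n)
    then obtain z where z: "Poly_Mapping.keys z \<subseteq> long_paths n" "z \<odot>\<^bsub>R\<^esub> v = ((\<lambda>u. y \<odot>\<^bsub>R\<^esub> u) ^^ n) v"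
      by blast
    have zp: "Poly_Mapping.keys z \<subseteq> paths Q" using z(1) by (auto simp: long_paths_def)
    have "path_mult y z \<odot>\<^bsub>R\<^esub> v = ((\<lambda>u. y \<odot>\<^bsub>R\<^esub> u) ^^ Suc n) v"
      unfolding act_assoc[OF yp zp v] z(2) by simp
    moreover have "Poly_Mapping.keys (path_mult y z) \<subseteq> long_paths (Suc n)"
      using keys_path_mult_long[OF y z(1)] by simp
    ultimately show ?case by blast
  qed
  then obtain z where z: "Poly_Mapping.keys z \<subseteq> long_paths m" "z \<odot>\<^bsub>R\<^esub> v = ((\<lambda>u. y \<odot>\<^bsub>R\<^esub> u) ^^ m) v"
    by blast
  show ?thesis using long_act_zero[OF m ann z(1) v] unfolding z(2) .
qed

text \<open>
  If \<open>x\<close> acts as zero, then its trivial part \<open>D\<close> acts like \<open>D - x\<close>, hence nilpotently.  At the vertex \<open>i\<close> it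
  multiplies the non-zero space \<open>K\<^bsup>d i\<^esup>\<close> by the coefficient of \<open>x\<close>.
\<close>

lemma vertex_coefficient_zero:
  assumes m: "ideal_power KQ (arrow_ideal Q) m \<subseteq> I" and ann: "annihilates I R"
    and x: "Poly_Mapping.keys x \<subseteq> paths Q" and z: "\<And>v. v \<in> carrier R \<Longrightarrow> x \<odot>\<^bsub>R\<^esub> v = \<zero>\<^bsub>R\<^esub>"
    and i: "i \<in> verts Q" "d i > 0"
  shows "Poly_Mapping.lookup x (i, [], i) = 0"
proof -
  interpret R: abelian_group R by (rule R_group)
  let ?c = "\<lambda>i. Poly_Mapping.lookup x (i, [], i)"
  let ?D = "\<Sum>i\<in>verts Q. Poly_Mapping.single (i, [], i) (?c i)"
  have eq: "?D \<odot>\<^bsub>R\<^esub> u = (?D - x) \<odot>\<^bsub>R\<^esub> u" if u: "u \<in> carrier R" for u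
    using act_add_left[of x "?D - x" u] R.l_zero[OF act_mem] z[OF u] by simp
  obtain v where v: "v \<in> carrier R" and vi: "v i $ 0 = 1"
  proof
    show "(\<lambda>j\<in>verts Q. vec (d j) (\<lambda>r. 1 :: 'k)) \<in> carrier R" by simp
    show "(\<lambda>j\<in>verts Q. vec (d j) (\<lambda>r. 1 :: 'k)) i $ 0 = 1" using i by simp
  qed
  let ?u = "\<lambda>n. ((\<lambda>u. ?D \<odot>\<^bsub>R\<^esub> u) ^^ n) v"
  have "?u n = ((\<lambda>u. (?D - x) \<odot>\<^bsub>R\<^esub> u) ^^ n) v \<and> ?u n \<in> carrier R \<and> ?u n i $ 0 = ?c i ^ n" for n
  proof (induction n)
    case 0
    show ?case using v vi by simp
  next
    case (Suc n)
    then have n: "?u n = ((\<lambda>u. (?D - x) \<odot>\<^bsub>R\<^esub> u) ^^ n) v" "?u n \<in> carrier R" "?u n i $ 0 = ?c i ^ n"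
      by blast+
    have s: "?u (Suc n) = ?D \<odot>\<^bsub>R\<^esub> ?u n" by simp
    show ?case
    proof (intro conjI)
      show "?u (Suc n) = ((\<lambda>u. (?D - x) \<odot>\<^bsub>R\<^esub> u) ^^ Suc n) v"
        by (rule trans[OF s trans[OF eq[OF n(2)]]]) (simp only: n(1) funpow.simps o_apply)
      show "?u (Suc n) \<in> carrier R" unfolding s by (rule act_mem)
      show "?u (Suc n) i $ 0 = ?c i ^ Suc n" unfolding s act_vertex_sum[OF n(2) i, of ?c] n(3) by simp
    qed
  qed
  from this[of m] have "?u m = ((\<lambda>u. (?D - x) \<odot>\<^bsub>R\<^esub> u) ^^ m) v" and "?u m i $ 0 = ?c i ^ m" by blast+
  then have "?c i ^ m = \<zero>\<^bsub>R\<^esub> i $ 0"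
    unfolding arrow_part_nilpotent[OF m ann keys_minus_vertex_part(2)[OF x] v] by simp
  then show ?thesis using i by simp
qed

text \<open>
  The trivial part of \<open>x\<close> acts as zero, so \<open>x\<close> acts like an element supported on paths of positive length,
  that is, nilpotently.  A nilpotent idempotent is zero.
\<close>

lemma idempotent_acts_zero:
  assumes m: "ideal_power KQ (arrow_ideal Q) m \<subseteq> I" and ann: "annihilates I R"
    and x: "Poly_Mapping.keys x \<subseteq> paths Q"
    and c: "\<And>i. \<lbrakk>i \<in> verts Q; d i > 0\<rbrakk> \<Longrightarrow> Poly_Mapping.lookup x (i, [], i) = 0"
    and idem: "\<And>v. v \<in> carrier R \<Longrightarrow> x \<odot>\<^bsub>R\<^esub> (x \<odot>\<^bsub>R\<^esub> v) = x \<odot>\<^bsub>R\<^esub> v"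
    and v: "v \<in> carrier R"
  shows "x \<odot>\<^bsub>R\<^esub> v = \<zero>\<^bsub>R\<^esub>"
proof -
  interpret R: abelian_group R by (rule R_group)
  let ?D = "\<Sum>i\<in>verts Q. Poly_Mapping.single (i, [], i) (Poly_Mapping.lookup x (i, [], i))"
  have "?D \<odot>\<^bsub>R\<^esub> u = \<zero>\<^bsub>R\<^esub>" if u: "u \<in> carrier R" for u
    by (rule R_eqI) (use c in \<open>simp_all add: act_ext act_dim act_vertex_sum[OF u]\<close>)
  then have eq: "x \<odot>\<^bsub>R\<^esub> u = (x - ?D) \<odot>\<^bsub>R\<^esub> u" if u: "u \<in> carrier R" for u
    using act_add_left[of ?D "x - ?D" u] R.l_zero[OF act_mem[of "x - ?D" u]] u by simp
  have "((\<lambda>u. (x - ?D) \<odot>\<^bsub>R\<^esub> u) ^^ n) (x \<odot>\<^bsub>R\<^esub> v) = x \<odot>\<^bsub>R\<^esub> v" for n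
  proof (induction n)
    case (Suc n)
    have "(x - ?D) \<odot>\<^bsub>R\<^esub> (x \<odot>\<^bsub>R\<^esub> v) = x \<odot>\<^bsub>R\<^esub> v"
      using eq[OF act_mem[of x v]] idem[OF v] by (rule trans[OF sym])
    then show ?case using Suc by (simp only: funpow.simps o_apply)
  qed simp
  from this[of m] show ?thesis
    unfolding arrow_part_nilpotent[OF m ann keys_minus_vertex_part(1)[OF x] act_mem] by (rule sym)
qed

end

text \<open>
  That \<open>e\<close> kills \<open>M\<close> forces the trivial path coefficients of a representative of \<open>e\<close> to vanish at the
  vertices with \<open>d i > 0\<close>.  This condition does not involve \<open>M\<close> any more, and it makes \<open>e\<close> kill every
  point of \<open>mod(A, d)\<close>.
\<close>

lemma (in quiver) quotient_mod_var_eq: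
  fixes I :: "('q path \<Rightarrow>\<^sub>0 'k::field) set"
  assumes I: "ideal I (path_algebra Q)"
    and m: "ideal_power (path_algebra Q) (arrow_ideal Q) m \<subseteq> I"
    and e: "e \<in> carrier (quotient_algebra (path_algebra Q) I)" "e \<otimes>\<^bsub>quotient_algebra (path_algebra Q) I\<^esub> e = e"
    and M: "M \<in> quotient_mod_var Q I e d"
  shows "quotient_mod_var Q I e d = mod_var Q I d"
proof (intro equalityI subsetI)
  show "N \<in> mod_var Q I d" if "N \<in> quotient_mod_var Q I e d" for N
    using that by (simp add: quotient_mod_var_def)
  let ?KQ = "path_algebra Q :: ('k, 'q path \<Rightarrow>\<^sub>0 'k) module"
  let ?A = "quotient_algebra ?KQ I"
  interpret AI: algebra_ideal ?KQ I by (intro algebra_ideal.intro path_K_algebra I)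
  interpret A: K_algebra ?A by (rule AI.quotient_K_algebra)
  obtain x where x: "x \<in> carrier ?KQ" "e = AI.residue x" using AI.residue_obtain[OF e(1)] by blast
  have xp: "Poly_Mapping.keys x \<subseteq> paths Q" using x(1) by simp
  have M': "M \<in> rep Q d" "annihilates I (rep_module Q d M)"
    "annihilates (idempotent_ideal ?A e) (mod_of_rep Q d M)"
    using M by (simp_all add: quotient_mod_var_def mod_var_def)
  interpret M: quiver_rep Q d M by (unfold_locales) (rule M'(1))
  have "(\<one>\<^bsub>?A\<^esub> \<otimes>\<^bsub>?A\<^esub> e) \<otimes>\<^bsub>?A\<^esub> \<one>\<^bsub>?A\<^esub> \<in> idempotent_ideal ?A e"
    unfolding idempotent_ideal_def by (rule ideal_prod.prod[OF _ A.one_closed]) (use A.one_closed in blast)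
  then have eJ: "e \<in> idempotent_ideal ?A e" unfolding A.l_one[OF e(1)] A.r_one[OF e(1)] .
  have Mx: "x \<odot>\<^bsub>M.R\<^esub> v = \<zero>\<^bsub>M.R\<^esub>" if v: "v \<in> carrier M.R" for v
  proof -
    have "e \<odot>\<^bsub>mod_of_rep Q d M\<^esub> v = \<zero>\<^bsub>mod_of_rep Q d M\<^esub>"
      using M'(3) eJ v unfolding annihilates_def mod_of_rep_def factor_module_simps by blast
    then show ?thesis
      unfolding mod_of_rep_def x(2) AI.factor_act[OF M.rep_left_module M'(2) x(1) v] factor_module_simps .
  qed
  note c = M.vertex_coefficient_zero[OF m M'(2) xp Mx]
  fix N assume N: "N \<in> mod_var Q I d"
  then have N': "N \<in> rep Q d" "annihilates I (rep_module Q d N)" by (simp_all add: mod_var_def)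
  interpret N: quiver_rep Q d N by (unfold_locales) (rule N'(1))
  note Nm = AI.factor_left_module[OF N.rep_left_module N'(2)]
  note act = AI.factor_act[OF N.rep_left_module N'(2) x(1), folded x(2)]
  have idem: "x \<odot>\<^bsub>N.R\<^esub> (x \<odot>\<^bsub>N.R\<^esub> v) = x \<odot>\<^bsub>N.R\<^esub> v" if v: "v \<in> carrier N.R" for v
  proof -
    have v': "v \<in> carrier (factor_module N.R)" unfolding factor_module_simps by (rule v)
    have "(e \<otimes>\<^bsub>?A\<^esub> e) \<odot>\<^bsub>factor_module N.R\<^esub> v
        = e \<odot>\<^bsub>factor_module N.R\<^esub> (e \<odot>\<^bsub>factor_module N.R\<^esub> v)"
      by (rule lm_assoc[OF Nm e(1) e(1) v'])
    then show ?thesis unfolding e(2) act[OF v] act[OF N.act_mem] by (rule sym)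
  qed
  have "annihilates (idempotent_ideal ?A e) (factor_module N.R)"
  proof (rule idempotent_ideal_annihilates[OF Nm e(1)])
    fix v assume "v \<in> carrier (factor_module N.R)"
    then have v: "v \<in> carrier N.R" unfolding factor_module_simps .
    show "e \<odot>\<^bsub>factor_module N.R\<^esub> v = \<zero>\<^bsub>factor_module N.R\<^esub>"
      unfolding act[OF v] factor_module_simps by (rule N.idempotent_acts_zero[OF m N'(2) xp c idem v])
  qed
  then show "N \<in> quotient_mod_var Q I e d" using N by (simp add: quotient_mod_var_def mod_of_rep_def)
qed

theorem theorem1p2:
  fixes Q :: "(nat, 'q) pre_digraph" and n :: nat
    and I :: "('q path \<Rightarrow>\<^sub>0 'k::alg_closed_field) set"
    and A :: "('k, ('q path \<Rightarrow>\<^sub>0 'k) set) module"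
    and e :: "('q path \<Rightarrow>\<^sub>0 'k) set"
    and B :: "('k, ('q path \<Rightarrow>\<^sub>0 'k) set set) module"
    and d :: "nat \<Rightarrow> nat"
    and M :: "'q \<Rightarrow> 'k mat"
  assumes "fin_digraph Q" and "verts Q = {1..n}"
    and "admissible_ideal Q I"
    and "A = quotient_algebra (path_algebra Q) I"
    and "e \<in> carrier A" and "e \<otimes>\<^bsub>A\<^esub> e = e"
    and "B = quotient_algebra A (idempotent_ideal A e)"
    and "M \<in> quotient_mod_var Q I e d"
  shows "tau_regular Q d A (mod_var Q I d) (mod_of_rep Q d) M \<longleftrightarrow>
         tau_regular Q d B (quotient_mod_var Q I e d) (quotient_mod_of_rep Q d) M"
proof -
  interpret quiver Q using assms(1) by (rule quiver.intro)
  obtain m where I: "ideal I (path_algebra Q)" and m: "ideal_power (path_algebra Q) (arrow_ideal Q) m \<subseteq> I"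
    using assms(3) unfolding admissible_ideal_def by blast
  interpret AI: algebra_ideal "path_algebra Q" I by (intro algebra_ideal.intro path_K_algebra I)
  interpret A: K_algebra A unfolding assms(4) by (rule AI.quotient_K_algebra)
  have A_fd: "fd_module A (regular_module A)" unfolding assms(4) by (rule path_quotient_fd[OF I m])
  note e = assms(5,6)
  interpret AJ: algebra_ideal A "idempotent_ideal A e"
    by (intro algebra_ideal.intro A.K_algebra_axioms)
      (unfold idempotent_ideal_def, rule A.idempotent_ideal_ideal[OF e(1)])
  have M: "M \<in> rep Q d" "annihilates I (rep_module Q d M)"
    "annihilates (idempotent_ideal A e) (mod_of_rep Q d M)"
    using assms(8) by (simp_all only: quotient_mod_var_def mod_var_def assms(4) mem_Collect_eq)
  interpret M: quiver_rep Q d M by (intro quiver_rep.intro quiver_axioms quiver_rep_axioms.intro M(1))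
  have "fd_module A (mod_of_rep Q d M)"
    unfolding assms(4) mod_of_rep_def by (rule AI.factor_fd[OF M.rep_left_module M(2) M.rep_fd])
  moreover have "idempotent_ideal A e
      \<subseteq> ideal_prod A (idempotent_ideal A e) (idempotent_ideal A e)"
    unfolding idempotent_ideal_def by (rule A.idempotent_ideal_idem[OF e])
  ultimately have E: "E_invariant A (mod_of_rep Q d M) = E_invariant B (quotient_mod_of_rep Q d M)"
    unfolding assms(7) quotient_mod_of_rep_def using A_fd M(3) by (intro AJ.E_invariant_factor)
  have "quotient_mod_var Q I e d = mod_var Q I d"
    by (rule quotient_mod_var_eq[OF I m e[unfolded assms(4)] assms(8)])
  then show ?thesis unfolding tau_regular_def E by simp
qed

end
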